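(* Let $H_0f=-f''$, $f\in\operatorname{dom}(H_0)=H^2(\mathbb R)$, in $L^2(\mathbb R)$. If $V\in H^{-1}(\mathbb R)$, then $$(H_0+\kappa^2I_{L^2(\mathbb R)})^{-1/2}\,V\,(H_0+\kappa^2I_{L^2(\mathbb R)})^{-1/2}\in\mathcal B_2(L^2(\mathbb R)),\quad\kappa\in(0,\infty),\qquad( * )$$ and $$\Big\|(H_0+\kappa^2I_{L^2(\mathbb R)})^{-1/2}V(H_0+\kappa^2I_{L^2(\mathbb R)})^{-1/2}\Big\|_{\mathcal B_2(L^2(\mathbb R))}^2=\frac1\kappa\int_{\mathbb R}\frac{|\widehat V(\xi)|^2}{\xi^2+4\kappa^2}\,d\xi,\quad\kappa\in(0,\infty).$$ In particular, $$\lim_{\kappa\to\infty}\Big\|(H_0+\kappa^2I_{L^2(\mathbb R)})^{-1/2}V(H_0+\kappa^2I_{L^2(\mathbb R)})^{-1/2}\Big\|_{\mathcal B_2(L^2(\mathbb R))}=0.$$ Moreover, for a Sobolev multiplier $V\in\mathcal S'(\mathbb R)$ from $H^1(\mathbb R)$ to $H^{-1}(\mathbb R)$, the Hilbert--Schmidt property $( * )$ holds if and only if $V\in H^{-1}(\mathbb R)$.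
   Context: $\mathcal B_2(L^2(\mathbb R))$ is the Hilbert--Schmidt class. Fourier transform: $\widehat f(\xi)=(2\pi)^{-1/2}\int_{\mathbb R}e^{-i\xi x}f(x)\,dx$, extended to tempered distributions. For $s\in\mathbb R$, $H^s(\mathbb R)=\{T\in\mathcal S'(\mathbb R)\,|\,(1+|\cdot|^2)^{s/2}\widehat T\in L^2(\mathbb R)\}$ with norm $\|T\|_{H^s(\mathbb R)}=\|(1+|\cdot|^2)^{s/2}\widehat T\|_{L^2(\mathbb R)}$; $H^{-1}(\mathbb R)=[H^1(\mathbb R)]^*$ (conjugate dual). Distributional pairings are conjugate linear in the first slot, $\langle\psi,T\rangle=\int\overline\psi\,T$ for functions $T$. For $V\in\mathcal S'(\mathbb R)$ and $\varphi\in\mathcal S(\mathbb R)$, $V\varphi\in\mathcal S'(\mathbb R)$ is defined by $\langle\psi,V\varphi\rangle:=\langle\overline\varphi\,\psi,V\rangle$, $\psi\in\mathcal S(\mathbb R)$. $V$ is called a Sobolev multiplier from $H^1(\mathbb R)$ to $H^{-1}(\mathbb R)$ if there is $C_V\in(0,\infty)$ with $|\langle\psi,V\varphi\rangle|\le C_V\|\psi\|_{H^1(\mathbb R)}\|\varphi\|_{H^1(\mathbb R)}$ for all $\varphi,\psi\in\mathcal S(\mathbb R)$; in that case the form extends by continuity to $H^1(\mathbb R)$ and defines a bounded operator, again denoted $V$, from $H^1(\mathbb R)$ to $H^{-1}(\mathbb R)$. Every $V\in H^{-1}(\mathbb R)$ is such a multiplier, with $C_V=2^{1/2}\|V\|_{H^{-1}(\mathbb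 R)}$. For $\kappa>0$, $(H_0+\kappa^2I_{L^2(\mathbb R)})^{-1/2}$ is the Fourier multiplier by $(\xi^2+\kappa^2)^{-1/2}$ (positive root), which is bounded from $L^2(\mathbb R)$ to $H^1(\mathbb R)$ and from $H^{-1}(\mathbb R)$ to $L^2(\mathbb R)$; the operator in $( * )$ is the composition $L^2(\mathbb R)\to H^1(\mathbb R)\to H^{-1}(\mathbb R)\to L^2(\mathbb R)$. *)

theory Defs
  imports "HOL-Analysis.Analysis"
begin

section \<open>Square-integrable functions and operators on them\<close>

text \<open>
  Elements of \<open>L\<^sup>2(\<real>)\<close> are represented by functions \<open>real \<Rightarrow> complex\<close>, and equality in
  \<open>L\<^sup>2(\<real>)\<close> is equality almost everywhere. All inner products and pairings are conjugate linear in
  the first slot.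
\<close>

definition L2 :: "(real \<Rightarrow> complex) set" where
  "L2 = {f. f \<in> borel_measurable lborel \<and> integrable lborel (\<lambda>x. (cmod (f x))\<^sup>2)}"

definition L2_inner :: "(real \<Rightarrow> complex) \<Rightarrow> (real \<Rightarrow> complex) \<Rightarrow> complex" where
  "L2_inner f g = (LINT x|lborel. cnj (f x) * g x)"

definition L2_norm :: "(real \<Rightarrow> complex) \<Rightarrow> real" where
  "L2_norm f = sqrt (LINT x|lborel. (cmod (f x))\<^sup>2)"

text \<open>
  Compatibility of \<open>A\<close> with equality almost everywhere need not be required separately: it
  follows from linearity and boundedness.
\<close>

definition L2_bounded_op :: "((real \<Rightarrow> complex) \<Rightarrow> (real \<Rightarrow> complex)) \<Rightarrow> bool" where
  "L2_bounded_op A \<longleftrightarrow>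
     (\<forall>f\<in>L2. A f \<in> L2) \<and>
     (\<forall>f\<in>L2. \<forall>g\<in>L2. AE x in lborel. A (\<lambda>y. f y + g y) x = A f x + A g x) \<and>
     (\<forall>c. \<forall>f\<in>L2. AE x in lborel. A (\<lambda>y. c * f y) x = c * A f x) \<and>
     (\<exists>C. \<forall>f\<in>L2. L2_norm (A f) \<le> C * L2_norm f)"

text \<open>
  In an orthonormal set no two distinct functions agree almost everywhere, so summing over such a
  set of functions counts every element of \<open>L\<^sup>2(\<real>)\<close> only once.
\<close>

definition L2_orthonormal_basis :: "(real \<Rightarrow> complex) set \<Rightarrow> bool" where
  "L2_orthonormal_basis B \<longleftrightarrow>
     B \<subseteq> L2 \<and>
     (\<forall>e\<in>B. \<forall>e'\<in>B. L2_inner e e' = (if e = e' then 1 else 0)) \<and>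
     (\<forall>f\<in>L2. (\<forall>e\<in>B. L2_inner e f = 0) \<longrightarrow> (AE x in lborel. f x = 0))"

definition hilbert_schmidt :: "((real \<Rightarrow> complex) \<Rightarrow> (real \<Rightarrow> complex)) \<Rightarrow> bool" where
  "hilbert_schmidt A \<longleftrightarrow>
     L2_bounded_op A \<and>
     (\<exists>B. L2_orthonormal_basis B \<and> (\<lambda>e. (L2_norm (A e))\<^sup>2) summable_on B)"

text \<open>The value does not depend on the orthonormal basis that is chosen.\<close>

definition hs_norm :: "((real \<Rightarrow> complex) \<Rightarrow> (real \<Rightarrow> complex)) \<Rightarrow> real" where
  "hs_norm A = sqrt (\<Sum>\<^sub>\<infinity>e\<in>(SOME B. L2_orthonormal_basis B). (L2_norm (A e))\<^sup>2)"


section \<open>Schwartz functions and tempered distributions\<close>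

definition vderiv :: "(real \<Rightarrow> complex) \<Rightarrow> real \<Rightarrow> complex" where
  "vderiv f = (\<lambda>x. vector_derivative f (at x))"

definition schwartz :: "(real \<Rightarrow> complex) set" where
  "schwartz = {\<phi>. \<forall>k.
     (\<forall>x. (vderiv ^^ k) \<phi> differentiable (at x)) \<and>
     (\<forall>j. bounded (range (\<lambda>x. x ^ j *\<^sub>R (vderiv ^^ k) \<phi> x)))}"

definition schwartz_seminorm :: "nat \<Rightarrow> nat \<Rightarrow> (real \<Rightarrow> complex) \<Rightarrow> real" where
  "schwartz_seminorm j k \<phi> = (SUP x. norm (x ^ j *\<^sub>R (vderiv ^^ k) \<phi> x))"

text \<open>
  A distribution \<open>T\<close> is represented by the functional \<open>\<psi> \<mapsto> \<langle>\<psi>, T\<rangle>\<close>, which is therefore conjugate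
  linear. Only its values on \<^const>\<open>schwartz\<close> are meaningful. The last clause is continuity with
  respect to the Schwartz seminorms.
\<close>

type_synonym dist = "(real \<Rightarrow> complex) \<Rightarrow> complex"

definition tempered :: "dist set" where
  "tempered = {T.
     (\<forall>\<phi>\<in>schwartz. \<forall>\<psi>\<in>schwartz. T (\<lambda>x. \<phi> x + \<psi> x) = T \<phi> + T \<psi>) \<and>
     (\<forall>c. \<forall>\<phi>\<in>schwartz. T (\<lambda>x. c * \<phi> x) = cnj c * T \<phi>) \<and>
     (\<exists>C N. \<forall>\<phi>\<in>schwartz. cmod (T \<phi>) \<le> C * (\<Sum>j\<le>N. \<Sum>k\<le>N. schwartz_seminorm j k \<phi>))}"

definition dist_of_fun :: "(real \<Rightarrow> complex) \<Rightarrow> dist" where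
  "dist_of_fun f = (\<lambda>\<psi>. LINT x|lborel. cnj (\<psi> x) * f x)"

definition is_function :: "dist \<Rightarrow> (real \<Rightarrow> complex) \<Rightarrow> bool" where
  "is_function T g \<longleftrightarrow>
     g \<in> borel_measurable lborel \<and>
     (\<forall>\<psi>\<in>schwartz. integrable lborel (\<lambda>x. cnj (\<psi> x) * g x) \<and> T \<psi> = dist_of_fun g \<psi>)"

text \<open>For a distribution that is a function, that function (unique up to null sets).\<close>

definition fun_of_dist :: "dist \<Rightarrow> (real \<Rightarrow> complex)" where
  "fun_of_dist T = (SOME g. is_function T g)"

text \<open>
  The product \<open>m T\<close>, given by \<open>\<langle>\<psi>, m T\<rangle> = \<langle>m\<^sup>* \<psi>, T\<rangle>\<close>. It is used for functions \<open>m\<close> such that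
  multiplication by \<open>m\<close> maps \<^const>\<open>schwartz\<close> into itself.
\<close>

definition dist_mult :: "(real \<Rightarrow> complex) \<Rightarrow> dist \<Rightarrow> dist" where
  "dist_mult m T = (\<lambda>\<psi>. T (\<lambda>x. cnj (m x) * \<psi> x))"

definition fourier :: "(real \<Rightarrow> complex) \<Rightarrow> real \<Rightarrow> complex" where
  "fourier f \<xi> =
     complex_of_real ((2 * pi) powr (- 1 / 2)) *
     (LINT x|lborel. exp (- \<i> * complex_of_real (\<xi> * x)) * f x)"

definition inv_fourier :: "(real \<Rightarrow> complex) \<Rightarrow> real \<Rightarrow> complex" where
  "inv_fourier f x =
     complex_of_real ((2 * pi) powr (- 1 / 2)) *
     (LINT \<xi>|lborel. exp (\<i> * complex_of_real (x * \<xi>)) * f \<xi>)"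

text \<open>
  Since pairings are conjugate linear in the first slot, the extension of the Fourier transform
  \<open>F\<close> to distributions reads \<open>\<langle>\<psi>, F T\<rangle> = \<langle>F\<^sup>-\<^sup>1 \<psi>, T\<rangle>\<close>, and likewise with \<open>F\<close> and
  \<open>F\<^sup>-\<^sup>1\<close> exchanged.
\<close>

definition dist_fourier :: "dist \<Rightarrow> dist" where
  "dist_fourier T = (\<lambda>\<psi>. T (inv_fourier \<psi>))"

definition dist_inv_fourier :: "dist \<Rightarrow> dist" where
  "dist_inv_fourier T = (\<lambda>\<psi>. T (fourier \<psi>))"


section \<open>Sobolev spaces and Sobolev multipliers\<close>

definition sobolev_weighted :: "real \<Rightarrow> dist \<Rightarrow> dist" where
  "sobolev_weighted s T =
     dist_mult (\<lambda>\<xi>. complex_of_real ((1 + \<xi>\<^sup>2) powr (s / 2))) (dist_fourier T)"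

definition sobolev :: "real \<Rightarrow> dist set" where
  "sobolev s = {T \<in> tempered. \<exists>g\<in>L2. is_function (sobolev_weighted s T) g}"

definition sobolev_norm :: "real \<Rightarrow> dist \<Rightarrow> real" where
  "sobolev_norm s T = L2_norm (fun_of_dist (sobolev_weighted s T))"

text \<open>For Schwartz \<open>\<phi>\<close>, the distribution \<open>V \<phi>\<close> is \<^term>\<open>dist_mult \<phi> V\<close>.\<close>

definition sobolev_multiplier :: "dist \<Rightarrow> bool" where
  "sobolev_multiplier V \<longleftrightarrow>
     V \<in> tempered \<and>
     (\<exists>C>0. \<forall>\<phi>\<in>schwartz. \<forall>\<psi>\<in>schwartz.
        cmod (dist_mult \<phi> V \<psi>)
          \<le> C * sobolev_norm 1 (dist_of_fun \<psi>) * sobolev_norm 1 (dist_of_fun \<phi>))"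

text \<open>
  The operator from \<open>H\<^sup>1(\<real>)\<close> to \<open>H\<^sup>-\<^sup>1(\<real>)\<close> induced by a Sobolev multiplier \<open>V\<close>: the extension by
  continuity of \<open>\<phi> \<mapsto> V \<phi>\<close> from Schwartz functions to \<open>u\<close> in \<open>H\<^sup>1(\<real>)\<close>, namely
  \<open>\<langle>\<psi>, V u\<rangle> = lim \<langle>\<psi>, V \<phi>\<^sub>n\<rangle>\<close> whenever \<open>\<phi>\<^sub>n\<close> are Schwartz functions tending to \<open>u\<close> in \<open>H\<^sup>1(\<real>)\<close>.
\<close>

definition multiplier_op :: "dist \<Rightarrow> dist \<Rightarrow> dist" where
  "multiplier_op V u = (\<lambda>\<psi>. THE z. \<forall>\<phi> :: nat \<Rightarrow> real \<Rightarrow> complex.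
     (\<forall>n. \<phi> n \<in> schwartz) \<and>
     (\<lambda>n. sobolev_norm 1 (\<lambda>\<eta>. dist_of_fun (\<phi> n) \<eta> - u \<eta>)) \<longlonglongrightarrow> 0
     \<longrightarrow> (\<lambda>n. dist_mult (\<phi> n) V \<psi>) \<longlonglongrightarrow> z)"

text \<open>
  \<open>(H\<^sub>0 + \<kappa>\<^sup>2)\<^sup>-\<^sup>1\<^sup>/\<^sup>2\<close> for \<open>H\<^sub>0 f = - f''\<close> with domain \<open>H\<^sup>2(\<real>)\<close>, as the Fourier multiplier with symbol
  \<open>(\<xi>\<^sup>2 + \<kappa>\<^sup>2)\<^sup>-\<^sup>1\<^sup>/\<^sup>2\<close> on tempered distributions. Its restrictions are the maps from \<open>L\<^sup>2(\<real>)\<close> to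
  \<open>H\<^sup>1(\<real>)\<close> and from \<open>H\<^sup>-\<^sup>1(\<real>)\<close> to \<open>L\<^sup>2(\<real>)\<close>.
\<close>

definition H0_root :: "real \<Rightarrow> dist \<Rightarrow> dist" where
  "H0_root \<kappa> T =
     dist_inv_fourier
       (dist_mult (\<lambda>\<xi>. complex_of_real ((\<xi>\<^sup>2 + \<kappa>\<^sup>2) powr (- 1 / 2))) (dist_fourier T))"

text \<open>\<open>(H\<^sub>0 + \<kappa>\<^sup>2)\<^sup>-\<^sup>1\<^sup>/\<^sup>2 V (H\<^sub>0 + \<kappa>\<^sup>2)\<^sup>-\<^sup>1\<^sup>/\<^sup>2\<close> as an operator in \<open>L\<^sup>2(\<real>)\<close>.\<close>

definition sandwiched :: "real \<Rightarrow> dist \<Rightarrow> (real \<Rightarrow> complex) \<Rightarrow> (real \<Rightarrow> complex)" where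
  "sandwiched \<kappa> V f =
     fun_of_dist (H0_root \<kappa> (multiplier_op V (H0_root \<kappa> (dist_of_fun f))))"

end

theory Submission
  imports Defs "HOL-Probability.Probability" "HOL-Real_Asymp.Real_Asymp"
begin

text \<open>
  The Fourier transform turns multiplication by \<open>V\<close> into convolution with its transform \<open>Vhat\<close>, so that the sandwiched
  operator becomes the integral operator on \<open>L\<^sup>2(\<real>)\<close> with kernel
    \<open>K(\<xi>, \<eta>) = (2\<pi>)\<^sup>-\<^sup>1\<^sup>/\<^sup>2 (\<xi>\<^sup>2 + \<kappa>\<^sup>2)\<^sup>-\<^sup>1\<^sup>/\<^sup>2 Vhat(\<xi> - \<eta>) (\<eta>\<^sup>2 + \<kappa>\<^sup>2)\<^sup>-\<^sup>1\<^sup>/\<^sup>2\<close>.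
  The Hilbert--Schmidt norm of an integral operator is the \<open>L\<^sup>2\<close> norm of its kernel
  (\<open>kernel_op_hilbert_schmidt_sum\<close>). Integrating \<open>|K|\<^sup>2\<close> along the lines where \<open>\<xi> - \<eta> = \<zeta>\<close> is constant leaves
  the convolution of the Cauchy density \<open>1 / (\<eta>\<^sup>2 + \<kappa>\<^sup>2)\<close> with itself, which is \<open>2\<pi> / (\<kappa> (\<zeta>\<^sup>2 + 4\<kappa>\<^sup>2))\<close>
  (\<open>cauchy_convolution\<close>). This is the asserted formula, and the norm is \<open>O(\<kappa>\<^sup>-\<^sup>1\<^sup>/\<^sup>2)\<close> as \<open>\<kappa> \<rightarrow> \<infinity>\<close>. The identification
  with an integral operator is \<open>V_form_kernel\<close> on Schwartz functions and \<open>sandwiched_fourier\<close> on \<open>L\<^sup>2\<close>.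

  For the converse let \<open>A\<close> be the sandwiched operator for \<open>\<kappa> = 1\<close>, assumed to be Hilbert--Schmidt, where \<open>V\<close> is
  only a Sobolev multiplier and \<open>Vhat\<close> need not be a function. Multiplication by a Gaussian
  \<open>g\<^sub>\<epsilon>(x) = exp (-\<epsilon>\<^sup>2x\<^sup>2/2)\<close> repairs this: the Fourier transform of \<open>g\<^sub>\<epsilon> V\<close> is a function \<open>W\<close>, because \<open>V\<close> maps
  \<open>g\<^sub>\<epsilon> \<in> H\<^sup>1\<close> into \<open>H\<^sup>-\<^sup>1\<close>. Choose wave packets \<open>p\<^sub>h\<close> that the root of the resolvent maps to \<open>e\<^sup>i\<^sup>h\<^sup>x g\<^sub>\<epsilon>\<close>. Then the
  Fourier transform of \<open>A p\<^sub>h\<close> is \<open>(1 + \<xi>\<^sup>2)\<^sup>-\<^sup>1\<^sup>/\<^sup>2 W(\<xi> - h)\<close>, and the convolution formula shows that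
    \<open>\<integral> \<parallel>A p\<^sub>h\<parallel>\<^sup>2 / (1 + h\<^sup>2) dh = \<integral> |W(\<zeta>)|\<^sup>2 2\<pi> / (\<zeta>\<^sup>2 + 4) d\<zeta>\<close>
  controls the \<open>H\<^sup>-\<^sup>1\<close> norm of \<open>g\<^sub>\<epsilon> V\<close>. The weighted packets satisfy an upper frame bound
  \<open>\<integral> |\<langle>f, p\<^sub>h\<rangle>|\<^sup>2 / (1 + h\<^sup>2) dh \<le> c \<parallel>f\<parallel>\<^sup>2\<close> (\<open>packet_frame_bound\<close>), so the left-hand side is at most \<open>c\<close> times the
  squared Hilbert--Schmidt norm of \<open>A\<close>. The constant \<open>c\<close> does not depend on \<open>\<epsilon> \<le> 1\<close>. Letting \<open>\<epsilon> \<rightarrow> 0\<close> yields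
  \<open>|\<langle>\<psi>, V\<rangle>| \<le> c' \<parallel>\<psi>\<parallel>\<close> in \<open>H\<^sup>1\<close> for Schwartz \<open>\<psi>\<close>, and hence \<open>V \<in> H\<^sup>-\<^sup>1\<close>.

  The functional analysis rests on one representation theorem, \<open>L2_Riesz\<close>, for antilinear functionals on
  subspaces of \<open>L\<^sup>2\<close>. It provides Parseval's identity, the density of the Schwartz functions, the Fourier
  transform on \<open>L\<^sup>2\<close>, the values of the sandwiched operator, the function \<open>W\<close>, and the final conclusion.
\<close>

section \<open>The Hilbert space of square-integrable functions\<close>

lemma L2I:
  "f \<in> borel_measurable lborel \<Longrightarrow> integrable lborel (\<lambda>x. (cmod (f x))\<^sup>2) \<Longrightarrow> f \<in> L2"
  by (simp add: L2_def)

lemma L2_measurable[measurable_dest, intro]: "f \<in> L2 \<Longrightarrow> f \<in> borel_measurable lborel"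
  by (simp add: L2_def)

lemma L2_measurable_borel[intro]: "f \<in> L2 \<Longrightarrow> f \<in> borel_measurable borel"
  using L2_measurable by fastforce

lemma L2_integrable: "f \<in> L2 \<Longrightarrow> integrable lborel (\<lambda>x. (cmod (f x))\<^sup>2)"
  by (simp add: L2_def)

lemma L2_zero[simp]: "(\<lambda>x. 0) \<in> L2"
  by (simp add: L2_def)

lemma L2_scale: "f \<in> L2 \<Longrightarrow> (\<lambda>x. c * f x) \<in> L2"
  by (auto simp: L2_def norm_mult power_mult_distrib)

lemma L2_bounded_by:
  assumes "f \<in> L2" "g \<in> borel_measurable borel" "\<And>x. cmod (g x) \<le> C * cmod (f x)"
  shows "g \<in> L2"
proof (rule L2I)
  show "integrable lborel (\<lambda>x. (cmod (g x))\<^sup>2)"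
  proof (rule Bochner_Integration.integrable_bound)
    show "integrable lborel (\<lambda>x. C\<^sup>2 * (cmod (f x))\<^sup>2)"
      using assms(1) by (simp add: L2_def)
    have "(cmod (g x))\<^sup>2 \<le> (C * cmod (f x))\<^sup>2" for x
      using assms(3) by (intro power_mono) auto
    then show "AE x in lborel. norm ((cmod (g x))\<^sup>2) \<le> norm (C\<^sup>2 * (cmod (f x))\<^sup>2)"
      by (auto simp: power_mult_distrib)
  qed (use assms(2) in simp)
qed (use assms(2) in simp)

lemma borel_measurable_cnj[measurable]:
  "f \<in> borel_measurable M \<Longrightarrow> (\<lambda>x. cnj (f x)) \<in> borel_measurable M"
  by (rule borel_measurable_continuous_on[OF continuous_on_cnj[OF continuous_on_id]])

lemma L2_cnj: "f \<in> L2 \<Longrightarrow> (\<lambda>x. cnj (f x)) \<in> L2"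
  by (auto simp: L2_def)

lemma norm_prod_le_squares: "norm (a * b) \<le> (norm a)\<^sup>2 + (norm b)\<^sup>2" for a b :: complex
proof -
  have "0 \<le> (norm a - norm b)\<^sup>2" by simp
  then have "2 * norm (a * b) \<le> (norm a)\<^sup>2 + (norm b)\<^sup>2"
    by (simp add: norm_mult power2_diff)
  then show ?thesis
    using norm_ge_zero[of "a * b"] by linarith
qed

lemma L2_product_integrable:
  assumes "f \<in> L2" "g \<in> L2"
  shows "integrable lborel (\<lambda>x. f x * g x)"
proof (rule Bochner_Integration.integrable_bound)
  show "integrable lborel (\<lambda>x. (cmod (f x))\<^sup>2 + (cmod (g x))\<^sup>2)"
    using assms by (simp add: L2_integrable)
  show "AE x in lborel. norm (f x * g x) \<le> norm ((cmod (f x))\<^sup>2 + (cmod (g x))\<^sup>2)"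
    using norm_prod_le_squares[of "f _" "g _"] by auto
qed (use assms in measurable)

lemma L2_inner_integrable:
  "f \<in> L2 \<Longrightarrow> g \<in> L2 \<Longrightarrow> integrable lborel (\<lambda>x. cnj (f x) * g x)"
  using L2_product_integrable[OF L2_cnj] by blast

lemma L2_add:
  assumes "f \<in> L2" "g \<in> L2" shows "(\<lambda>x. f x + g x) \<in> L2"
proof (rule L2I)
  show "integrable lborel (\<lambda>x. (cmod (f x + g x))\<^sup>2)"
  proof (rule Bochner_Integration.integrable_bound)
    show "integrable lborel (\<lambda>x. 2 * (cmod (f x))\<^sup>2 + 2 * (cmod (g x))\<^sup>2)"
      using assms by (simp add: L2_integrable)
    have "(cmod (f x + g x))\<^sup>2 \<le> 2 * (cmod (f x))\<^sup>2 + 2 * (cmod (g x))\<^sup>2" for x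
    proof -
      have "(cmod (f x + g x))\<^sup>2 \<le> (cmod (f x) + cmod (g x))\<^sup>2"
        by (intro power_mono norm_triangle_ineq) auto
      also have "\<dots> \<le> 2 * (cmod (f x))\<^sup>2 + 2 * (cmod (g x))\<^sup>2"
        using zero_le_power2[of "cmod (f x) - cmod (g x)"]
        by (simp add: power2_sum power2_diff)
      finally show ?thesis .
    qed
    then show "AE x in lborel. norm ((cmod (f x + g x))\<^sup>2)
        \<le> norm (2 * (cmod (f x))\<^sup>2 + 2 * (cmod (g x))\<^sup>2)"
      by (auto intro: order.trans)
  qed (use assms in measurable)
qed (use assms in measurable)

lemma L2_diff: "f \<in> L2 \<Longrightarrow> g \<in> L2 \<Longrightarrow> (\<lambda>x. f x - g x) \<in> L2"
  using L2_add[of f "\<lambda>x. -1 * g x"] L2_scale[of g "-1"] by simp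

lemma L2_sum: "(\<And>i. i \<in> I \<Longrightarrow> f i \<in> L2) \<Longrightarrow> (\<lambda>x. \<Sum>i\<in>I. f i x) \<in> L2"
  by (induction I rule: infinite_finite_induct) (auto intro: L2_add)

lemma L2_inner_add_right:
  "f \<in> L2 \<Longrightarrow> g \<in> L2 \<Longrightarrow> h \<in> L2 \<Longrightarrow> L2_inner f (\<lambda>x. g x + h x) = L2_inner f g + L2_inner f h"
  by (simp add: L2_inner_def distrib_left L2_inner_integrable)

lemma L2_inner_diff_right:
  "f \<in> L2 \<Longrightarrow> g \<in> L2 \<Longrightarrow> h \<in> L2 \<Longrightarrow> L2_inner f (\<lambda>x. g x - h x) = L2_inner f g - L2_inner f h"
  by (simp add: L2_inner_def right_diff_distrib L2_inner_integrable)

lemma L2_inner_scale_right: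
  "L2_inner f (\<lambda>x. c * g x) = c * L2_inner f g"
proof -
  have "(\<lambda>x. cnj (f x) * (c * g x)) = (\<lambda>x. c * (cnj (f x) * g x))" by (auto simp: mult_ac)
  then show ?thesis by (simp only: L2_inner_def integral_mult_right_zero)
qed

lemma L2_inner_commute: "L2_inner g f = cnj (L2_inner f g)"
proof -
  have "cnj (L2_inner f g) = (LINT x|lborel. cnj (cnj (f x) * g x))"
    unfolding L2_inner_def by (rule Bochner_Integration.integral_cnj[symmetric])
  then show ?thesis by (simp add: L2_inner_def mult.commute)
qed

lemma L2_inner_add_left:
  "f \<in> L2 \<Longrightarrow> g \<in> L2 \<Longrightarrow> h \<in> L2 \<Longrightarrow> L2_inner (\<lambda>x. f x + g x) h = L2_inner f h + L2_inner g h"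
  by (subst (1 2 3) L2_inner_commute) (simp add: L2_inner_add_right)

lemma L2_inner_scale_left: "L2_inner (\<lambda>x. c * f x) g = cnj c * L2_inner f g"
  by (subst (1 2) L2_inner_commute) (simp add: L2_inner_scale_right)

lemma L2_inner_sum_right:
  "f \<in> L2 \<Longrightarrow> (\<And>i. i \<in> I \<Longrightarrow> g i \<in> L2) \<Longrightarrow>
   L2_inner f (\<lambda>x. \<Sum>i\<in>I. g i x) = (\<Sum>i\<in>I. L2_inner f (g i))"
  by (induction I rule: infinite_finite_induct)
     (auto simp: L2_inner_add_right L2_sum, simp_all add: L2_inner_def)

lemma L2_norm_nonneg[simp]: "L2_norm f \<ge> 0"
  by (simp add: L2_norm_def)

lemma L2_norm_squared: "(L2_norm f)\<^sup>2 = (LINT x|lborel. (cmod (f x))\<^sup>2)"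
  by (simp add: L2_norm_def)

lemma L2_inner_self: "L2_inner f f = complex_of_real ((L2_norm f)\<^sup>2)"
proof -
  have "L2_inner f f = (LINT x|lborel. complex_of_real ((cmod (f x))\<^sup>2))"
    unfolding L2_inner_def by (intro Bochner_Integration.integral_cong refl)
      (simp add: complex_norm_square mult.commute del: of_real_power)
  then show ?thesis by (simp add: L2_norm_squared del: of_real_power)
qed

lemma L2_norm_add_squared:
  assumes "f \<in> L2" "g \<in> L2"
  shows "(L2_norm (\<lambda>x. f x + g x))\<^sup>2 = (L2_norm f)\<^sup>2 + 2 * Re (L2_inner f g) + (L2_norm g)\<^sup>2"
proof -
  have "complex_of_real ((L2_norm (\<lambda>x. f x + g x))\<^sup>2)
      = L2_inner f f + L2_inner f g + (L2_inner g f + L2_inner g g)"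
    by (subst L2_inner_self[symmetric])
       (simp add: L2_inner_add_left L2_inner_add_right L2_add assms algebra_simps)
  also have "L2_inner g f = cnj (L2_inner f g)" by (rule L2_inner_commute)
  finally have "Re (complex_of_real ((L2_norm (\<lambda>x. f x + g x))\<^sup>2))
    = Re (L2_inner f f + L2_inner f g + (cnj (L2_inner f g) + L2_inner g g))" by simp
  then show ?thesis by (simp add: L2_inner_self del: of_real_power)
qed

lemma L2_norm_scale: "L2_norm (\<lambda>x. c * f x) = cmod c * L2_norm f"
  by (simp add: L2_norm_def norm_mult power_mult_distrib real_sqrt_mult)

lemma L2_norm_minus_commute: "L2_norm (\<lambda>x. f x - g x) = L2_norm (\<lambda>x. g x - f x)"
  by (simp add: L2_norm_def norm_minus_commute)

lemma L2_norm_diff_squared: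
  assumes "f \<in> L2" "g \<in> L2"
  shows "(L2_norm (\<lambda>x. f x - g x))\<^sup>2 = (L2_norm f)\<^sup>2 - 2 * Re (L2_inner f g) + (L2_norm g)\<^sup>2"
  using L2_norm_add_squared[OF assms(1) L2_scale[OF assms(2), of "-1"]]
    L2_inner_scale_right[of f "-1" g]
  by (simp add: L2_norm_scale[of "-1", simplified])

text \<open>
  The usual argument: \<open>\<parallel>f - t \<langle>g, f\<rangle> g\<parallel>\<^sup>2\<close> is nonnegative for all real \<open>t\<close>. If \<open>\<parallel>g\<parallel> = 0\<close>, it is affine in \<open>t\<close>, and a
  large \<open>t\<close> would make it negative unless the inner product vanishes.
\<close>

lemma L2_Cauchy_Schwarz:
  assumes "f \<in> L2" "g \<in> L2"
  shows "cmod (L2_inner f g) \<le> L2_norm f * L2_norm g"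
proof -
  define z where "z = L2_inner f g"
  have key: "0 \<le> (L2_norm f)\<^sup>2 - 2 * t * (cmod z)\<^sup>2 + t\<^sup>2 * (cmod z)\<^sup>2 * (L2_norm g)\<^sup>2" for t :: real
  proof -
    define c where "c = complex_of_real t * cnj z"
    have "0 \<le> (L2_norm (\<lambda>x. f x - c * g x))\<^sup>2" by simp
    also have "\<dots> = (L2_norm f)\<^sup>2 - 2 * Re (c * z) + (cmod c * L2_norm g)\<^sup>2"
      using assms by (simp add: L2_norm_diff_squared L2_scale L2_inner_scale_right L2_norm_scale z_def)
    also have "c * z = of_real (t * (cmod z)\<^sup>2)"
      by (simp add: c_def complex_norm_square[symmetric] mult.assoc mult.commute[of "cnj z"] del: of_real_power)
    finally show ?thesis by (simp add: c_def norm_mult power_mult_distrib)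
  qed
  have "(cmod z)\<^sup>2 \<le> (L2_norm f * L2_norm g)\<^sup>2"
  proof (cases "L2_norm g = 0")
    case True
    have "cmod z = 0"
    proof (rule ccontr)
      assume "cmod z \<noteq> 0"
      then have "(L2_norm f)\<^sup>2 - 2 * (((L2_norm f)\<^sup>2 + 1) / (cmod z)\<^sup>2) * (cmod z)\<^sup>2 = - (L2_norm f)\<^sup>2 - 2"
        by (simp add: field_simps)
      then show False
        using key[of "((L2_norm f)\<^sup>2 + 1) / (cmod z)\<^sup>2"] True zero_le_power2[of "L2_norm f"] by simp
    qed
    then show ?thesis by simp
  next
    case False
    then have "0 < (L2_norm g)\<^sup>2" by simp
    moreover have "0 \<le> ((L2_norm f)\<^sup>2 * (L2_norm g)\<^sup>2 - (cmod z)\<^sup>2) / (L2_norm g)\<^sup>2"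
      using key[of "1 / (L2_norm g)\<^sup>2"] False
      by (simp add: field_simps power2_eq_square)
    ultimately show ?thesis
      by (simp add: zero_le_divide_iff power_mult_distrib)
  qed
  then show ?thesis
    unfolding z_def by (rule power2_le_imp_le) simp
qed

lemma L2_norm_triangle:
  assumes "f \<in> L2" "g \<in> L2"
  shows "L2_norm (\<lambda>x. f x + g x) \<le> L2_norm f + L2_norm g"
proof -
  have "Re (L2_inner f g) \<le> L2_norm f * L2_norm g"
    using L2_Cauchy_Schwarz[OF assms] complex_Re_le_cmod order.trans by blast
  then have "(L2_norm (\<lambda>x. f x + g x))\<^sup>2 \<le> (L2_norm f + L2_norm g)\<^sup>2"
    by (simp add: L2_norm_add_squared[OF assms] power2_sum)
  then show ?thesis by (rule power2_le_imp_le) simp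
qed

lemma L2_norm_triangle_rev:
  assumes "f \<in> L2" "g \<in> L2"
  shows "\<bar>L2_norm f - L2_norm g\<bar> \<le> L2_norm (\<lambda>x. f x - g x)"
  using L2_norm_triangle[OF L2_diff[OF assms] assms(2)]
    L2_norm_triangle[OF L2_diff[OF assms(2,1)] assms(1)]
  by (simp add: L2_norm_minus_commute[of g f])

lemma L2_norm_cong_AE:
  assumes "f \<in> borel_measurable borel" "g \<in> borel_measurable borel" "AE x in lborel. f x = g x"
  shows "L2_norm f = L2_norm g"
proof -
  have "(LINT x|lborel. (cmod (f x))\<^sup>2) = (LINT x|lborel. (cmod (g x))\<^sup>2)"
    using assms by (intro integral_cong_AE) auto
  then show ?thesis by (simp add: L2_norm_def)
qed

lemma L2_inner_cong_AE:
  assumes "f \<in> borel_measurable borel" "g \<in> borel_measurable borel" "h \<in> borel_measurable borel"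
    "AE x in lborel. f x = g x"
  shows "L2_inner h f = L2_inner h g"
  unfolding L2_inner_def using assms by (intro integral_cong_AE) auto

lemma L2_cong_AE:
  assumes "f \<in> L2" "g \<in> borel_measurable borel" "AE x in lborel. f x = g x"
  shows "g \<in> L2"
proof (rule L2I)
  have "integrable lborel (\<lambda>x. (cmod (f x))\<^sup>2) \<longleftrightarrow> integrable lborel (\<lambda>x. (cmod (g x))\<^sup>2)"
    using assms L2_measurable[OF assms(1)] by (intro integrable_cong_AE) auto
  then show "integrable lborel (\<lambda>x. (cmod (g x))\<^sup>2)" using assms(1) by (simp add: L2_def)
qed (use assms in simp)

lemma L2_norm_eq_zero_iff:
  assumes "f \<in> L2" shows "L2_norm f = 0 \<longleftrightarrow> (AE x in lborel. f x = 0)"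
  using integral_nonneg_eq_0_iff_AE[OF L2_integrable[OF assms]] by (simp add: L2_norm_def)

lemma L2_nn_integral:
  assumes "f \<in> L2"
  shows "(\<integral>\<^sup>+x. ennreal ((cmod (f x))\<^sup>2) \<partial>lborel) = ennreal ((L2_norm f)\<^sup>2)"
  using assms by (subst nn_integral_eq_integral) (auto simp: L2_norm_squared L2_def)

lemma L2_by_nn_integral:
  assumes "f \<in> borel_measurable borel" "(\<integral>\<^sup>+x. ennreal ((cmod (f x))\<^sup>2) \<partial>lborel) < \<infinity>"
  shows "f \<in> L2"
  using assms by (intro L2I integrableI_bounded) auto

lemma L2_norm_le_by_nn_integral:
  assumes "f \<in> L2" "(\<integral>\<^sup>+x. ennreal ((cmod (f x))\<^sup>2) \<partial>lborel) \<le> ennreal (C\<^sup>2)" "C \<ge> 0"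
  shows "L2_norm f \<le> C"
proof -
  have "(L2_norm f)\<^sup>2 \<le> C\<^sup>2"
    using assms L2_nn_integral[OF assms(1)] by simp
  then show ?thesis using assms(3) by (rule power2_le_imp_le)
qed

lemma L2_inner_tendsto:
  assumes "\<And>n. f n \<in> L2" "g \<in> L2" "h \<in> L2" "(\<lambda>n. L2_norm (\<lambda>x. f n x - g x)) \<longlonglongrightarrow> 0"
  shows "(\<lambda>n. L2_inner h (f n)) \<longlonglongrightarrow> L2_inner h g" "(\<lambda>n. L2_inner (f n) h) \<longlonglongrightarrow> L2_inner g h"
proof -
  show *: "(\<lambda>n. L2_inner h (f n)) \<longlonglongrightarrow> L2_inner h g"
  proof (subst tendsto_dist_iff, rule tendsto_sandwich[of "\<lambda>_. 0"])
    show "\<forall>\<^sub>F n in sequentially. dist (L2_inner h (f n)) (L2_inner h g) \<le> L2_norm h * L2_norm (\<lambda>x. f n x - g x)"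
      using L2_Cauchy_Schwarz[OF assms(3) L2_diff[OF assms(1,2)]]
      by (simp add: dist_norm L2_inner_diff_right assms)
    show "(\<lambda>n. L2_norm h * L2_norm (\<lambda>x. f n x - g x)) \<longlonglongrightarrow> 0"
      using assms(4) by (rule tendsto_mult_right_zero)
  qed auto
  have "(\<lambda>n. cnj (L2_inner h (f n))) \<longlonglongrightarrow> cnj (L2_inner h g)"
    using * by (rule tendsto_cnj)
  then show "(\<lambda>n. L2_inner (f n) h) \<longlonglongrightarrow> L2_inner g h"
    by (subst (asm) (1 2) L2_inner_commute[symmetric])
qed

lemma L2_norm_tendsto:
  assumes "\<And>n. f n \<in> L2" "g \<in> L2" "(\<lambda>n. L2_norm (\<lambda>x. f n x - g x)) \<longlonglongrightarrow> 0"
  shows "(\<lambda>n. L2_norm (f n)) \<longlonglongrightarrow> L2_norm g"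
proof (subst tendsto_dist_iff, rule tendsto_sandwich[of "\<lambda>_. 0"])
  show "\<forall>\<^sub>F n in sequentially. dist (L2_norm (f n)) (L2_norm g) \<le> L2_norm (\<lambda>x. f n x - g x)"
    using L2_norm_triangle_rev[OF assms(1,2)] by (simp add: dist_norm)
qed (use assms(3) in auto)

text \<open>
  Along a subsequence with steps of norm at most \<open>4\<^sup>-\<^sup>k\<close>, the sum \<open>\<Sum>k. 4\<^sup>k |d\<^sub>k|\<^sup>2\<close> of the squared steps has finite
  integral. It is therefore finite almost everywhere, which forces \<open>|d\<^sub>k| = O(2\<^sup>-\<^sup>k)\<close> pointwise, so the
  subsequence converges almost everywhere. Fatou's lemma turns the Cauchy estimate into convergence in norm.
\<close>

proposition L2_complete:
  fixes f :: "nat \<Rightarrow> real \<Rightarrow> complex"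
  assumes L2: "\<And>n. f n \<in> L2"
    and Cauchy: "\<And>\<epsilon>. \<epsilon> > 0 \<Longrightarrow> \<exists>N. \<forall>m\<ge>N. \<forall>n\<ge>N. L2_norm (\<lambda>x. f m x - f n x) \<le> \<epsilon>"
  obtains g where "g \<in> L2" "(\<lambda>n. L2_norm (\<lambda>x. f n x - g x)) \<longlonglongrightarrow> 0"
proof -
  have "\<exists>N. \<forall>k. \<forall>m\<ge>N k. \<forall>n\<ge>N k. L2_norm (\<lambda>x. f m x - f n x) \<le> (1/4) ^ k"
    using Cauchy by (intro choice allI) simp
  then obtain N where N: "\<And>k m n. m \<ge> N k \<Longrightarrow> n \<ge> N k \<Longrightarrow> L2_norm (\<lambda>x. f m x - f n x) \<le> (1/4) ^ k"
    by blast
  define r where "r k = (\<Sum>i\<le>k. N i) + k" for k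
  have rN: "r k \<ge> N k" for k
    unfolding r_def using member_le_sum[of k "{..k}" N] by simp
  have rSuc: "r (Suc k) \<ge> N k" for k
    unfolding r_def using member_le_sum[of k "{..Suc k}" N] by simp
  have rk: "r k \<ge> k" for k by (simp add: r_def)
  define d where "d k x = f (r (Suc k)) x - f (r k) x" for k x
  have [measurable]: "f n \<in> borel_measurable borel" for n using L2 by auto
  have [measurable]: "d k \<in> borel_measurable borel" for k unfolding d_def by measurable
  have d: "L2_norm (d k) \<le> (1/4) ^ k" for k
    using N[OF rSuc rN] by (simp add: d_def[abs_def])
  have dL2: "d k \<in> L2" for k
    unfolding d_def by (intro L2_diff L2)
  have "(\<integral>\<^sup>+x. (\<Sum>k. ennreal (4 ^ k * (cmod (d k x))\<^sup>2)) \<partial>lborel)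
     = (\<Sum>k. \<integral>\<^sup>+x. ennreal (4 ^ k * (cmod (d k x))\<^sup>2) \<partial>lborel)"
    by (rule nn_integral_suminf) measurable
  also have "\<dots> = (\<Sum>k. ennreal (4 ^ k * (L2_norm (d k))\<^sup>2))"
    by (simp add: ennreal_mult nn_integral_cmult L2_nn_integral dL2)
  also have "\<dots> \<le> (\<Sum>k. ennreal ((1/4) ^ k))"
  proof (intro suminf_le ennreal_leI)
    fix k :: nat
    have "(L2_norm (d k))\<^sup>2 \<le> ((1/4) ^ k)\<^sup>2" by (intro power_mono d) simp
    then have "4 ^ k * (L2_norm (d k))\<^sup>2 \<le> 4 ^ k * ((1/4) ^ k)\<^sup>2" by simp
    also have "(4::real) ^ k * ((1/4) ^ k)\<^sup>2 = (1/4) ^ k"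
      by (simp add: power2_eq_square power_mult_distrib[symmetric] mult.assoc[symmetric])
    finally show "4 ^ k * (L2_norm (d k))\<^sup>2 \<le> (1/4) ^ k" .
  qed auto
  also have "\<dots> < \<infinity>"
    by (subst suminf_ennreal2) (auto intro: summable_geometric)
  finally have "(\<integral>\<^sup>+x. (\<Sum>k. ennreal (4 ^ k * (cmod (d k x))\<^sup>2)) \<partial>lborel) \<noteq> \<infinity>" by simp
  then have "AE x in lborel. (\<Sum>k. ennreal (4 ^ k * (cmod (d k x))\<^sup>2)) \<noteq> \<infinity>"
    by (intro nn_integral_PInf_AE) measurable
  then have conv: "AE x in lborel. convergent (\<lambda>k. f (r k) x)"
  proof eventually_elim
    fix x assume fin: "(\<Sum>k. ennreal (4 ^ k * (cmod (d k x))\<^sup>2)) \<noteq> \<infinity>"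
    have "summable (\<lambda>k. 4 ^ k * (cmod (d k x))\<^sup>2)"
      using fin by (intro summable_suminf_not_top) auto
    then obtain C where C: "\<And>k. norm (4 ^ k * (cmod (d k x))\<^sup>2) \<le> C"
      using summable_imp_bounded unfolding bounded_iff by blast
    have le: "cmod (d k x) \<le> sqrt C * (1/2) ^ k" for k
    proof -
      have "(2 ^ k * cmod (d k x))\<^sup>2 \<le> C"
        using C[of k] by (simp add: power_mult_distrib power_mult[symmetric] mult.commute[of k])
          (simp add: power_mult)
      then have "2 ^ k * cmod (d k x) \<le> sqrt C" by (rule real_le_rsqrt)
      then show ?thesis by (simp add: field_simps)
    qed
    have "summable (\<lambda>k. d k x)"
      by (rule summable_comparison_test'[of "\<lambda>k. sqrt C * (1/2) ^ k" 0])
         (auto intro!: summable_mult summable_geometric le)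
    then have "convergent (\<lambda>n. \<Sum>k<n. d k x)"
      by (simp add: summable_iff_convergent)
    moreover have "(\<Sum>k<n. d k x) = f (r n) x - f (r 0) x" for n
      by (simp add: d_def sum_lessThan_telescope[of "\<lambda>k. f (r k) x"])
    ultimately have "convergent (\<lambda>n. f (r n) x - f (r 0) x)" by simp
    then have "convergent (\<lambda>n. (f (r n) x - f (r 0) x) + f (r 0) x)"
      by (intro convergent_add) (auto simp: convergent_const)
    then show "convergent (\<lambda>k. f (r k) x)" by simp
  qed
  define g where "g x = lim (\<lambda>k. f (r k) x)" for x
  have [measurable]: "g \<in> borel_measurable borel"
    unfolding g_def by measurable
  have lim: "AE x in lborel. (\<lambda>k. f (r k) x) \<longlonglongrightarrow> g x"
    using conv by eventually_elim (simp add: g_def convergent_LIMSEQ_iff)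
  have close: "(\<integral>\<^sup>+x. ennreal ((cmod (f n x - g x))\<^sup>2) \<partial>lborel) \<le> ennreal (\<epsilon>\<^sup>2)"
    if \<epsilon>: "\<epsilon> > 0" and n: "n \<ge> M" and M: "\<And>m n. m \<ge> M \<Longrightarrow> n \<ge> M \<Longrightarrow> L2_norm (\<lambda>x. f m x - f n x) \<le> \<epsilon>"
    for \<epsilon> n M
  proof -
    have "(\<integral>\<^sup>+x. ennreal ((cmod (f n x - g x))\<^sup>2) \<partial>lborel)
       = (\<integral>\<^sup>+x. liminf (\<lambda>k. ennreal ((cmod (f n x - f (r k) x))\<^sup>2)) \<partial>lborel)"
    proof (rule nn_integral_cong_AE, use lim in eventually_elim)
      fix x assume "(\<lambda>k. f (r k) x) \<longlonglongrightarrow> g x"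
      then have "(\<lambda>k. ennreal ((cmod (f n x - f (r k) x))\<^sup>2)) \<longlonglongrightarrow> ennreal ((cmod (f n x - g x))\<^sup>2)"
        by (intro tendsto_intros)
      then show "ennreal ((cmod (f n x - g x))\<^sup>2) = liminf (\<lambda>k. ennreal ((cmod (f n x - f (r k) x))\<^sup>2))"
        using lim_imp_Liminf[OF sequentially_bot] by metis
    qed
    also have "\<dots> \<le> liminf (\<lambda>k. \<integral>\<^sup>+x. ennreal ((cmod (f n x - f (r k) x))\<^sup>2) \<partial>lborel)"
      by (rule nn_integral_liminf) measurable
    also have "\<dots> = liminf (\<lambda>k. ennreal ((L2_norm (\<lambda>x. f n x - f (r k) x))\<^sup>2))"
      by (simp add: L2_nn_integral L2_diff L2)
    also have "\<dots> \<le> ennreal (\<epsilon>\<^sup>2)"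
    proof (rule Liminf_le)
      have "ennreal ((L2_norm (\<lambda>x. f n x - f (r k) x))\<^sup>2) \<le> ennreal (\<epsilon>\<^sup>2)" if "k \<ge> M" for k
        using M[of n "r k"] n that rk[of k] by (intro ennreal_leI power_mono) auto
      then show "\<forall>\<^sub>F k in sequentially. ennreal ((L2_norm (\<lambda>x. f n x - f (r k) x))\<^sup>2) \<le> ennreal (\<epsilon>\<^sup>2)"
        by (auto simp: eventually_sequentially)
    qed simp
    finally show ?thesis .
  qed
  have gL2: "g \<in> L2"
  proof -
    obtain M where M: "\<And>m n. m \<ge> M \<Longrightarrow> n \<ge> M \<Longrightarrow> L2_norm (\<lambda>x. f m x - f n x) \<le> 1"
      using Cauchy[of 1] by auto
    have "(\<integral>\<^sup>+x. ennreal ((cmod (f M x - g x))\<^sup>2) \<partial>lborel) \<le> ennreal (1\<^sup>2)"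
      by (rule close[of 1 M M]) (use M in auto)
    then have "(\<integral>\<^sup>+x. ennreal ((cmod (f M x - g x))\<^sup>2) \<partial>lborel) < \<infinity>"
      by (rule order.strict_trans1) simp
    then have "(\<lambda>x. f M x - g x) \<in> L2" by (intro L2_by_nn_integral) measurable
    then show ?thesis using L2_diff[OF L2[of M]] by fastforce
  qed
  moreover have "(\<lambda>n. L2_norm (\<lambda>x. f n x - g x)) \<longlonglongrightarrow> 0"
  proof (rule LIMSEQ_I)
    fix e :: real assume e: "e > 0"
    obtain M where M: "\<And>m n. m \<ge> M \<Longrightarrow> n \<ge> M \<Longrightarrow> L2_norm (\<lambda>x. f m x - f n x) \<le> e / 2"
      using Cauchy[of "e / 2"] e by auto
    have "L2_norm (\<lambda>x. f n x - g x) \<le> e / 2" if "n \<ge> M" for n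
      using e close[OF _ that M] by (intro L2_norm_le_by_nn_integral L2_diff L2 gL2) auto
    then show "\<exists>no. \<forall>n\<ge>no. norm (L2_norm (\<lambda>x. f n x - g x) - 0) < e"
      using e by (intro exI[of _ M]) fastforce
  qed
  ultimately show ?thesis by (rule that)
qed

text \<open>
  Requiring closedness would exclude the Schwartz functions, which are the main example.
\<close>

definition L2_subspace :: "(real \<Rightarrow> complex) set \<Rightarrow> bool" where
  "L2_subspace D \<longleftrightarrow> D \<subseteq> L2 \<and> (\<lambda>x. 0) \<in> D \<and>
     (\<forall>f\<in>D. \<forall>g\<in>D. (\<lambda>x. f x + g x) \<in> D) \<and> (\<forall>c. \<forall>f\<in>D. (\<lambda>x. c * f x) \<in> D)"

text \<open>
  The representing function is the limit of a minimising sequence of \<open>J(f) = \<parallel>f\<parallel>\<^sup>2 - 2 Re (T f)\<close> in the subspace.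
  It is a limit of elements of the subspace, which makes this theorem double as a projection theorem: applied
  to \<open>T \<psi> = \<langle>\<psi>, f\<rangle>\<close> it yields the projection of \<open>f\<close> onto the closure of the subspace.
\<close>

theorem L2_Riesz:
  assumes D: "L2_subspace D"
    and add: "\<And>f g. f \<in> D \<Longrightarrow> g \<in> D \<Longrightarrow> T (\<lambda>x. f x + g x) = T f + T g"
    and scale: "\<And>c f. f \<in> D \<Longrightarrow> T (\<lambda>x. c * f x) = cnj c * T f"
    and bounded: "\<And>f. f \<in> D \<Longrightarrow> cmod (T f) \<le> C * L2_norm f"
  obtains g u where "g \<in> L2" "\<And>f. f \<in> D \<Longrightarrow> T f = L2_inner f g"
    "\<And>n :: nat. u n \<in> D" "(\<lambda>n. L2_norm (\<lambda>x. u n x - g x)) \<longlonglongrightarrow> 0" "C \<ge> 0 \<Longrightarrow> L2_norm g \<le> C"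
proof -
  have DL2: "f \<in> L2" if "f \<in> D" for f using D that by (auto simp: L2_subspace_def)
  have Dadd: "(\<lambda>x. f x + g x) \<in> D" if "f \<in> D" "g \<in> D" for f g
    using D that by (auto simp: L2_subspace_def)
  have Dscale: "(\<lambda>x. c * f x) \<in> D" if "f \<in> D" for f c
    using D that by (auto simp: L2_subspace_def)
  define J where "J f = (L2_norm f)\<^sup>2 - 2 * Re (T f)" for f
  have J_lower: "J f \<ge> - C\<^sup>2" if "f \<in> D" for f
  proof -
    have "Re (T f) \<le> C * L2_norm f"
      using bounded[OF that] complex_Re_le_cmod order.trans by blast
    then show ?thesis
      using zero_le_power2[of "L2_norm f - C"] by (simp add: J_def power2_diff mult.commute)
  qed
  define I where "I = (INF f\<in>D. J f)"
  have bdd: "bdd_below (J ` D)" using J_lower by (auto intro!: bdd_belowI[of _ "- C\<^sup>2"])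
  have I: "I \<le> J f" if "f \<in> D" for f
    unfolding I_def using bdd that by (rule cINF_lower)
  have "\<exists>f\<in>D. J f < I + 1 / real (Suc n)" for n
  proof -
    have "D \<noteq> {}" using D by (auto simp: L2_subspace_def)
    moreover have "Inf (J ` D) < I + 1 / real (Suc n)" by (simp add: I_def)
    ultimately show ?thesis using cInf_lessD[of "J ` D"] by blast
  qed
  then obtain u where u: "\<And>n. u n \<in> D" "\<And>n. J (u n) < I + 1 / real (Suc n)" by metis
  \<comment> \<open>By the parallelogram law, a minimising sequence of \<open>J\<close> is a Cauchy sequence.\<close>
  have par: "(L2_norm (\<lambda>x. u m x - u n x))\<^sup>2 \<le> 2 / real (Suc m) + 2 / real (Suc n)" for m n
  proof -
    define w where "w = (\<lambda>x. (1/2) * (u m x + u n x))"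
    have wD: "w \<in> D" unfolding w_def by (intro Dscale Dadd u)
    have Tw: "T w = (T (u m) + T (u n)) / 2"
      using scale[OF Dadd[OF u(1)[of m] u(1)[of n]], of "1/2"] by (simp add: w_def add u)
    have Nw: "(L2_norm w)\<^sup>2 = ((L2_norm (u m))\<^sup>2 + 2 * Re (L2_inner (u m) (u n)) + (L2_norm (u n))\<^sup>2) / 4"
      unfolding w_def L2_norm_scale power_mult_distrib
      by (simp add: L2_norm_add_squared DL2 u power_divide)
    have "4 * I \<le> 4 * J w" using I[OF wD] by simp
    also have "\<dots> = 2 * J (u m) + 2 * J (u n) - (L2_norm (\<lambda>x. u m x - u n x))\<^sup>2"
      by (simp add: J_def Tw Nw L2_norm_diff_squared DL2 u field_simps)
    finally show ?thesis using u(2)[of m] u(2)[of n] by simp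
  qed
  have "\<exists>N. \<forall>m\<ge>N. \<forall>n\<ge>N. L2_norm (\<lambda>x. u m x - u n x) \<le> \<epsilon>" if "\<epsilon> > 0" for \<epsilon>
  proof -
    have "\<epsilon>\<^sup>2 / 4 > 0" using that by simp
    then obtain N where N: "1 / real (Suc N) < \<epsilon>\<^sup>2 / 4" using nat_approx_posE by blast
    have "L2_norm (\<lambda>x. u m x - u n x) \<le> \<epsilon>" if "m \<ge> N" "n \<ge> N" for m n
    proof (rule power2_le_imp_le)
      have "1 / real (Suc m) \<le> 1 / real (Suc N)" "1 / real (Suc n) \<le> 1 / real (Suc N)"
        using that by (simp_all add: field_simps)
      then have "2 / real (Suc m) + 2 / real (Suc n) \<le> \<epsilon>\<^sup>2" using N by linarith
      then show "(L2_norm (\<lambda>x. u m x - u n x))\<^sup>2 \<le> \<epsilon>\<^sup>2" using par[of m n] by linarith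
    qed (use \<open>\<epsilon> > 0\<close> in simp)
    then show ?thesis by blast
  qed
  then obtain g where g: "g \<in> L2" "(\<lambda>n. L2_norm (\<lambda>x. u n x - g x)) \<longlonglongrightarrow> 0"
    using L2_complete[of u] DL2 u(1) by blast
  have Jlim: "(\<lambda>n. J (u n)) \<longlonglongrightarrow> I"
  proof (rule tendsto_sandwich)
    show "\<forall>\<^sub>F n in sequentially. I \<le> J (u n)" using I u(1) by simp
    show "\<forall>\<^sub>F n in sequentially. J (u n) \<le> I + 1 / real (Suc n)"
      by (intro always_eventually allI less_imp_le u(2))
    show "(\<lambda>n. I + 1 / real (Suc n)) \<longlonglongrightarrow> I"
      using tendsto_add[OF tendsto_const LIMSEQ_Suc[OF lim_1_over_n], of I] by simp
  qed simp
  \<comment> \<open>First variation of \<open>J\<close>: a quadratic polynomial in \<open>t\<close> that is nonnegative and vanishes at \<open>0\<close> has no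
    linear term.\<close>
  have Re_eq: "Re (T f) = Re (L2_inner f g)" if f: "f \<in> D" for f
  proof -
    define q where "q = Re (L2_inner g f) - Re (T f)"
    have ineq: "0 \<le> 2 * t * q + t\<^sup>2 * (L2_norm f)\<^sup>2" for t :: real
    proof -
      have "J (\<lambda>x. u n x + of_real t * f x)
        = J (u n) + 2 * t * (Re (L2_inner (u n) f) - Re (T f)) + t\<^sup>2 * (L2_norm f)\<^sup>2" for n
        using f u(1)[of n]
        by (simp add: J_def add scale Dscale L2_norm_add_squared L2_scale DL2 L2_inner_scale_right
            L2_norm_scale power_mult_distrib algebra_simps)
      moreover have "I \<le> J (\<lambda>x. u n x + of_real t * f x)" for n
        using f u(1)[of n] by (intro I Dadd Dscale)
      ultimately have "I \<le> J (u n) + 2 * t * (Re (L2_inner (u n) f) - Re (T f)) + t\<^sup>2 * (L2_norm f)\<^sup>2" for n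
        by metis
      moreover have "(\<lambda>n. J (u n) + 2 * t * (Re (L2_inner (u n) f) - Re (T f)) + t\<^sup>2 * (L2_norm f)\<^sup>2)
        \<longlonglongrightarrow> I + 2 * t * q + t\<^sup>2 * (L2_norm f)\<^sup>2"
        unfolding q_def
        using L2_inner_tendsto(2)[OF DL2[OF u(1)] g(1) DL2[OF f] g(2)]
        by (intro tendsto_intros Jlim)
      ultimately have "I \<le> I + 2 * t * q + t\<^sup>2 * (L2_norm f)\<^sup>2"
        using LIMSEQ_le_const by blast
      then show ?thesis by simp
    qed
    have "q = 0"
    proof (rule ccontr)
      assume "q \<noteq> 0"
      define s where "s = 1 + (L2_norm f)\<^sup>2"
      have s: "s > 0" "(L2_norm f)\<^sup>2 < s" using zero_le_power2[of "L2_norm f"] unfolding s_def by linarith+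
      have "2 * (- q / s) * q + (- q / s)\<^sup>2 * (L2_norm f)\<^sup>2 < 2 * (- q / s) * q + (- q / s)\<^sup>2 * s"
        using s \<open>q \<noteq> 0\<close> by (intro add_strict_left_mono mult_strict_left_mono) auto
      also have "\<dots> = - q\<^sup>2 / s" using s by (simp add: field_simps power2_eq_square)
      also have "\<dots> < 0" using s \<open>q \<noteq> 0\<close> by simp
      finally show False using ineq[of "- q / s"] by simp
    qed
    then show ?thesis by (simp add: q_def L2_inner_commute[of g f])
  qed
  have eq: "T f = L2_inner f g" if f: "f \<in> D" for f
  proof (rule complex_eqI)
    show "Re (T f) = Re (L2_inner f g)" by (rule Re_eq[OF f])
    show "Im (T f) = Im (L2_inner f g)"
      using Re_eq[OF Dscale[OF f, of \<i>]] by (simp add: scale f L2_inner_scale_left)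
  qed
  have "L2_norm g \<le> C" if "C \<ge> 0"
  proof -
    have "cmod (L2_inner (u n) g) \<le> C * L2_norm (u n)" for n
      using bounded[OF u(1)[of n]] eq[OF u(1)[of n]] by simp
    moreover have "(\<lambda>n. cmod (L2_inner (u n) g)) \<longlonglongrightarrow> cmod (L2_inner g g)"
      using L2_inner_tendsto(2)[OF DL2[OF u(1)] g(1) g(1) g(2)] by (rule tendsto_norm)
    moreover have "(\<lambda>n. C * L2_norm (u n)) \<longlonglongrightarrow> C * L2_norm g"
      by (intro tendsto_mult tendsto_const L2_norm_tendsto[OF DL2[OF u(1)] g])
    ultimately have "cmod (L2_inner g g) \<le> C * L2_norm g"
      by (intro LIMSEQ_le) auto
    then have "L2_norm g * L2_norm g \<le> C * L2_norm g"
      by (simp add: L2_inner_self power2_eq_square norm_mult)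
    then show ?thesis
      using that by (cases "L2_norm g = 0") (auto simp: mult_le_cancel_right)
  qed
  then show ?thesis using that g eq u(1) by blast
qed

section \<open>Orthonormal bases\<close>

definition L2_orthonormal :: "(real \<Rightarrow> complex) set \<Rightarrow> bool" where
  "L2_orthonormal B \<longleftrightarrow> B \<subseteq> L2 \<and> (\<forall>e\<in>B. \<forall>e'\<in>B. L2_inner e e' = (if e = e' then 1 else 0))"

lemma L2_orthonormal_basis_altdef:
  "L2_orthonormal_basis B \<longleftrightarrow>
     L2_orthonormal B \<and> (\<forall>f\<in>L2. (\<forall>e\<in>B. L2_inner e f = 0) \<longrightarrow> (AE x in lborel. f x = 0))"
  by (auto simp: L2_orthonormal_basis_def L2_orthonormal_def)

lemma L2_orthonormal_in_L2: "L2_orthonormal B \<Longrightarrow> e \<in> B \<Longrightarrow> e \<in> L2"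
  by (auto simp: L2_orthonormal_def)

text \<open>
  A maximal orthonormal set is complete, because a nonzero function orthogonal to it could be normalised and
  added.
\<close>

theorem L2_orthonormal_basis_exists: "\<exists>B. L2_orthonormal_basis B"
proof -
  have "\<exists>M\<in>{B. L2_orthonormal B}. \<forall>X\<in>{B. L2_orthonormal B}. M \<subseteq> X \<longrightarrow> X = M"
  proof (rule subset_Zorn')
    fix C assume C: "subset.chain {B. L2_orthonormal B} C"
    have "L2_inner e e' = (if e = e' then 1 else 0)" if "X \<in> C" "Y \<in> C" "e \<in> X" "e' \<in> Y" for X Y e e'
    proof -
      have "X \<subseteq> Y \<or> Y \<subseteq> X" using C that by (auto simp: subset.chain_def)
      then obtain Z where "Z \<in> C" "e \<in> Z" "e' \<in> Z"
        using \<open>X \<in> C\<close> \<open>Y \<in> C\<close> \<open>e \<in> X\<close> \<open>e' \<in> Y\<close> by blast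
      then show ?thesis using C by (auto simp: subset.chain_def L2_orthonormal_def subset_iff)
    qed
    then show "\<Union>C \<in> {B. L2_orthonormal B}"
      using C by (auto simp: L2_orthonormal_def subset.chain_def subset_iff)
  qed
  then obtain B where B: "L2_orthonormal B" and max: "\<And>X. L2_orthonormal X \<Longrightarrow> B \<subseteq> X \<Longrightarrow> X = B"
    by auto
  have "AE x in lborel. f x = 0" if f: "f \<in> L2" and orth: "\<And>e. e \<in> B \<Longrightarrow> L2_inner e f = 0" for f
  proof (rule ccontr)
    assume "\<not> (AE x in lborel. f x = 0)"
    then have n0: "L2_norm f \<noteq> 0" using L2_norm_eq_zero_iff[OF f] by simp
    define h where "h = (\<lambda>x. complex_of_real (1 / L2_norm f) * f x)"
    have h: "h \<in> L2" unfolding h_def by (rule L2_scale[OF f])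
    have hh: "L2_inner h h = 1"
      unfolding L2_inner_self unfolding h_def L2_norm_scale using n0
      by (simp add: power_mult_distrib norm_divide of_real_power[symmetric] power_divide del: of_real_power)
    have eh: "L2_inner e h = 0" "L2_inner h e = 0" if "e \<in> B" for e
      using orth[OF that] L2_inner_commute[of f e]
      by (simp_all only: h_def L2_inner_scale_right L2_inner_scale_left) auto
    have "h \<notin> B" using eh(1)[of h] hh by auto
    moreover have "L2_orthonormal (insert h B)"
      using B h hh eh unfolding L2_orthonormal_def by auto
    ultimately show False using max[of "insert h B"] by auto
  qed
  then show ?thesis using B by (auto simp: L2_orthonormal_basis_altdef)
qed

text \<open>
  This identity contains both Bessel's inequality (with \<open>c e = \<langle>e, f\<rangle>\<close>) and the fact that the Fourier
  coefficients give the best approximation from the span.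
\<close>

lemma L2_distance_to_combination:
  assumes B: "L2_orthonormal B" and F: "finite F" "F \<subseteq> B" and f: "f \<in> L2"
  shows "(L2_norm (\<lambda>x. f x - (\<Sum>e\<in>F. c e * e x)))\<^sup>2
    = (L2_norm f)\<^sup>2 - (\<Sum>e\<in>F. (cmod (L2_inner e f))\<^sup>2) + (\<Sum>e\<in>F. (cmod (c e - L2_inner e f))\<^sup>2)"
proof -
  define p where "p = (\<lambda>x. \<Sum>e\<in>F. c e * e x)"
  have FL2: "e \<in> L2" if "e \<in> F" for e using B F(2) that by (auto simp: L2_orthonormal_def)
  have pL2: "p \<in> L2" unfolding p_def by (intro L2_sum L2_scale FL2)
  have fp: "L2_inner f p = (\<Sum>e\<in>F. c e * cnj (L2_inner e f))"
    unfolding p_def by (simp add: L2_inner_sum_right f FL2 L2_scale L2_inner_scale_right)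
      (simp add: L2_inner_commute[of f])
  have ep: "L2_inner e p = c e" if "e \<in> F" for e
  proof -
    have "L2_inner e p = (\<Sum>e'\<in>F. c e' * (if e = e' then 1 else 0))"
      unfolding p_def using that B F(2)
      by (simp add: L2_inner_sum_right FL2 L2_scale L2_inner_scale_right L2_orthonormal_def subset_iff)
    then show ?thesis using that F(1) by (simp add: if_distrib cong: if_cong)
  qed
  have "L2_inner p p = (\<Sum>e\<in>F. c e * L2_inner p e)"
    by (subst (2) p_def) (simp add: L2_inner_sum_right pL2 FL2 L2_scale L2_inner_scale_right)
  also have "\<dots> = (\<Sum>e\<in>F. of_real ((cmod (c e))\<^sup>2))"
    by (intro sum.cong refl) (simp add: L2_inner_commute[of p] ep complex_norm_square del: of_real_power)
  finally have "complex_of_real ((L2_norm p)\<^sup>2) = of_real (\<Sum>e\<in>F. (cmod (c e))\<^sup>2)"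
    by (simp add: L2_inner_self)
  then have pp: "(L2_norm p)\<^sup>2 = (\<Sum>e\<in>F. (cmod (c e))\<^sup>2)"
    by (simp only: of_real_eq_iff)
  have "(cmod (c e - L2_inner e f))\<^sup>2
      = (cmod (c e))\<^sup>2 - 2 * Re (c e * cnj (L2_inner e f)) + (cmod (L2_inner e f))\<^sup>2" for e
    by (simp only: cmod_power2) (simp add: power2_eq_square algebra_simps)
  then have "(L2_norm (\<lambda>x. f x - p x))\<^sup>2
    = (L2_norm f)\<^sup>2 - (\<Sum>e\<in>F. (cmod (L2_inner e f))\<^sup>2) + (\<Sum>e\<in>F. (cmod (c e - L2_inner e f))\<^sup>2)"
    by (simp add: L2_norm_diff_squared f pL2 fp pp sum.distrib sum_subtractf sum_distrib_left distrib_left)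
  then show ?thesis by (simp add: p_def)
qed

lemma L2_Bessel:
  assumes "L2_orthonormal B" "finite F" "F \<subseteq> B" "f \<in> L2"
  shows "(\<Sum>e\<in>F. (cmod (L2_inner e f))\<^sup>2) \<le> (L2_norm f)\<^sup>2"
  using L2_distance_to_combination[OF assms, of "\<lambda>e. L2_inner e f"]
    zero_le_power2[of "L2_norm (\<lambda>x. f x - (\<Sum>e\<in>F. L2_inner e f * e x))"] by simp

lemma L2_subspace_span:
  assumes B: "B \<subseteq> L2"
  shows "L2_subspace {\<lambda>x. \<Sum>e\<in>F. c e * e x | F c. finite F \<and> F \<subseteq> B}" (is "L2_subspace ?D")
  unfolding L2_subspace_def
proof (intro conjI ballI allI)
  show "?D \<subseteq> L2" using B by (auto intro!: L2_sum L2_scale)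
  show "(\<lambda>x. 0) \<in> ?D" by (rule CollectI, rule exI[of _ "{}"]) simp
  fix f g assume "f \<in> ?D" "g \<in> ?D"
  then obtain F c G d where *: "finite F" "F \<subseteq> B" "f = (\<lambda>x. \<Sum>e\<in>F. c e * e x)"
    "finite G" "G \<subseteq> B" "g = (\<lambda>x. \<Sum>e\<in>G. d e * e x)" by blast
  have "f = (\<lambda>x. \<Sum>e\<in>F \<union> G. (if e \<in> F then c e else 0) * e x)"
    unfolding * by (intro ext sum.mono_neutral_cong_left) (use * in auto)
  moreover have "g = (\<lambda>x. \<Sum>e\<in>F \<union> G. (if e \<in> G then d e else 0) * e x)"
    unfolding * by (intro ext sum.mono_neutral_cong_left) (use * in auto)
  ultimately have "(\<lambda>x. f x + g x)
     = (\<lambda>x. \<Sum>e\<in>F \<union> G. ((if e \<in> F then c e else 0) + (if e \<in> G then d e else 0)) * e x)"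
    by (simp add: distrib_right sum.distrib)
  then show "(\<lambda>x. f x + g x) \<in> ?D"
    using * by (intro CollectI exI[of _ "F \<union> G"] exI conjI) auto
next
  fix k f assume "f \<in> ?D"
  then obtain F c where *: "finite F" "F \<subseteq> B" "f = (\<lambda>x. \<Sum>e\<in>F. c e * e x)" by blast
  then have "(\<lambda>x. k * f x) = (\<lambda>x. \<Sum>e\<in>F. (k * c e) * e x)"
    by (simp add: sum_distrib_left mult.assoc)
  then show "(\<lambda>x. k * f x) \<in> ?D"
    using * by (intro CollectI exI[of _ F] exI conjI) auto
qed

text \<open>
  Projecting \<open>f\<close> onto the closed span of the basis gives a function \<open>g\<close> with the same coefficients, hence equal
  to \<open>f\<close> by completeness of the basis. Thus \<open>f\<close> is a limit of finite combinations, and the partial sums of the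
  squared coefficients come arbitrarily close to Bessel's upper bound.
\<close>

theorem L2_Parseval:
  assumes B: "L2_orthonormal_basis B" and f: "f \<in> L2"
  shows "((\<lambda>e. (cmod (L2_inner e f))\<^sup>2) has_sum (L2_norm f)\<^sup>2) B"
proof -
  have on: "L2_orthonormal B" and complete: "\<And>h. h \<in> L2 \<Longrightarrow> (\<And>e. e \<in> B \<Longrightarrow> L2_inner e h = 0) \<Longrightarrow> AE x in lborel. h x = 0"
    using B by (auto simp: L2_orthonormal_basis_altdef)
  have BL2: "B \<subseteq> L2" using on by (simp add: L2_orthonormal_def)
  let ?D = "{\<lambda>x. \<Sum>e\<in>F. c e * e x | F c. finite F \<and> F \<subseteq> B}"
  have D: "L2_subspace ?D" by (rule L2_subspace_span[OF BL2])
  then have DL2: "\<psi> \<in> L2" if "\<psi> \<in> ?D" for \<psi> using that by (auto simp: L2_subspace_def)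
  obtain g u where g: "g \<in> L2" "\<And>\<psi>. \<psi> \<in> ?D \<Longrightarrow> L2_inner \<psi> f = L2_inner \<psi> g"
    "\<And>n. u n \<in> ?D" "(\<lambda>n. L2_norm (\<lambda>x. u n x - g x)) \<longlonglongrightarrow> 0"
  proof (rule L2_Riesz[OF D, of "\<lambda>\<psi>. L2_inner \<psi> f" "L2_norm f"])
    show "L2_inner (\<lambda>x. \<phi> x + \<psi> x) f = L2_inner \<phi> f + L2_inner \<psi> f" if "\<phi> \<in> ?D" "\<psi> \<in> ?D" for \<phi> \<psi>
      using DL2[OF that(1)] DL2[OF that(2)] f by (simp add: L2_inner_add_left)
    show "L2_inner (\<lambda>x. c * \<psi> x) f = cnj c * L2_inner \<psi> f" for c \<psi> by (rule L2_inner_scale_left)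
    show "cmod (L2_inner \<psi> f) \<le> L2_norm f * L2_norm \<psi>" if "\<psi> \<in> ?D" for \<psi>
      using L2_Cauchy_Schwarz[OF DL2[OF that] f] by (simp add: mult.commute)
  qed (use that in blast)
  have eD: "e \<in> ?D" if "e \<in> B" for e
    by (rule CollectI, rule exI[of _ "{e}"], rule exI[of _ "\<lambda>_. 1"]) (use that in auto)
  have "AE x in lborel. f x - g x = 0"
  proof (rule complete[OF L2_diff[OF f g(1)]])
    fix e assume "e \<in> B"
    then show "L2_inner e (\<lambda>x. f x - g x) = 0"
      using g(2)[OF eD] f g(1) BL2 by (simp add: L2_inner_diff_right subset_iff)
  qed
  then have fg: "AE x in lborel. f x = g x" by simp
  have lim: "(\<lambda>n. (L2_norm (\<lambda>x. f x - u n x))\<^sup>2) \<longlonglongrightarrow> 0"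
  proof -
    have "L2_norm (\<lambda>x. f x - u n x) = L2_norm (\<lambda>x. u n x - g x)" for n
    proof -
      have "L2_norm (\<lambda>x. f x - u n x) = L2_norm (\<lambda>x. g x - u n x)"
        using fg by (intro L2_norm_cong_AE L2_measurable_borel L2_diff f g(1) DL2[OF g(3)]) auto
      then show ?thesis by (simp add: L2_norm_minus_commute[of g])
    qed
    then show ?thesis using tendsto_power[OF g(4), of 2] by simp
  qed
  let ?S = "sum (\<lambda>e. (cmod (L2_inner e f))\<^sup>2)"
  have Bessel: "?S F \<le> (L2_norm f)\<^sup>2" if "finite F" "F \<subseteq> B" for F
    by (rule L2_Bessel[OF on that f])
  then have summ: "(\<lambda>e. (cmod (L2_inner e f))\<^sup>2) summable_on B"
    by (intro nonneg_bdd_above_summable_on bdd_aboveI2[of _ _ "(L2_norm f)\<^sup>2"]) auto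
  have "infsum (\<lambda>e. (cmod (L2_inner e f))\<^sup>2) B = (L2_norm f)\<^sup>2"
  proof (rule antisym)
    show "infsum (\<lambda>e. (cmod (L2_inner e f))\<^sup>2) B \<le> (L2_norm f)\<^sup>2"
      by (rule infsum_le_finite_sums[OF summ Bessel])
    have "(L2_norm f)\<^sup>2 - (L2_norm (\<lambda>x. f x - u n x))\<^sup>2 \<le> infsum (\<lambda>e. (cmod (L2_inner e f))\<^sup>2) B" for n
    proof -
      obtain F c where F: "finite F" "F \<subseteq> B" "u n = (\<lambda>x. \<Sum>e\<in>F. c e * e x)" using g(3)[of n] by blast
      have "0 \<le> (\<Sum>e\<in>F. (cmod (c e - L2_inner e f))\<^sup>2)" by (intro sum_nonneg) simp
      then have "(L2_norm f)\<^sup>2 - (L2_norm (\<lambda>x. f x - u n x))\<^sup>2 \<le> ?S F"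
        using L2_distance_to_combination[OF on F(1,2) f, of c] by (simp add: F(3))
      also have "\<dots> \<le> infsum (\<lambda>e. (cmod (L2_inner e f))\<^sup>2) B"
        by (rule finite_sum_le_infsum[OF summ F(1,2)]) simp
      finally show ?thesis .
    qed
    moreover have "(\<lambda>n. (L2_norm f)\<^sup>2 - (L2_norm (\<lambda>x. f x - u n x))\<^sup>2) \<longlonglongrightarrow> (L2_norm f)\<^sup>2 - 0"
      by (intro tendsto_diff tendsto_const lim)
    ultimately show "(L2_norm f)\<^sup>2 \<le> infsum (\<lambda>e. (cmod (L2_inner e f))\<^sup>2) B"
      by (intro LIMSEQ_le_const2) auto
  qed
  then show ?thesis using summ by (metis has_sum_infsum)
qed

text \<open>
  By Parseval's identity each test function \<open>q\<close> is orthogonal to all but countably many basis elements, and no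
  basis element is orthogonal to every test function.
\<close>

lemma L2_orthonormal_basis_countable:
  assumes B: "L2_orthonormal_basis B" and Q: "countable Q" "Q \<subseteq> L2"
    and total: "\<And>f. f \<in> L2 \<Longrightarrow> (\<And>q. q \<in> Q \<Longrightarrow> L2_inner f q = 0) \<Longrightarrow> AE x in lborel. f x = 0"
  shows "countable B"
proof -
  have BL2: "B \<subseteq> L2" using B by (auto simp: L2_orthonormal_basis_def)
  have "countable (\<Union>q\<in>Q. {e \<in> B. (cmod (L2_inner e q))\<^sup>2 \<noteq> 0})"
  proof (intro countable_UN[OF Q(1)])
    fix q assume "q \<in> Q"
    then have "(\<lambda>e. (cmod (L2_inner e q))\<^sup>2) summable_on B"
      using L2_Parseval[OF B, of q] Q(2) by (auto simp: summable_on_def)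
    then show "countable {e \<in> B. (cmod (L2_inner e q))\<^sup>2 \<noteq> 0}" by (rule summable_countable_real)
  qed
  moreover have "B \<subseteq> (\<Union>q\<in>Q. {e \<in> B. (cmod (L2_inner e q))\<^sup>2 \<noteq> 0})"
  proof (rule subsetI, rule ccontr)
    fix e assume e: "e \<in> B" and "e \<notin> (\<Union>q\<in>Q. {e \<in> B. (cmod (L2_inner e q))\<^sup>2 \<noteq> 0})"
    then have "AE x in lborel. e x = 0" using BL2 by (intro total) auto
    then have "L2_norm e = 0" using L2_norm_eq_zero_iff e BL2 by blast
    moreover have "L2_inner e e = 1" using e B by (simp add: L2_orthonormal_basis_def)
    ultimately show False by (simp add: L2_inner_self)
  qed
  ultimately show ?thesis by (rule countable_subset[rotated])
qed

text \<open>
  The finite sets \<open>F n\<close> depend only on the basis, so the same partial sums approximate all functions at once.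
\<close>

lemma L2_expansion:
  assumes B: "L2_orthonormal_basis B" and "countable B"
  obtains F :: "nat \<Rightarrow> (real \<Rightarrow> complex) set" where "\<And>n. finite (F n)" "\<And>n. F n \<subseteq> B"
    "\<And>f. f \<in> L2 \<Longrightarrow> (\<lambda>n. L2_norm (\<lambda>x. (\<Sum>e\<in>F n. L2_inner e f * e x) - f x)) \<longlonglongrightarrow> 0"
proof -
  define F where "F n = from_nat_into B ` {..<n} \<inter> B" for n
  have fin: "finite (F n)" "F n \<subseteq> B" for n by (auto simp: F_def)
  have F: "filterlim F (finite_subsets_at_top B) sequentially"
    unfolding filterlim_iff eventually_finite_subsets_at_top
  proof (intro allI impI, elim exE conjE)
    fix P X assume X: "finite X" "X \<subseteq> B" "\<forall>Y. finite Y \<and> X \<subseteq> Y \<and> Y \<subseteq> B \<longrightarrow> P Y"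
    obtain N where N: "\<And>e. e \<in> X \<Longrightarrow> to_nat_on B e < N"
      using finite_nat_set_iff_bounded[of "to_nat_on B ` X"] X(1) by auto
    have "X \<subseteq> F n" if "n \<ge> N" for n
    proof
      fix e assume e: "e \<in> X"
      then have "from_nat_into B (to_nat_on B e) = e" using X(2) assms(2) by auto
      moreover have "to_nat_on B e < n" using N[OF e] that by simp
      ultimately have "e \<in> from_nat_into B ` {..<n}" by (metis imageI lessThan_iff)
      then show "e \<in> F n" using e X(2) by (auto simp: F_def)
    qed
    then have "P (F n)" if "n \<ge> N" for n
      using X(3)[rule_format, of "F n"] fin[of n] that by simp
    then show "\<forall>\<^sub>F n in sequentially. P (F n)"
      by (rule eventually_sequentiallyI)
  qed
  have on: "L2_orthonormal B" using B by (simp add: L2_orthonormal_basis_altdef)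
  show ?thesis
  proof (rule that[OF fin])
    fix f assume f: "f \<in> L2"
    have "(\<lambda>n. \<Sum>e\<in>F n. (cmod (L2_inner e f))\<^sup>2) \<longlonglongrightarrow> (L2_norm f)\<^sup>2"
      using L2_Parseval[OF B f] F unfolding has_sum_def by (rule filterlim_compose)
    then have "(\<lambda>n. (L2_norm f)\<^sup>2 - (\<Sum>e\<in>F n. (cmod (L2_inner e f))\<^sup>2)) \<longlonglongrightarrow> (L2_norm f)\<^sup>2 - (L2_norm f)\<^sup>2"
      by (intro tendsto_diff tendsto_const)
    moreover have "(L2_norm f)\<^sup>2 - (\<Sum>e\<in>F n. (cmod (L2_inner e f))\<^sup>2)
        = (L2_norm (\<lambda>x. f x - (\<Sum>e\<in>F n. L2_inner e f * e x)))\<^sup>2" for n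
      using L2_distance_to_combination[OF on fin(1)[of n] fin(2)[of n] f, of "\<lambda>e. L2_inner e f"] by simp
    ultimately have "(\<lambda>n. (L2_norm (\<lambda>x. f x - (\<Sum>e\<in>F n. L2_inner e f * e x)))\<^sup>2) \<longlonglongrightarrow> 0"
      by simp
    then have "(\<lambda>n. sqrt ((L2_norm (\<lambda>x. f x - (\<Sum>e\<in>F n. L2_inner e f * e x)))\<^sup>2)) \<longlonglongrightarrow> sqrt 0"
      by (rule tendsto_real_sqrt)
    then show "(\<lambda>n. L2_norm (\<lambda>x. (\<Sum>e\<in>F n. L2_inner e f * e x) - f x)) \<longlonglongrightarrow> 0"
      by (simp add: L2_norm_minus_commute[of _ f])
  qed
qed

section \<open>Schwartz functions\<close>

text \<open>
  Smooth functions all of whose derivatives satisfy a growth condition \<open>P\<close>. The condition \<open>rapid\<close> describes the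
  Schwartz functions, and \<open>poly_bounded\<close> the slowly increasing functions, which act on them by multiplication.
\<close>

definition smooth_with :: "((real \<Rightarrow> complex) \<Rightarrow> bool) \<Rightarrow> (real \<Rightarrow> complex) \<Rightarrow> bool" where
  "smooth_with P f \<longleftrightarrow> (\<forall>k. (\<forall>x. (vderiv ^^ k) f differentiable (at x)) \<and> P ((vderiv ^^ k) f))"

text \<open>
  The powers of \<open>1 + x\<^sup>2\<close> replace the monomials \<open>x\<^sup>j\<close> in the definition of Schwartz functions. They are positive and
  multiplicative, which simplifies estimates of products.
\<close>

definition rapid :: "(real \<Rightarrow> complex) \<Rightarrow> bool" where
  "rapid f \<longleftrightarrow> (\<forall>N. \<exists>C. \<forall>x. (1 + x\<^sup>2) ^ N * cmod (f x) \<le> C)"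

definition poly_bounded :: "(real \<Rightarrow> complex) \<Rightarrow> bool" where
  "poly_bounded f \<longleftrightarrow> (\<exists>N C. \<forall>x. cmod (f x) \<le> C * (1 + x\<^sup>2) ^ N)"

abbreviation slow :: "(real \<Rightarrow> complex) \<Rightarrow> bool" where
  "slow \<equiv> smooth_with poly_bounded"

lemma one_plus_square_pos[simp]: "(0::real) < 1 + x\<^sup>2" "(0::real) \<le> 1 + x\<^sup>2" "1 + x\<^sup>2 \<noteq> (0::real)"
  using zero_le_power2[of x] by linarith+

lemma rapid_iff: "rapid f \<longleftrightarrow> (\<forall>j. bounded (range (\<lambda>x. x ^ j *\<^sub>R f x)))"
proof
  assume f: "rapid f"
  show "\<forall>j. bounded (range (\<lambda>x. x ^ j *\<^sub>R f x))"
  proof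
    fix j
    obtain C where C: "\<And>x. (1 + x\<^sup>2) ^ j * cmod (f x) \<le> C" using f by (auto simp: rapid_def)
    have "norm (x ^ j *\<^sub>R f x) \<le> C" for x
    proof -
      have "\<bar>x\<bar> \<le> 1 + x\<^sup>2"
        using zero_le_power2[of "\<bar>x\<bar> - 1/2"] by (simp add: power2_eq_square algebra_simps)
      then have "\<bar>x\<bar> ^ j \<le> (1 + x\<^sup>2) ^ j" by (intro power_mono) auto
      then have "norm (x ^ j *\<^sub>R f x) \<le> (1 + x\<^sup>2) ^ j * cmod (f x)"
        by (simp add: power_abs mult_right_mono)
      then show ?thesis using C[of x] by linarith
    qed
    then show "bounded (range (\<lambda>x. x ^ j *\<^sub>R f x))" by (auto intro!: boundedI)
  qed
next
  assume f: "\<forall>j. bounded (range (\<lambda>x. x ^ j *\<^sub>R f x))"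
  show "rapid f" unfolding rapid_def
  proof
    fix N
    have "\<forall>j. \<exists>c. \<forall>x. norm (x ^ j *\<^sub>R f x) \<le> c" using f by (auto simp: bounded_iff)
    then obtain c where c: "\<And>j x. norm (x ^ j *\<^sub>R f x) \<le> c j" by metis
    have "(1 + x\<^sup>2) ^ N * cmod (f x) \<le> (\<Sum>k\<le>N. real (N choose k) * c (2 * k))" for x
    proof -
      have "(1 + x\<^sup>2) ^ N * cmod (f x) = (\<Sum>k\<le>N. real (N choose k) * norm (x ^ (2 * k) *\<^sub>R f x))"
        by (subst add.commute) (simp add: binomial_ring sum_distrib_right power_mult mult.assoc abs_mult power_abs)
      also have "\<dots> \<le> (\<Sum>k\<le>N. real (N choose k) * c (2 * k))"
        by (intro sum_mono mult_left_mono c) simp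
      finally show ?thesis .
    qed
    then show "\<exists>C. \<forall>x. (1 + x\<^sup>2) ^ N * cmod (f x) \<le> C" by blast
  qed
qed

lemma schwartz_altdef: "schwartz = {f. smooth_with rapid f}"
  by (auto simp: schwartz_def smooth_with_def rapid_iff)

text \<open>
  To show that a function is smooth with growth \<open>P\<close> it suffices to place it in a set of functions with growth
  \<open>P\<close> that is closed under differentiation. No formula for the higher derivatives is needed.
\<close>

lemma smooth_with_coinduct:
  assumes "f \<in> S" and P: "\<And>g. g \<in> S \<Longrightarrow> P g"
    and D: "\<And>g. g \<in> S \<Longrightarrow> \<exists>g'\<in>S. \<forall>x. (g has_vector_derivative g' x) (at x)"
  shows "smooth_with P f"
proof -
  have vderiv: "vderiv g \<in> S" "\<forall>x. g differentiable (at x)" if "g \<in> S" for g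
  proof -
    obtain g' where g': "g' \<in> S" "\<And>x. (g has_vector_derivative g' x) (at x)" using D[OF \<open>g \<in> S\<close>] by blast
    then have "vderiv g = g'" by (auto simp: vderiv_def vector_derivative_at)
    then show "vderiv g \<in> S" using g' by simp
    show "\<forall>x. g differentiable (at x)" using g'(2) by (auto intro: differentiableI_vector)
  qed
  have "(vderiv ^^ k) f \<in> S" for k
    by (induction k) (auto intro: vderiv \<open>f \<in> S\<close>)
  then show ?thesis using vderiv P by (auto simp: smooth_with_def)
qed

lemma smooth_with_imp: "smooth_with P f \<Longrightarrow> P f"
  unfolding smooth_with_def by (metis funpow_0)

lemma smooth_with_vderiv: "smooth_with P f \<Longrightarrow> smooth_with P (vderiv f)"
  unfolding smooth_with_def by (metis funpow_Suc_right comp_apply)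

lemma smooth_with_has_vector_derivative:
  "smooth_with P f \<Longrightarrow> (f has_vector_derivative vderiv f x) (at x)"
  unfolding smooth_with_def vderiv_def by (metis funpow_0 vector_derivative_works)

lemma smooth_with_continuous: "smooth_with P f \<Longrightarrow> continuous_on A f"
  using smooth_with_has_vector_derivative
  by (meson continuous_at_imp_continuous_on has_vector_derivative_continuous)

lemma smooth_with_measurable: "smooth_with P f \<Longrightarrow> f \<in> borel_measurable borel"
  by (intro borel_measurable_continuous_onI smooth_with_continuous)

lemma smooth_with_mono: "smooth_with P f \<Longrightarrow> (\<And>g. P g \<Longrightarrow> Q g) \<Longrightarrow> smooth_with Q f"
  by (auto simp: smooth_with_def)

lemma schwartz_vderiv: "f \<in> schwartz \<Longrightarrow> vderiv f \<in> schwartz"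
  by (auto simp: schwartz_altdef smooth_with_vderiv)

lemma schwartz_has_vector_derivative:
  "f \<in> schwartz \<Longrightarrow> (f has_vector_derivative vderiv f x) (at x)"
  by (auto simp: schwartz_altdef smooth_with_has_vector_derivative)

lemma schwartz_continuous: "f \<in> schwartz \<Longrightarrow> continuous_on A f"
  by (auto simp: schwartz_altdef smooth_with_continuous)

lemma schwartz_measurable[measurable_dest]: "f \<in> schwartz \<Longrightarrow> f \<in> borel_measurable borel"
  by (auto simp: schwartz_altdef smooth_with_measurable)

lemma schwartz_rapid: "f \<in> schwartz \<Longrightarrow> rapid f"
  by (auto simp: schwartz_altdef dest: smooth_with_imp)

lemma schwartz_decay:
  assumes "f \<in> schwartz" obtains C where "C \<ge> 0" "\<And>x. (1 + x\<^sup>2) ^ N * cmod (f x) \<le> C"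
proof -
  obtain C where C: "\<And>x. (1 + x\<^sup>2) ^ N * cmod (f x) \<le> C"
    using schwartz_rapid[OF assms] by (auto simp: rapid_def)
  have "0 \<le> (1 + 0\<^sup>2) ^ N * cmod (f 0)" by simp
  then have "C \<ge> 0" using C[of 0] by linarith
  then show ?thesis using C by (rule that)
qed

lemma poly_bounded_add:
  assumes "poly_bounded f" "poly_bounded g" shows "poly_bounded (\<lambda>x. f x + g x)"
proof -
  obtain N C M D where f: "\<And>x. cmod (f x) \<le> C * (1 + x\<^sup>2) ^ N" and g: "\<And>x. cmod (g x) \<le> D * (1 + x\<^sup>2) ^ M"
    using assms by (auto simp: poly_bounded_def)
  have "0 \<le> C" using f[of 0] norm_ge_zero[of "f 0"] by (simp del: norm_ge_zero)
  moreover have "0 \<le> D" using g[of 0] norm_ge_zero[of "g 0"] by (simp del: norm_ge_zero)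
  ultimately have "cmod (f x + g x) \<le> (C + D) * (1 + x\<^sup>2) ^ (N + M)" for x
  proof -
    have "C * (1 + x\<^sup>2) ^ N \<le> C * (1 + x\<^sup>2) ^ (N + M)" "D * (1 + x\<^sup>2) ^ M \<le> D * (1 + x\<^sup>2) ^ (N + M)"
      using \<open>0 \<le> C\<close> \<open>0 \<le> D\<close> by (auto intro!: mult_left_mono power_increasing)
    then show ?thesis
      using f[of x] g[of x] norm_triangle_ineq[of "f x" "g x"] by (simp add: distrib_right)
  qed
  then show ?thesis by (auto simp: poly_bounded_def)
qed

lemma poly_bounded_mult:
  assumes "poly_bounded f" "poly_bounded g" shows "poly_bounded (\<lambda>x. f x * g x)"
proof -
  obtain N C M D where f: "\<And>x. cmod (f x) \<le> C * (1 + x\<^sup>2) ^ N" and g: "\<And>x. cmod (g x) \<le> D * (1 + x\<^sup>2) ^ M"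
    using assms by (auto simp: poly_bounded_def)
  have "cmod (f x * g x) \<le> (C * D) * (1 + x\<^sup>2) ^ (N + M)" for x
  proof -
    have "cmod (f x * g x) \<le> (C * (1 + x\<^sup>2) ^ N) * (D * (1 + x\<^sup>2) ^ M)"
      unfolding norm_mult by (intro mult_mono f g order.trans[OF norm_ge_zero f] norm_ge_zero)
    then show ?thesis by (simp add: power_add mult_ac)
  qed
  then show ?thesis by (auto simp: poly_bounded_def)
qed

lemma poly_bounded_const: "poly_bounded (\<lambda>x. c)"
  unfolding poly_bounded_def by (rule exI[of _ 0], rule exI[of _ "cmod c"]) simp

lemma poly_bounded_of_real_linear: "poly_bounded (\<lambda>x. of_real x + c)"
proof (rule poly_bounded_add[OF _ poly_bounded_const])
  have "\<bar>x\<bar> \<le> 1 * (1 + x\<^sup>2) ^ 1" for x :: real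
    using zero_le_power2[of "\<bar>x\<bar> - 1/2"] by (simp add: power2_eq_square algebra_simps)
  then show "poly_bounded complex_of_real" unfolding poly_bounded_def
    by (intro exI[of _ 1]) simp
qed

lemma poly_bounded_poly: "poly_bounded (\<lambda>x. poly p (of_real x + c))"
  by (induction p)
     (auto simp: poly_bounded_const intro!: poly_bounded_add poly_bounded_mult poly_bounded_of_real_linear)

lemma rapid_imp_poly_bounded: "rapid f \<Longrightarrow> poly_bounded f"
  unfolding rapid_def poly_bounded_def
  by (drule spec[of _ 0], elim exE, rule exI[of _ 0]) auto

lemma rapid_mult:
  assumes "poly_bounded m" "rapid f" shows "rapid (\<lambda>x. m x * f x)"
  unfolding rapid_def
proof
  fix N
  obtain M C where m: "\<And>x. cmod (m x) \<le> C * (1 + x\<^sup>2) ^ M" using assms by (auto simp: poly_bounded_def)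
  have "0 \<le> C" using m[of 0] norm_ge_zero[of "m 0"] by (simp del: norm_ge_zero)
  obtain D where f: "\<And>x. (1 + x\<^sup>2) ^ (N + M) * cmod (f x) \<le> D" using assms by (auto simp: rapid_def)
  have "(1 + x\<^sup>2) ^ N * cmod (m x * f x) \<le> C * D" for x
  proof -
    have "(1 + x\<^sup>2) ^ N * cmod (m x * f x) = cmod (m x) * ((1 + x\<^sup>2) ^ N * cmod (f x))"
      by (simp add: norm_mult)
    also have "\<dots> \<le> C * (1 + x\<^sup>2) ^ M * ((1 + x\<^sup>2) ^ N * cmod (f x))"
      by (intro mult_right_mono m) simp
    also have "\<dots> = C * ((1 + x\<^sup>2) ^ (N + M) * cmod (f x))" by (simp add: power_add)
    also have "\<dots> \<le> C * D" by (intro mult_left_mono f \<open>0 \<le> C\<close>)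
    finally show ?thesis .
  qed
  then show "\<exists>C. \<forall>x. (1 + x\<^sup>2) ^ N * cmod (m x * f x) \<le> C" by blast
qed

lemma rapid_add:
  assumes "rapid f" "rapid g" shows "rapid (\<lambda>x. f x + g x)"
  unfolding rapid_def
proof
  fix N
  obtain C D where "\<And>x. (1 + x\<^sup>2) ^ N * cmod (f x) \<le> C" "\<And>x. (1 + x\<^sup>2) ^ N * cmod (g x) \<le> D"
    using assms by (meson rapid_def)
  then have "(1 + x\<^sup>2) ^ N * cmod (f x + g x) \<le> C + D" for x
    using mult_left_mono[OF norm_triangle_ineq[of "f x" "g x"], of "(1 + x\<^sup>2) ^ N"]
    by (simp add: distrib_left) (meson add_mono order.trans)
  then show "\<exists>C. \<forall>x. (1 + x\<^sup>2) ^ N * cmod (f x + g x) \<le> C" by blast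
qed

text \<open>
  By the product rule, sums of products of slowly increasing functions and Schwartz functions are closed
  under differentiation, while the products alone are not.
\<close>

inductive_set slow_combinations :: "(real \<Rightarrow> complex) set" where
  product: "slow m \<Longrightarrow> f \<in> schwartz \<Longrightarrow> (\<lambda>x. m x * f x) \<in> slow_combinations"
| sum: "f \<in> slow_combinations \<Longrightarrow> g \<in> slow_combinations \<Longrightarrow> (\<lambda>x. f x + g x) \<in> slow_combinations"

lemma slow_combinations_schwartz:
  assumes "f \<in> slow_combinations" shows "f \<in> schwartz"
proof -
  have "smooth_with rapid f"
  proof (rule smooth_with_coinduct[OF assms])
    fix g assume g: "g \<in> slow_combinations"
    then show "rapid g"
      by induction (blast intro: rapid_mult rapid_add schwartz_rapid smooth_with_imp)+
    from g show "\<exists>g'\<in>slow_combinations. \<forall>x. (g has_vector_derivative g' x) (at x)"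
    proof induction
      case (product m f)
      have "(\<lambda>x. m x * vderiv f x + vderiv m x * f x) \<in> slow_combinations"
        using product by (intro slow_combinations.intros schwartz_vderiv smooth_with_vderiv)
      moreover have "((\<lambda>x. m x * f x) has_vector_derivative m x * vderiv f x + vderiv m x * f x) (at x)" for x
        by (intro has_vector_derivative_mult smooth_with_has_vector_derivative[OF product(1)]
            schwartz_has_vector_derivative product)
      ultimately show ?case
        by (intro bexI[of _ "\<lambda>x. m x * vderiv f x + vderiv m x * f x"]) auto
    next
      case (sum f g)
      then obtain f' g' where "f' \<in> slow_combinations" "g' \<in> slow_combinations"
        "\<And>x. (f has_vector_derivative f' x) (at x)" "\<And>x. (g has_vector_derivative g' x) (at x)" by blast
      then show ?case
        by (intro bexI[of _ "\<lambda>x. f' x + g' x"] allI has_vector_derivative_add slow_combinations.sum)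
    qed
  qed
  then show ?thesis by (simp add: schwartz_altdef)
qed

lemma schwartz_mult_slow: "slow m \<Longrightarrow> f \<in> schwartz \<Longrightarrow> (\<lambda>x. m x * f x) \<in> schwartz"
  by (rule slow_combinations_schwartz[OF slow_combinations.product])

lemma slow_const: "slow (\<lambda>x. c)"
  by (rule smooth_with_coinduct[of _ "{\<lambda>x. c | c. True}"])
     (auto simp: poly_bounded_const intro!: exI[of _ "\<lambda>x. 0"])

lemma schwartz_scale: "f \<in> schwartz \<Longrightarrow> (\<lambda>x. c * f x) \<in> schwartz"
  by (rule schwartz_mult_slow[OF slow_const])

lemma schwartz_add: "f \<in> schwartz \<Longrightarrow> g \<in> schwartz \<Longrightarrow> (\<lambda>x. f x + g x) \<in> schwartz"
  using slow_combinations.sum[OF slow_combinations.product[OF slow_const[of 1], of f]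
      slow_combinations.product[OF slow_const[of 1], of g]]
  by (intro slow_combinations_schwartz) simp

lemma schwartz_diff: "f \<in> schwartz \<Longrightarrow> g \<in> schwartz \<Longrightarrow> (\<lambda>x. f x - g x) \<in> schwartz"
  using schwartz_add[of f "\<lambda>x. -1 * g x"] schwartz_scale[of g "-1"] by simp

lemma schwartz_imp_slow: "f \<in> schwartz \<Longrightarrow> slow f"
  by (auto simp: schwartz_altdef intro: smooth_with_mono rapid_imp_poly_bounded)

lemma schwartz_mult: "f \<in> schwartz \<Longrightarrow> g \<in> schwartz \<Longrightarrow> (\<lambda>x. f x * g x) \<in> schwartz"
  by (intro schwartz_mult_slow schwartz_imp_slow)

lemma schwartz_cnj:
  assumes "f \<in> schwartz" shows "(\<lambda>x. cnj (f x)) \<in> schwartz"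
proof -
  have "smooth_with rapid (\<lambda>x. cnj (f x))"
  proof (rule smooth_with_coinduct[of _ "{\<lambda>x. cnj (g x) | g. g \<in> schwartz}"])
    fix g assume "g \<in> {\<lambda>x. cnj (g x) | g. g \<in> schwartz}"
    then obtain h where h: "h \<in> schwartz" "g = (\<lambda>x. cnj (h x))" by blast
    show "rapid g" using schwartz_rapid[OF h(1)] by (simp add: rapid_def h(2))
    show "\<exists>g'\<in>{\<lambda>x. cnj (g x) |g. g \<in> schwartz}. \<forall>x. (g has_vector_derivative g' x) (at x)"
      using h schwartz_vderiv[OF h(1)] schwartz_has_vector_derivative[OF h(1)]
      by (intro bexI[of _ "\<lambda>x. cnj (vderiv h x)"])
         (auto intro!: bounded_linear.has_vector_derivative[OF bounded_linear_cnj])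
  qed (use assms in blast)
  then show ?thesis by (simp add: schwartz_altdef)
qed

lemma slow_exp_i: "slow (\<lambda>x. exp (\<i> * of_real (a * x)))"
proof (rule smooth_with_coinduct[of _ "{\<lambda>x. c * exp (\<i> * of_real (a * x)) | c. True}"])
  show "(\<lambda>x. exp (\<i> * of_real (a * x))) \<in> {\<lambda>x. c * exp (\<i> * of_real (a * x)) | c. True}"
    by (rule CollectI, rule exI[of _ 1]) simp
  fix g assume "g \<in> {\<lambda>x. c * exp (\<i> * of_real (a * x)) | c. True}"
  then obtain c where g: "g = (\<lambda>x. c * exp (\<i> * of_real (a * x)))" by blast
  show "poly_bounded g" unfolding poly_bounded_def g
    by (rule exI[of _ 0], rule exI[of _ "cmod c"]) (simp add: norm_mult)
  have "(g has_vector_derivative (c * \<i> * of_real a) * exp (\<i> * of_real (a * x))) (at x)" for x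
  proof -
    have "((\<lambda>z. c * exp (\<i> * (of_real a * z))) has_field_derivative (c * \<i> * of_real a) * exp (\<i> * of_real (a * x))) (at (of_real x))"
      by (auto intro!: derivative_eq_intros)
    from has_vector_derivative_real_field[OF this] show ?thesis by (simp add: g)
  qed
  then show "\<exists>g'\<in>{\<lambda>x. c * exp (\<i> * of_real (a * x)) | c. True}. \<forall>x. (g has_vector_derivative g' x) (at x)"
    by (intro bexI[of _ "\<lambda>x. (c * \<i> * of_real a) * exp (\<i> * of_real (a * x))"]) auto
qed

text \<open>
  With a polynomial factor and an arbitrary exponent, the family is closed under differentiation. It contains
  the symbols \<open>(\<xi>\<^sup>2 + \<kappa>\<^sup>2)\<^sup>-\<^sup>1\<^sup>/\<^sup>2\<close> of the resolvent roots, the weights of the Sobolev norms, and smooth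
  approximations of the sign function.
\<close>

lemma slow_quadratic_powr:
  assumes \<kappa>: "\<kappa> > 0"
  shows "slow (\<lambda>x. poly p (of_real (x - a)) * complex_of_real (((x - a)\<^sup>2 + \<kappa>\<^sup>2) powr r))"
proof (rule smooth_with_coinduct[of _ "{\<lambda>x. poly p (of_real (x - a)) * complex_of_real (((x - a)\<^sup>2 + \<kappa>\<^sup>2) powr r) | p r. True}"])
  have pos: "0 < y\<^sup>2 + \<kappa>\<^sup>2" for y :: real using \<kappa> by (simp add: add_nonneg_pos)
  fix g assume "g \<in> {\<lambda>x. poly p (of_real (x - a)) * complex_of_real (((x - a)\<^sup>2 + \<kappa>\<^sup>2) powr r) | p r. True}"
  then obtain p r where g: "g = (\<lambda>x. poly p (of_real (x - a)) * complex_of_real (((x - a)\<^sup>2 + \<kappa>\<^sup>2) powr r))" by blast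
  have "poly_bounded (\<lambda>x. complex_of_real (((x - a)\<^sup>2 + \<kappa>\<^sup>2) powr r))"
  proof -
    obtain N :: nat where N: "\<bar>r\<bar> \<le> real N" using real_arch_simple by blast
    have "poly_bounded (\<lambda>x. complex_of_real (((x - a)\<^sup>2 + \<kappa>\<^sup>2 + 1 / \<kappa>\<^sup>2) ^ N))"
      using poly_bounded_poly[of "([:\<kappa>\<^sup>2 + 1 / \<kappa>\<^sup>2, 0, 1:]) ^ N" "- of_real a"]
      by (simp add: power2_eq_square algebra_simps)
    moreover have "norm (complex_of_real (((x - a)\<^sup>2 + \<kappa>\<^sup>2) powr r))
        \<le> norm (complex_of_real (((x - a)\<^sup>2 + \<kappa>\<^sup>2 + 1 / \<kappa>\<^sup>2) ^ N))" for x
    proof -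
      define q where "q = (x - a)\<^sup>2 + \<kappa>\<^sup>2"
      have q: "q > 0" "q \<ge> \<kappa>\<^sup>2" using pos by (auto simp: q_def)
      \<comment> \<open>Both \<open>q\<close> and \<open>1/q\<close> are at most \<open>q + 1/\<kappa>\<^sup>2\<close>, and this sum is at least \<open>1\<close>. Hence it bounds powers of \<open>q\<close> of
        either sign and admits rounding the exponent up to an integer.\<close>
      have inv: "1 / q \<le> 1 / \<kappa>\<^sup>2" using q \<kappa> by (simp add: frac_le)
      have ge1: "1 \<le> q + 1 / \<kappa>\<^sup>2"
      proof (cases "q \<ge> 1")
        case False
        then have "1 \<le> 1 / q" using q by simp
        then show ?thesis using inv q by linarith
      qed (use \<kappa> in \<open>simp add: add_increasing2\<close>)
      have "q powr r \<le> (q + 1 / \<kappa>\<^sup>2) powr \<bar>r\<bar>"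
      proof (cases "r \<ge> 0")
        case True
        then show ?thesis using q \<kappa> by (auto intro!: powr_mono2)
      next
        case False
        have "q powr r = (1 / q) powr \<bar>r\<bar>"
          using False q by (simp add: powr_divide powr_minus_divide[symmetric])
        also have "\<dots> \<le> (q + 1 / \<kappa>\<^sup>2) powr \<bar>r\<bar>"
          using q inv by (intro powr_mono2) auto
        finally show ?thesis .
      qed
      also have "\<dots> \<le> (q + 1 / \<kappa>\<^sup>2) powr real N" by (intro powr_mono N ge1)
      also have "\<dots> = (q + 1 / \<kappa>\<^sup>2) ^ N" using ge1 by (intro powr_realpow) linarith
      finally show ?thesis unfolding norm_of_real using ge1 by (simp add: q_def)
    qed
    ultimately show ?thesis unfolding poly_bounded_def by (meson order.trans)
  qed
  then show "poly_bounded g"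
    unfolding g using poly_bounded_poly[of p "- of_real a"] by (intro poly_bounded_mult) auto
  define p' where "p' = pderiv p * [:of_real (\<kappa>\<^sup>2), 0, 1:] + p * [:0, of_real (2 * r):]"
  have "(g has_vector_derivative poly p' (of_real (x - a)) * complex_of_real (((x - a)\<^sup>2 + \<kappa>\<^sup>2) powr (r - 1))) (at x)" for x
  proof -
    have "((\<lambda>z. poly p (z - of_real a)) has_field_derivative poly (pderiv p) (of_real (x - a))) (at (of_real x))"
      by (rule DERIV_chain'[where g="poly p" and f="\<lambda>z. z - of_real a" and D=1, simplified])
         (auto intro!: derivative_eq_intros poly_DERIV)
    from has_vector_derivative_real_field[OF this]
    have 1: "((\<lambda>x. poly p (of_real (x - a))) has_vector_derivative poly (pderiv p) (of_real (x - a))) (at x)"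
      by simp
    have "((\<lambda>x. ((x - a)\<^sup>2 + \<kappa>\<^sup>2) powr r) has_real_derivative 2 * r * (x - a) * ((x - a)\<^sup>2 + \<kappa>\<^sup>2) powr (r - 1)) (at x)"
      using pos[of "x - a"] by (auto intro!: derivative_eq_intros simp: powr_diff field_simps)
    then have 2: "((\<lambda>x. complex_of_real (((x - a)\<^sup>2 + \<kappa>\<^sup>2) powr r)) has_vector_derivative
        of_real (2 * r * (x - a) * ((x - a)\<^sup>2 + \<kappa>\<^sup>2) powr (r - 1))) (at x)"
      by (intro has_vector_derivative_of_real) (simp add: has_real_derivative_iff_has_vector_derivative)
    have "((x - a)\<^sup>2 + \<kappa>\<^sup>2) powr r = ((x - a)\<^sup>2 + \<kappa>\<^sup>2) * ((x - a)\<^sup>2 + \<kappa>\<^sup>2) powr (r - 1)"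
      using pos[of "x - a"] by (simp add: powr_diff)
    then have 3: "complex_of_real (((x - a)\<^sup>2 + \<kappa>\<^sup>2) powr r)
        = ((of_real (x - a))\<^sup>2 + of_real (\<kappa>\<^sup>2)) * complex_of_real (((x - a)\<^sup>2 + \<kappa>\<^sup>2) powr (r - 1))"
      by (simp only: of_real_mult of_real_add of_real_power)
    show ?thesis
      unfolding g using has_vector_derivative_mult[OF 1 2] unfolding 3
      by (rule back_subst[of "\<lambda>D. (_ has_vector_derivative D) _"])
         (simp add: p'_def algebra_simps power2_eq_square)
  qed
  then show "\<exists>g'\<in>{\<lambda>x. poly p (of_real (x - a)) * complex_of_real (((x - a)\<^sup>2 + \<kappa>\<^sup>2) powr r) | p r. True}.
      \<forall>x. (g has_vector_derivative g' x) (at x)"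
    by (intro bexI[of _ "\<lambda>x. poly p' (of_real (x - a)) * complex_of_real (((x - a)\<^sup>2 + \<kappa>\<^sup>2) powr (r - 1))"]) blast+
qed blast

lemma schwartz_poly_gaussian:
  assumes "a > 0"
  shows "(\<lambda>x. poly p (of_real x) * of_real (exp (- a * x\<^sup>2))) \<in> schwartz"
proof -
  have "smooth_with rapid (\<lambda>x. poly p (of_real x) * of_real (exp (- a * x\<^sup>2)))"
  proof (rule smooth_with_coinduct[of _ "{\<lambda>x. poly p (of_real x) * of_real (exp (- a * x\<^sup>2)) | p. True}"])
    fix g assume "g \<in> {\<lambda>x. poly p (of_real x) * complex_of_real (exp (- a * x\<^sup>2)) | p. True}"
    then obtain p where g: "g = (\<lambda>x. poly p (of_real x) * of_real (exp (- a * x\<^sup>2)))" by blast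
    have "rapid (\<lambda>x. of_real (exp (- a * x\<^sup>2)))"
      unfolding rapid_def
    proof
      fix N
      have "(1 + x\<^sup>2) ^ N * cmod (of_real (exp (- a * x\<^sup>2))) \<le> fact N / a ^ N * exp a" for x
      proof -
        define y where "y = a * (1 + x\<^sup>2)"
        have y: "y \<ge> 0" using assms by (simp add: y_def)
        have "y ^ N /\<^sub>R fact N \<le> (\<Sum>n. y ^ n /\<^sub>R fact n)"
          using y sum_le_suminf[OF summable_exp_generic[of y], of "{N}"] by simp
        then have "y ^ N \<le> fact N * exp y" by (simp add: exp_def field_simps)
        then have "y ^ N * exp (- y) \<le> fact N * exp y * exp (- y)" by (intro mult_right_mono) auto
        then have "y ^ N * exp (- y) \<le> fact N" by (simp add: exp_minus field_simps)
        moreover have "(1 + x\<^sup>2) ^ N * exp (- a * x\<^sup>2) = y ^ N * exp (- y) * exp a / a ^ N"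
        proof -
          have "exp (- a * x\<^sup>2) = exp (- y) * exp a" by (simp add: y_def algebra_simps flip: exp_add)
          moreover have "y ^ N = a ^ N * (1 + x\<^sup>2) ^ N" by (simp add: y_def power_mult_distrib)
          ultimately show ?thesis using assms by simp
        qed
        ultimately show ?thesis
          using assms by (simp add: divide_right_mono mult_right_mono)
      qed
      then show "\<exists>C. \<forall>x. (1 + x\<^sup>2) ^ N * cmod (of_real (exp (- a * x\<^sup>2))) \<le> C" by blast
    qed
    then show "rapid g" unfolding g using poly_bounded_poly[of p 0] by (intro rapid_mult) auto
    define p' where "p' = pderiv p + p * [:0, - of_real (2 * a):]"
    have "(g has_vector_derivative poly p' (of_real x) * of_real (exp (- a * x\<^sup>2))) (at x)" for x
    proof -
      have 1: "((\<lambda>x. poly p (of_real x)) has_vector_derivative poly (pderiv p) (of_real x)) (at x)"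
        using poly_DERIV by (rule has_vector_derivative_real_field)
      have "((\<lambda>x. exp (- a * x\<^sup>2)) has_real_derivative - 2 * a * x * exp (- a * x\<^sup>2)) (at x)"
        by (auto intro!: derivative_eq_intros)
      then have 2: "((\<lambda>x. complex_of_real (exp (- a * x\<^sup>2))) has_vector_derivative
          of_real (- 2 * a * x * exp (- a * x\<^sup>2))) (at x)"
        by (intro has_vector_derivative_of_real) (simp add: has_real_derivative_iff_has_vector_derivative)
      show ?thesis
        unfolding g using has_vector_derivative_mult[OF 1 2]
        by (rule back_subst[of "\<lambda>D. (_ has_vector_derivative D) _"])
           (simp add: p'_def algebra_simps)
    qed
    then show "\<exists>g'\<in>{\<lambda>x. poly p (of_real x) * complex_of_real (exp (- a * x\<^sup>2)) | p. True}.
      \<forall>x. (g has_vector_derivative g' x) (at x)"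
      by (intro bexI[of _ "\<lambda>x. poly p' (of_real x) * complex_of_real (exp (- a * x\<^sup>2))"]) blast+
  qed blast
  then show ?thesis by (simp add: schwartz_altdef)
qed

section \<open>Testing against Schwartz functions\<close>

lemma integrable_inverse_one_plus_square: "integrable lborel (\<lambda>x::real. 1 / (1 + x\<^sup>2))"
  using integrable_inverse_1_plus_square
  by (simp add: set_integrable_def inverse_eq_divide)

lemma schwartz_integrable:
  assumes f: "f \<in> schwartz" shows "integrable lborel f"
proof -
  obtain C where C: "\<And>x. (1 + x\<^sup>2) ^ 1 * cmod (f x) \<le> C" using schwartz_decay[OF f] by blast
  have "integrable lborel (\<lambda>x. C * (1 / (1 + x\<^sup>2)))"
    by (intro integrable_mult_right integrable_inverse_one_plus_square)
  then show ?thesis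
  proof (rule Bochner_Integration.integrable_bound)
    show "AE x in lborel. norm (f x) \<le> norm (C * (1 / (1 + x\<^sup>2)))"
    proof (rule AE_I2)
      fix x
      have "cmod (f x) \<le> C / (1 + x\<^sup>2)" using C[of x] by (simp add: pos_le_divide_eq mult.commute)
      then show "norm (f x) \<le> norm (C * (1 / (1 + x\<^sup>2)))" using abs_ge_self order.trans by fastforce
    qed
  qed (use f in measurable)
qed

lemma schwartz_L2: "f \<in> schwartz \<Longrightarrow> f \<in> L2"
proof (rule L2I)
  assume f: "f \<in> schwartz"
  show "integrable lborel (\<lambda>x. (cmod (f x))\<^sup>2)"
    using integrable_norm[OF schwartz_integrable[OF schwartz_mult[OF f f]]]
    by (simp add: norm_mult power2_eq_square)
qed (simp add: schwartz_measurable)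

lemma schwartz_zero: "(\<lambda>x. 0) \<in> schwartz"
  using schwartz_poly_gaussian[of 1 0] by simp

lemma L2_subspace_schwartz: "L2_subspace schwartz"
  unfolding L2_subspace_def
  by (auto intro: schwartz_zero schwartz_L2 schwartz_add schwartz_scale)

text \<open>
  The positive and the negative part of \<open>h\<close> are the densities of finite measures that agree on all half-lines,
  hence everywhere.
\<close>

lemma integrable_zero_by_halflines_real:
  fixes h :: "real \<Rightarrow> real"
  assumes h: "integrable lborel h"
    and zero: "\<And>a. (LINT x|lborel. indicator {a<..} x * h x) = 0"
  shows "AE x in lborel. h x = 0"
proof -
  have [measurable]: "h \<in> borel_measurable borel" using h by auto
  let ?p = "\<lambda>x. ennreal (max 0 (h x))" and ?n = "\<lambda>x. ennreal (max 0 (- h x))"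
  have int: "integrable lborel (\<lambda>x. indicator {a<..} x * max 0 (h x))"
    "integrable lborel (\<lambda>x. indicator {a<..} x * max 0 (- h x))" for a
    by (rule Bochner_Integration.integrable_bound[OF h]; force simp: indicator_def)+
  have emeasure: "emeasure (density lborel ?p) {a<..} = ennreal (LINT x|lborel. indicator {a<..} x * max 0 (h x))"
    "emeasure (density lborel ?n) {a<..} = ennreal (LINT x|lborel. indicator {a<..} x * max 0 (- h x))" for a
    by (simp_all add: emeasure_density nn_integral_eq_integral[OF int(1), symmetric]
        nn_integral_eq_integral[OF int(2), symmetric])
       (auto intro!: nn_integral_cong simp: indicator_def)
  have eq: "(LINT x|lborel. indicator {a<..} x * max 0 (h x)) = (LINT x|lborel. indicator {a<..} x * max 0 (- h x))" for a
  proof -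
    have "(LINT x|lborel. indicator {a<..} x * max 0 (h x)) - (LINT x|lborel. indicator {a<..} x * max 0 (- h x))
      = (LINT x|lborel. indicator {a<..} x * max 0 (h x) - indicator {a<..} x * max 0 (- h x))"
      by (rule Bochner_Integration.integral_diff[symmetric, OF int])
    also have "\<dots> = (LINT x|lborel. indicator {a<..} x * h x)"
      by (intro Bochner_Integration.integral_cong refl) (auto simp: indicator_def max_def)
    finally show ?thesis using zero[of a] by simp
  qed
  have "density lborel ?p = density lborel ?n"
    by (rule measure_eqI_lessThan)
       (simp_all only: emeasure eq sets_density sets_lborel ennreal_less_top infinity_ennreal_def)
  then have "AE x in lborel. ?p x = ?n x"
  proof (subst (asm) finite_density_unique)
    have "(\<integral>\<^sup>+x. ?p x \<partial>lborel) \<le> (\<integral>\<^sup>+x. ennreal (norm (h x)) \<partial>lborel)"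
      by (intro nn_integral_mono ennreal_leI) auto
    also have "\<dots> < \<infinity>" using h by (simp add: integrable_iff_bounded)
    finally show "(\<integral>\<^sup>+x. ?p x \<partial>lborel) \<noteq> \<infinity>" by simp
  qed auto
  then show ?thesis by eventually_elim (auto simp: max_def split: if_splits)
qed

text \<open>
  Rational end points suffice, by dominated convergence. This makes the family of tests countable, which is
  what the countability of orthonormal bases is derived from.
\<close>

lemma integrable_zero_by_halflines:
  fixes h :: "real \<Rightarrow> complex"
  assumes h: "integrable lborel h"
    and zero: "\<And>a. a \<in> \<rat> \<Longrightarrow> (LINT x|lborel. indicator {a<..} x * h x) = 0"
  shows "AE x in lborel. h x = 0"
proof -
  have [measurable]: "h \<in> borel_measurable borel" using h by auto
  have int: "integrable lborel (\<lambda>x. indicator {a<..} x * h x)" for a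
    by (rule Bochner_Integration.integrable_bound[OF h]) (auto simp: indicator_def)
  have all: "(LINT x|lborel. indicator {a<..} x * h x) = 0" for a
  proof -
    have "\<forall>n. \<exists>q. q \<in> \<rat> \<and> a < q \<and> q < a + 1 / real (Suc n)"
      using Rats_dense_in_real[of a "a + 1 / real (Suc n)" for n] by (auto simp del: of_nat_Suc)
    then obtain q where q: "\<And>n. q n \<in> \<rat>" "\<And>n. a < q n" "\<And>n. q n < a + 1 / real (Suc n)" by metis
    have qlim: "q \<longlonglongrightarrow> a"
    proof (rule tendsto_sandwich[of "\<lambda>_. a"])
      show "(\<lambda>n. a + 1 / real (Suc n)) \<longlonglongrightarrow> a"
        using tendsto_add[OF tendsto_const LIMSEQ_Suc[OF lim_1_over_n], of a] by simp
      show "\<forall>\<^sub>F n in sequentially. a \<le> q n" "\<forall>\<^sub>F n in sequentially. q n \<le> a + 1 / real (Suc n)"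
        by (intro always_eventually allI less_imp_le q)+
    qed simp
    have "(\<lambda>n. LINT x|lborel. indicator {q n<..} x * h x) \<longlonglongrightarrow> (LINT x|lborel. indicator {a<..} x * h x)"
    proof (rule integral_dominated_convergence[where w="\<lambda>x. norm (h x)"])
      show "AE x in lborel. (\<lambda>n. indicator {q n<..} x * h x) \<longlonglongrightarrow> indicator {a<..} x * h x"
      proof (rule AE_I2)
        fix x
        have "\<forall>\<^sub>F n in sequentially. indicator {q n<..} x * h x = indicator {a<..} x * h x"
        proof (cases "a < x")
          case True
          then have "\<forall>\<^sub>F n in sequentially. q n < x" using order_tendstoD(2)[OF qlim] by blast
          then show ?thesis by eventually_elim (use True in \<open>auto simp: indicator_def\<close>)
        next
          case False
          then have "\<not> q n < x" for n using q(2)[of n] by linarith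
          then show ?thesis using False by (simp add: indicator_def)
        qed
        then show "(\<lambda>n. indicator {q n<..} x * h x) \<longlonglongrightarrow> indicator {a<..} x * h x"
          by (rule tendsto_eventually)
      qed
      show "AE x in lborel. norm (indicator {q n<..} x * h x) \<le> norm (h x)" for n
        by (auto simp: indicator_def)
    qed (use h in \<open>auto intro: integrable_norm\<close>)
    moreover have "(LINT x|lborel. indicator {q n<..} x * h x) = 0" for n by (rule zero[OF q(1)])
    ultimately show ?thesis by (simp add: LIMSEQ_const_iff)
  qed
  have "AE x in lborel. Re (h x) = 0"
  proof (rule integrable_zero_by_halflines_real)
    fix a
    have "(LINT x|lborel. indicator {a<..} x * Re (h x)) = (LINT x|lborel. Re (indicator {a<..} x * h x))"
      by (intro Bochner_Integration.integral_cong refl) (auto simp: indicator_def)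
    also have "\<dots> = 0" using integral_Re[OF int[of a]] all[of a] by simp
    finally show "(LINT x|lborel. indicator {a<..} x * Re (h x)) = 0" .
  qed (use h in simp)
  moreover have "AE x in lborel. Im (h x) = 0"
  proof (rule integrable_zero_by_halflines_real)
    fix a
    have "(LINT x|lborel. indicator {a<..} x * Im (h x)) = (LINT x|lborel. Im (indicator {a<..} x * h x))"
      by (intro Bochner_Integration.integral_cong refl) (auto simp: indicator_def)
    also have "\<dots> = 0" using integral_Im[OF int[of a]] all[of a] by simp
    finally show "(LINT x|lborel. indicator {a<..} x * Im (h x)) = 0" .
  qed (use h in simp)
  ultimately show ?thesis by eventually_elim (simp add: complex_eq_iff)
qed

definition bell :: "real \<Rightarrow> complex" where
  "bell x = of_real (exp (- x\<^sup>2 / 2))"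

lemma bell_schwartz: "bell \<in> schwartz"
  using schwartz_poly_gaussian[of "1/2" 1] by (simp add: bell_def[abs_def])

lemma bell_nonzero[simp]: "bell x \<noteq> 0" by (simp add: bell_def)

lemma cnj_bell[simp]: "cnj (bell x) = bell x" by (simp add: bell_def)

lemma bell_measurable[measurable]: "bell \<in> borel_measurable borel"
  using bell_schwartz by measurable

text \<open>
  As \<open>\<epsilon> \<rightarrow> 0\<close> these Schwartz functions converge boundedly to twice the Gaussian cut off to the half-line
  \<open>{a<..}\<close>.
\<close>

lemma schwartz_step:
  assumes "\<epsilon> > 0"
  shows "(\<lambda>x. (1 + of_real ((x - a) / sqrt ((x - a)\<^sup>2 + \<epsilon>\<^sup>2))) * bell x) \<in> schwartz" (is "?f \<in> _")
proof -
  have pos: "0 < y\<^sup>2 + \<epsilon>\<^sup>2" for y :: real using assms by (simp add: add_nonneg_pos)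
  have "slow (\<lambda>x. poly [:0, 1:] (of_real (x - a)) * of_real (((x - a)\<^sup>2 + \<epsilon>\<^sup>2) powr (- 1 / 2)))"
    by (rule slow_quadratic_powr[OF assms])
  moreover have "poly [:0, 1:] (complex_of_real (x - a)) * of_real (((x - a)\<^sup>2 + \<epsilon>\<^sup>2) powr (- 1 / 2))
      = of_real ((x - a) / sqrt ((x - a)\<^sup>2 + \<epsilon>\<^sup>2))" for x
    using pos[of "x - a"] powr_minus_divide[of "(x - a)\<^sup>2 + \<epsilon>\<^sup>2" "1/2"]
    by (simp add: powr_half_sqrt del: of_real_diff)
  ultimately have "slow (\<lambda>x. of_real ((x - a) / sqrt ((x - a)\<^sup>2 + \<epsilon>\<^sup>2)))" by simp
  from schwartz_add[OF bell_schwartz schwartz_mult_slow[OF this bell_schwartz]]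
  show ?thesis by (simp add: distrib_right)
qed

text \<open>
  Passing to the limit in smoothed steps shows that the integrals of \<open>bell \<cdot> g\<close> over all half-lines vanish.
\<close>

theorem zero_by_schwartz_tests:
  assumes [measurable]: "g \<in> borel_measurable borel"
    and int: "\<And>\<psi>. \<psi> \<in> schwartz \<Longrightarrow> integrable lborel (\<lambda>x. cnj (\<psi> x) * g x)"
    and zero: "\<And>\<psi>. \<psi> \<in> schwartz \<Longrightarrow> (LINT x|lborel. cnj (\<psi> x) * g x) = 0"
  shows "AE x in lborel. g x = 0"
proof -
  have bg: "integrable lborel (\<lambda>x. bell x * g x)"
    using int[OF bell_schwartz] by simp
  have "(LINT x|lborel. indicator {a<..} x * (bell x * g x)) = 0" for a
  proof -
    define \<sigma> where "\<sigma> n x = (x - a) / sqrt ((x - a)\<^sup>2 + (1 / real (Suc n))\<^sup>2)" for n x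
    have [measurable]: "\<sigma> n \<in> borel_measurable borel" for n unfolding \<sigma>_def by measurable
    have \<sigma>_le: "\<bar>\<sigma> n x\<bar> \<le> 1" for n x
    proof -
      have "\<bar>x - a\<bar> \<le> sqrt ((x - a)\<^sup>2 + (1 / real (Suc n))\<^sup>2)"
        by (rule real_le_rsqrt) simp
      moreover have "0 < (x - a)\<^sup>2 + (1 / real (Suc n))\<^sup>2" by (intro add_nonneg_pos) auto
      ultimately show ?thesis
        by (simp add: \<sigma>_def abs_divide divide_le_eq_1 del: of_nat_Suc)
    qed
    have \<sigma>_lim: "(\<lambda>n. \<sigma> n x) \<longlonglongrightarrow> sgn (x - a)" if "x \<noteq> a" for x
    proof -
      have "(\<lambda>n. \<sigma> n x) \<longlonglongrightarrow> (x - a) / sqrt ((x - a)\<^sup>2 + 0\<^sup>2)"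
        unfolding \<sigma>_def using that by (intro tendsto_intros LIMSEQ_Suc[OF lim_1_over_n]) auto
      moreover have "(x - a) / sqrt ((x - a)\<^sup>2 + 0\<^sup>2) = sgn (x - a)"
        using that by (auto simp: sgn_real_def abs_if field_simps)
      ultimately show ?thesis by simp
    qed
    have "(\<lambda>n. LINT x|lborel. (1 + of_real (\<sigma> n x)) * (bell x * g x))
      \<longlonglongrightarrow> (LINT x|lborel. (1 + of_real (sgn (x - a))) * (bell x * g x))"
    proof (rule integral_dominated_convergence[where w="\<lambda>x. 2 * norm (bell x * g x)"])
      have "AE x in lborel. x \<noteq> a" by (rule AE_lborel_singleton)
      then show "AE x in lborel. (\<lambda>n. (1 + of_real (\<sigma> n x)) * (bell x * g x)) \<longlonglongrightarrow> (1 + of_real (sgn (x - a))) * (bell x * g x)"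
        by eventually_elim (intro tendsto_intros \<sigma>_lim)
      have "cmod (1 + of_real (\<sigma> n x)) \<le> 2" for n x
        using norm_triangle_ineq[of 1 "complex_of_real (\<sigma> n x)"] \<sigma>_le[of n x] by simp
      then show "AE x in lborel. norm ((1 + of_real (\<sigma> n x)) * (bell x * g x)) \<le> 2 * norm (bell x * g x)" for n
        by (intro AE_I2) (simp add: norm_mult mult_right_mono)
      show "integrable lborel (\<lambda>x. 2 * norm (bell x * g x))"
        by (intro integrable_mult_right integrable_norm bg)
    qed measurable
    moreover have "(LINT x|lborel. (1 + of_real (\<sigma> n x)) * (bell x * g x)) = 0" for n
      using zero[OF schwartz_step[of "1 / real (Suc n)" a]] by (simp add: \<sigma>_def mult.assoc)
    ultimately have "(LINT x|lborel. (1 + of_real (sgn (x - a))) * (bell x * g x)) = 0"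
      by (simp add: LIMSEQ_const_iff)
    also have "(LINT x|lborel. (1 + of_real (sgn (x - a))) * (bell x * g x))
      = (LINT x|lborel. 2 * (indicator {a<..} x * (bell x * g x)))"
    proof (rule integral_cong_AE)
      show "AE x in lborel. (1 + of_real (sgn (x - a))) * (bell x * g x) = 2 * (indicator {a<..} x * (bell x * g x))"
        using AE_lborel_singleton[of a] by eventually_elim (auto simp: sgn_real_def indicator_def)
    qed measurable
    finally show ?thesis by simp
  qed
  then have "AE x in lborel. bell x * g x = 0"
    by (intro integrable_zero_by_halflines[OF bg])
  then show ?thesis by simp
qed

lemma is_function_unique:
  assumes "is_function T g" "is_function T h" shows "AE x in lborel. g x = h x"
proof -
  have "AE x in lborel. g x - h x = 0"
  proof (rule zero_by_schwartz_tests)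
    show "(\<lambda>x. g x - h x) \<in> borel_measurable borel"
      using assms by (auto simp: is_function_def)
    fix \<psi> assume "\<psi> \<in> schwartz"
    then have *: "integrable lborel (\<lambda>x. cnj (\<psi> x) * g x)" "integrable lborel (\<lambda>x. cnj (\<psi> x) * h x)"
      "(LINT x|lborel. cnj (\<psi> x) * g x) = (LINT x|lborel. cnj (\<psi> x) * h x)"
      using assms by (auto simp: is_function_def dist_of_fun_def)
    show "integrable lborel (\<lambda>x. cnj (\<psi> x) * (g x - h x))"
      using * by (simp add: right_diff_distrib)
    show "(LINT x|lborel. cnj (\<psi> x) * (g x - h x)) = 0"
      using * by (simp add: right_diff_distrib)
  qed
  then show ?thesis by simp
qed

lemma fun_of_dist_AE:
  assumes "is_function T g" shows "AE x in lborel. fun_of_dist T x = g x" "is_function T (fun_of_dist T)"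
proof -
  show "is_function T (fun_of_dist T)" unfolding fun_of_dist_def using assms someI[of "is_function T" g] by blast
  then show "AE x in lborel. fun_of_dist T x = g x" using assms by (rule is_function_unique)
qed

lemma L2_eq_by_schwartz_tests:
  assumes "f \<in> L2" "g \<in> L2" "\<And>\<psi>. \<psi> \<in> schwartz \<Longrightarrow> L2_inner \<psi> f = L2_inner \<psi> g"
  shows "AE x in lborel. f x = g x"
  using assms
  by (intro is_function_unique[of "\<lambda>\<psi>. L2_inner \<psi> f"])
     (auto simp: is_function_def dist_of_fun_def L2_inner_def schwartz_L2
       intro: L2_inner_integrable[unfolded L2_inner_def])

text \<open>
  The projection of \<open>f\<close> onto the closure of the Schwartz functions has the same pairings with Schwartz functions
  as \<open>f\<close>, and therefore equals \<open>f\<close>.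
\<close>

theorem schwartz_dense:
  assumes f: "f \<in> L2"
  obtains u :: "nat \<Rightarrow> real \<Rightarrow> complex" where "\<And>n. u n \<in> schwartz"
    "(\<lambda>n. L2_norm (\<lambda>x. u n x - f x)) \<longlonglongrightarrow> 0"
proof -
  obtain g u where g: "g \<in> L2" "\<And>\<psi>. \<psi> \<in> schwartz \<Longrightarrow> L2_inner \<psi> f = L2_inner \<psi> g"
    "\<And>n :: nat. u n \<in> schwartz" "(\<lambda>n. L2_norm (\<lambda>x. u n x - g x)) \<longlonglongrightarrow> 0"
  proof (rule L2_Riesz[OF L2_subspace_schwartz, of "\<lambda>\<psi>. L2_inner \<psi> f" "L2_norm f"])
    show "L2_inner (\<lambda>x. \<phi> x + \<psi> x) f = L2_inner \<phi> f + L2_inner \<psi> f" if "\<phi> \<in> schwartz" "\<psi> \<in> schwartz" for \<phi> \<psi>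
      using that f by (simp add: L2_inner_add_left schwartz_L2)
    show "cmod (L2_inner \<psi> f) \<le> L2_norm f * L2_norm \<psi>" if "\<psi> \<in> schwartz" for \<psi>
      using L2_Cauchy_Schwarz[OF schwartz_L2[OF that] f] by (simp add: mult.commute)
  qed (auto simp: L2_inner_scale_left)
  have "AE x in lborel. f x = g x"
    using g f by (intro L2_eq_by_schwartz_tests) auto
  then have "L2_norm (\<lambda>x. u n x - f x) = L2_norm (\<lambda>x. u n x - g x)" for n
    by (intro L2_norm_cong_AE L2_measurable_borel L2_diff schwartz_L2 g f) auto
  then show ?thesis using g by (intro that[of u]) simp_all
qed

text \<open>
  The Gaussians cut off at rational points form a countable total set.
\<close>

theorem L2_orthonormal_bases_countable:
  assumes "L2_orthonormal_basis B" shows "countable B"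
proof -
  have q: "(\<lambda>x. indicator {a<..} x * bell x) \<in> L2" for a
    by (rule L2_bounded_by[OF schwartz_L2[OF bell_schwartz], of _ 1]) (auto simp: indicator_def)
  show ?thesis
  proof (rule L2_orthonormal_basis_countable[OF assms, of "(\<lambda>a x. indicator {a<..} x * bell x) ` \<rat>"])
    fix f assume f: "f \<in> L2" and orth: "\<And>q. q \<in> (\<lambda>a x. indicator {a<..} x * bell x) ` \<rat> \<Longrightarrow> L2_inner f q = 0"
    have "AE x in lborel. bell x * f x = 0"
    proof (rule integrable_zero_by_halflines)
      show "integrable lborel (\<lambda>x. bell x * f x)"
        by (rule L2_product_integrable[OF schwartz_L2[OF bell_schwartz] f])
      fix a :: real assume a: "a \<in> \<rat>"
      have complex_cnj_ind: "cnj (indicator {a<..} x) = indicator {a<..} x" for x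
        by (simp add: indicator_def)
      have "L2_inner (\<lambda>x. indicator {a<..} x * bell x) f = cnj (L2_inner f (\<lambda>x. indicator {a<..} x * bell x))"
        by (rule L2_inner_commute)
      also have "\<dots> = 0" using orth a by simp
      finally show "(LINT x|lborel. indicator {a<..} x * (bell x * f x)) = 0"
        using complex_cnj_ind by (simp add: L2_inner_def mult.assoc)
    qed
    then show "AE x in lborel. f x = 0" by simp
  qed (auto intro: q countable_rat countable_image)
qed

section \<open>The Fourier transform of Schwartz functions\<close>

abbreviation fconst :: complex where
  "fconst \<equiv> complex_of_real ((2 * pi) powr (- 1 / 2))"

lemma fconst_eq: "(2 * pi) powr (- 1 / 2) = 1 / sqrt (2 * pi)"
  using powr_minus_divide[of "2 * pi" "1/2"] by (simp add: powr_half_sqrt)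

lemma norm_exp_minus_i[simp]: "cmod (exp (- (\<i> * complex_of_real t))) = 1"
  by (simp add: norm_exp_eq_Re)

lemma norm_exp_times_i[simp]: "cmod (exp (\<i> * complex_of_real t)) = 1"
  by (simp add: norm_exp_eq_Re)

lemma norm_exp_i_products[simp]:
  "cmod (exp (- (\<i> * (complex_of_real s * complex_of_real t)))) = 1"
  "cmod (exp (\<i> * (complex_of_real s * complex_of_real t))) = 1"
  by (simp_all add: norm_exp_eq_Re)

lemma fourier_kernel_integrable:
  fixes f :: "real \<Rightarrow> complex"
  assumes f: "integrable lborel f"
  shows "integrable lborel (\<lambda>x. exp (- \<i> * complex_of_real (\<xi> * x)) * f x)"
    "integrable lborel (\<lambda>x. exp (\<i> * complex_of_real (\<xi> * x)) * f x)"
proof -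
  have [measurable]: "f \<in> borel_measurable borel" using f by auto
  show "integrable lborel (\<lambda>x. exp (- \<i> * complex_of_real (\<xi> * x)) * f x)"
    by (rule Bochner_Integration.integrable_bound[OF f]) (measurable, simp add: norm_mult)
  show "integrable lborel (\<lambda>x. exp (\<i> * complex_of_real (\<xi> * x)) * f x)"
    by (rule Bochner_Integration.integrable_bound[OF f]) (measurable, simp add: norm_mult)
qed

lemma fourier_norm_le: "cmod (fourier f \<xi>) \<le> (LINT x|lborel. cmod (f x))"
proof -
  let ?I = "LINT x|lborel. exp (- \<i> * complex_of_real (\<xi> * x)) * f x"
  have "cmod ?I \<le> (LINT x|lborel. cmod (exp (- \<i> * complex_of_real (\<xi> * x)) * f x))"
    by (rule integral_norm_bound)
  also have "\<dots> = (LINT x|lborel. cmod (f x))" by (simp add: norm_mult)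
  finally have I: "cmod ?I \<le> (LINT x|lborel. cmod (f x))" .
  have "1 / sqrt (2 * pi) \<le> 1" using pi_gt3 by simp
  then have "(2 * pi) powr (- 1 / 2) \<le> 1" by (simp only: fconst_eq)
  then have "(2 * pi) powr (- 1 / 2) * cmod ?I \<le> 1 * cmod ?I" by (intro mult_right_mono) auto
  with I show ?thesis by (simp add: fourier_def norm_mult)
qed

lemma fourier_add:
  "integrable lborel f \<Longrightarrow> integrable lborel g \<Longrightarrow> fourier (\<lambda>x. f x + g x) \<xi> = fourier f \<xi> + fourier g \<xi>"
  using fourier_kernel_integrable[of f] fourier_kernel_integrable[of g]
  by (simp add: fourier_def distrib_left)

lemma fourier_scale: "fourier (\<lambda>x. c * f x) \<xi> = c * fourier f \<xi>"
proof -
  have "(\<lambda>x. exp (- \<i> * complex_of_real (\<xi> * x)) * (c * f x))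
    = (\<lambda>x. c * (exp (- \<i> * complex_of_real (\<xi> * x)) * f x))" by (simp add: mult_ac)
  then show ?thesis unfolding fourier_def by (simp only: integral_mult_right_zero) (simp add: mult_ac)
qed

lemma inv_fourier_eq_cnj: "inv_fourier f x = cnj (fourier (\<lambda>y. cnj (f y)) x)"
proof -
  have "cnj (LINT y|lborel. exp (- \<i> * complex_of_real (x * y)) * cnj (f y))
    = (LINT y|lborel. cnj (exp (- \<i> * complex_of_real (x * y)) * cnj (f y)))"
    by (rule Bochner_Integration.integral_cnj[symmetric])
  also have "\<dots> = (LINT y|lborel. exp (\<i> * complex_of_real (x * y)) * f y)"
    by (simp add: exp_cnj)
  finally show ?thesis by (simp add: fourier_def inv_fourier_def)
qed

text \<open>
  Differentiation under the integral sign: the difference quotients of \<open>e\<^sup>-\<^sup>i\<^sup>\<xi>\<^sup>x\<close> in \<open>\<xi>\<close> are bounded by \<open>|x|\<close>, so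
  \<open>|x f(x)|\<close> is an integrable majorant.
\<close>

lemma fourier_has_vector_derivative:
  assumes f: "integrable lborel f" and xf: "integrable lborel (\<lambda>x. of_real x * f x)"
  shows "(fourier f has_vector_derivative fourier (\<lambda>x. - \<i> * of_real x * f x) \<xi>) (at \<xi>)"
proof -
  have [measurable]: "f \<in> borel_measurable borel" using f by auto
  let ?e = "\<lambda>\<xi> x. exp (- \<i> * complex_of_real (\<xi> * x))"
  have "((\<lambda>\<xi>. LINT x|lborel. ?e \<xi> x * f x) has_vector_derivative (LINT x|lborel. ?e \<xi> x * (- \<i> * of_real x * f x))) (at \<xi>)"
    unfolding has_vector_derivative_def has_derivative_iff_norm
  proof -
    show "bounded_linear (\<lambda>h. h *\<^sub>R (LINT x|lborel. ?e \<xi> x * (- \<i> * of_real x * f x))) \<and>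
      ((\<lambda>\<eta>. norm (((LINT x|lborel. ?e \<eta> x * f x) - (LINT x|lborel. ?e \<xi> x * f x)) -
          (\<eta> - \<xi>) *\<^sub>R (LINT x|lborel. ?e \<xi> x * (- \<i> * of_real x * f x))) / norm (\<eta> - \<xi>)) \<longlongrightarrow> 0) (at \<xi>)"
    proof (intro conjI bounded_linear_scaleR_left, unfold tendsto_at_iff_sequentially comp_def, intro allI impI)
      fix X :: "nat \<Rightarrow> real" assume X: "\<forall>i. X i \<in> UNIV - {\<xi>}" "X \<longlonglongrightarrow> \<xi>"
      have ne: "X n \<noteq> \<xi>" for n using X(1) by simp
      define q where "q n x = (?e (X n) x - ?e \<xi> x) / of_real (X n - \<xi>)" for n x
      have [measurable]: "q n \<in> borel_measurable borel" for n unfolding q_def by measurable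
      have q_bound: "cmod (q n x) \<le> \<bar>x\<bar>" for n x
      proof -
        have "?e (X n) x - ?e \<xi> x = ?e \<xi> x * (exp (\<i> * complex_of_real ((\<xi> - X n) * x)) - 1)"
          by (simp add: algebra_simps flip: exp_add)
        then have "cmod (?e (X n) x - ?e \<xi> x) = cmod (exp (\<i> * complex_of_real ((\<xi> - X n) * x)) - 1)"
          by (simp add: norm_mult)
        also have "\<dots> \<le> \<bar>(\<xi> - X n) * x\<bar>"
          using iexp_approx1[of "(\<xi> - X n) * x" 0] by simp
        finally show ?thesis
          using ne[of n] unfolding q_def norm_divide norm_of_real
          by (simp only: divide_le_eq abs_mult abs_minus_commute[of \<xi>] mult.commute) simp
      qed
      have q_lim: "(\<lambda>n. q n x) \<longlonglongrightarrow> ?e \<xi> x * (- \<i> * of_real x)" for x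
      proof -
        have "((\<lambda>z. exp (- \<i> * (z * of_real x))) has_field_derivative exp (- \<i> * (of_real \<xi> * of_real x)) * (- \<i> * of_real x)) (at (of_real \<xi>))"
          by (auto intro!: derivative_eq_intros)
        then have slope: "((\<lambda>w. (exp (- \<i> * (w * of_real x)) - exp (- \<i> * (of_real \<xi> * of_real x))) / (w - of_real \<xi>))
            \<longlongrightarrow> exp (- \<i> * (of_real \<xi> * of_real x)) * (- \<i> * of_real x)) (at (complex_of_real \<xi>))"
          by (simp only: has_field_derivative_iff)
        have "(\<lambda>n. (exp (- \<i> * (of_real (X n) * of_real x)) - exp (- \<i> * (of_real \<xi> * of_real x))) / (of_real (X n) - of_real \<xi>))
            \<longlonglongrightarrow> exp (- \<i> * (of_real \<xi> * of_real x)) * (- \<i> * of_real x)"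
          using slope[unfolded tendsto_at_iff_sequentially comp_def, rule_format, of "\<lambda>n. complex_of_real (X n)"]
            ne tendsto_of_real[OF X(2), where ?'a = complex] by simp
        then show ?thesis by (simp add: q_def)
      qed
      have int_q: "integrable lborel (\<lambda>x. q n x * f x)" for n
        by (rule Bochner_Integration.integrable_bound[OF xf]) (measurable, auto simp: norm_mult intro!: mult_right_mono q_bound)
      have "(\<lambda>n. LINT x|lborel. q n x * f x) \<longlonglongrightarrow> (LINT x|lborel. ?e \<xi> x * (- \<i> * of_real x) * f x)"
      proof (rule integral_dominated_convergence[where w="\<lambda>x. norm (of_real x * f x)"])
        show "AE x in lborel. (\<lambda>n. q n x * f x) \<longlonglongrightarrow> ?e \<xi> x * (- \<i> * of_real x) * f x"
          by (intro AE_I2 tendsto_mult q_lim tendsto_const)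
        show "AE x in lborel. norm (q n x * f x) \<le> norm (of_real x * f x)" for n
          by (auto simp: norm_mult intro!: mult_right_mono q_bound)
        show "integrable lborel (\<lambda>x. norm (of_real x * f x))" using xf by (rule integrable_norm)
      qed measurable
      moreover have "norm (((LINT x|lborel. ?e (X n) x * f x) - (LINT x|lborel. ?e \<xi> x * f x)) -
          (X n - \<xi>) *\<^sub>R (LINT x|lborel. ?e \<xi> x * (- \<i> * of_real x * f x))) / norm (X n - \<xi>)
        = norm ((LINT x|lborel. q n x * f x) - (LINT x|lborel. ?e \<xi> x * (- \<i> * of_real x) * f x))" for n
      proof -
        have "(LINT x|lborel. ?e (X n) x * f x) - (LINT x|lborel. ?e \<xi> x * f x)
          = (LINT x|lborel. of_real (X n - \<xi>) * (q n x * f x))"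
          using ne[of n]
          by (subst Bochner_Integration.integral_diff[symmetric, OF fourier_kernel_integrable(1)[OF f] fourier_kernel_integrable(1)[OF f]])
             (intro Bochner_Integration.integral_cong refl, simp add: q_def left_diff_distrib del: of_real_diff)
        then have "(LINT x|lborel. ?e (X n) x * f x) - (LINT x|lborel. ?e \<xi> x * f x)
          = (X n - \<xi>) *\<^sub>R (LINT x|lborel. q n x * f x)"
          by (simp add: scaleR_conv_of_real del: of_real_diff)
        moreover have "norm ((X n - \<xi>) *\<^sub>R A - (X n - \<xi>) *\<^sub>R B) / norm (X n - \<xi>) = norm (A - B)" for A B :: complex
          using ne[of n] by (simp add: scaleR_diff_right[symmetric])
        ultimately show ?thesis by (simp only: mult.assoc)
      qed
      ultimately show "(\<lambda>n. norm (((LINT x|lborel. ?e (X n) x * f x) - (LINT x|lborel. ?e \<xi> x * f x)) -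
          (X n - \<xi>) *\<^sub>R (LINT x|lborel. ?e \<xi> x * (- \<i> * of_real x * f x))) / norm (X n - \<xi>)) \<longlonglongrightarrow> 0"
        by (simp only: LIM_zero_iff tendsto_norm_zero_iff)
    qed
  qed
  then have "((\<lambda>\<xi>. fconst * (LINT x|lborel. ?e \<xi> x * f x)) has_vector_derivative
      fconst * (LINT x|lborel. ?e \<xi> x * (- \<i> * of_real x * f x))) (at \<xi>)"
    by (rule has_vector_derivative_mult_right)
  then show ?thesis unfolding fourier_def[abs_def] .
qed

lemma slow_of_real: "slow complex_of_real"
proof -
  have "x\<^sup>2 + 1 \<noteq> 0" for x :: real using one_plus_square_pos(3)[of x] by (simp add: add.commute)
  then show ?thesis using slow_quadratic_powr[of 1 "[:0, 1:]" 0 0] by simp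
qed

lemma schwartz_times_x: "f \<in> schwartz \<Longrightarrow> (\<lambda>x. of_real x * f x) \<in> schwartz"
  by (rule schwartz_mult_slow[OF slow_of_real])

lemma schwartz_at_infinity:
  assumes f: "f \<in> schwartz" shows "(f \<longlongrightarrow> 0) at_infinity"
proof -
  obtain C where C: "C \<ge> 0" "\<And>x. (1 + x\<^sup>2) ^ 1 * cmod (f x) \<le> C" using schwartz_decay[OF f] by blast
  have "((\<lambda>x. C / norm x) \<longlongrightarrow> 0) at_infinity"
    by (intro tendsto_divide_0[OF tendsto_const] filterlim_at_top_imp_at_infinity filterlim_norm_at_top)
  moreover have "\<forall>\<^sub>F x in at_infinity. norm (f x) \<le> C / norm x"
    unfolding eventually_at_infinity
  proof (intro exI[of _ 1] allI impI)
    fix x :: real assume x: "1 \<le> norm x"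
    have "\<bar>x\<bar> * cmod (f x) \<le> (1 + x\<^sup>2) * cmod (f x)"
      using zero_le_power2[of "\<bar>x\<bar> - 1/2"]
      by (intro mult_right_mono) (auto simp: power2_eq_square algebra_simps)
    then have "\<bar>x\<bar> * cmod (f x) \<le> C" using C(2)[of x] by simp
    then show "norm (f x) \<le> C / norm x" using x by (simp add: pos_le_divide_eq mult.commute)
  qed
  ultimately show ?thesis by (rule Lim_null_comparison[rotated])
qed

lemma schwartz_integral_vderiv:
  assumes f: "f \<in> schwartz" shows "(LINT x|lborel. vderiv f x) = 0"
proof -
  have "(LBINT x=-\<infinity>..\<infinity>. vderiv f x) = 0 - 0"
  proof (rule interval_integral_FTC_integrable[where F=f])
    show "set_integrable lborel (einterval (-\<infinity>) \<infinity>) (vderiv f)"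
      using schwartz_integrable[OF schwartz_vderiv[OF f]] by (simp add: set_integrable_def)
    show "((f \<circ> real_of_ereal) \<longlongrightarrow> 0) (at_right (-\<infinity>))"
      using filterlim_mono[OF schwartz_at_infinity[OF f] order.refl at_bot_le_at_infinity]
      by (simp add: ereal_tendsto_simps)
    show "((f \<circ> real_of_ereal) \<longlongrightarrow> 0) (at_left \<infinity>)"
      using filterlim_mono[OF schwartz_at_infinity[OF f] order.refl at_top_le_at_infinity]
      by (simp add: ereal_tendsto_simps)
    show "isCont (vderiv f) x" for x
      using schwartz_continuous[OF schwartz_vderiv[OF f], of UNIV] continuous_on_eq_continuous_at[of UNIV] by auto
  qed (auto intro: schwartz_has_vector_derivative f)
  then show ?thesis by (simp add: interval_lebesgue_integral_def set_lebesgue_integral_def)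
qed

lemma fourier_vderiv:
  assumes f: "f \<in> schwartz" shows "fourier (vderiv f) \<xi> = \<i> * of_real \<xi> * fourier f \<xi>"
proof -
  let ?e = "\<lambda>x. exp (- \<i> * complex_of_real (\<xi> * x))"
  have slow: "slow ?e" using slow_exp_i[of "- \<xi>"] by simp
  have ef: "(\<lambda>x. ?e x * f x) \<in> schwartz" by (rule schwartz_mult_slow[OF slow f])
  have d: "vderiv (\<lambda>x. ?e x * f x) x = ?e x * vderiv f x + (- \<i> * of_real \<xi>) * (?e x * f x)" for x
  proof -
    have "((\<lambda>z. exp (- \<i> * (of_real \<xi> * z))) has_field_derivative exp (- \<i> * (of_real \<xi> * of_real x)) * (- \<i> * of_real \<xi>)) (at (of_real x))"
      by (auto intro!: derivative_eq_intros)
    from has_vector_derivative_real_field[OF this]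
    have "(?e has_vector_derivative ?e x * (- \<i> * of_real \<xi>)) (at x)" by simp
    from has_vector_derivative_mult[OF this schwartz_has_vector_derivative[OF f]]
    show ?thesis by (simp add: vderiv_def vector_derivative_at mult_ac)
  qed
  have "0 = (LINT x|lborel. ?e x * vderiv f x + (- \<i> * of_real \<xi>) * (?e x * f x))"
    using schwartz_integral_vderiv[OF ef] unfolding d by simp
  also have "\<dots> = (LINT x|lborel. ?e x * vderiv f x) + (LINT x|lborel. (- \<i> * of_real \<xi>) * (?e x * f x))"
    by (intro Bochner_Integration.integral_add integrable_mult_right fourier_kernel_integrable(1) schwartz_integrable schwartz_vderiv f)
  also have "(LINT x|lborel. (- \<i> * of_real \<xi>) * (?e x * f x)) = (- \<i> * of_real \<xi>) * (LINT x|lborel. ?e x * f x)"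
    by (rule integral_mult_right_zero)
  finally have "(LINT x|lborel. ?e x * vderiv f x) = \<i> * of_real \<xi> * (LINT x|lborel. ?e x * f x)"
    by (simp add: algebra_simps)
  then show ?thesis by (simp add: fourier_def mult_ac)
qed

text \<open>
  Multiplying the transform of \<open>u\<close> by \<open>1 + \<xi>\<^sup>2\<close> gives the transform of \<open>u - u''\<close>, which is again a Schwartz
  function. Iterating this bounds \<open>(1 + \<xi>\<^sup>2)\<^sup>N\<close> times the transform by an \<open>L\<^sup>1\<close> norm. Derivatives of the
  transform are transforms of Schwartz functions as well.
\<close>

theorem schwartz_fourier:
  assumes f: "f \<in> schwartz" shows "fourier f \<in> schwartz"
proof -
  have "smooth_with rapid (fourier f)"
  proof (rule smooth_with_coinduct[of _ "fourier ` schwartz"])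
    fix g assume "g \<in> fourier ` schwartz"
    then obtain h where h: "h \<in> schwartz" "g = fourier h" by blast
    have "\<exists>u\<in>schwartz. \<forall>\<xi>. (1 + (of_real \<xi>)\<^sup>2) ^ N * fourier h \<xi> = fourier u \<xi>" for N
    proof (induction N)
      case (Suc N)
      then obtain u where u: "u \<in> schwartz" "\<And>\<xi>. (1 + (of_real \<xi>)\<^sup>2) ^ N * fourier h \<xi> = fourier u \<xi>" by blast
      let ?v = "\<lambda>x. u x + - 1 * vderiv (vderiv u) x"
      have v: "vderiv (vderiv u) \<in> schwartz" "(\<lambda>x. - 1 * vderiv (vderiv u) x) \<in> schwartz"
        by (intro schwartz_vderiv schwartz_scale u)+
      have "fourier ?v \<xi> = (1 + (of_real \<xi>)\<^sup>2) ^ Suc N * fourier h \<xi>" for \<xi>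
      proof -
        have "fourier ?v \<xi> = fourier u \<xi> + - 1 * fourier (vderiv (vderiv u)) \<xi>"
          by (subst fourier_add[OF schwartz_integrable[OF u(1)] schwartz_integrable[OF v(2)]])
             (simp only: fourier_scale)
        also have "\<dots> = (1 + (of_real \<xi>)\<^sup>2) * fourier u \<xi>"
          by (simp add: fourier_vderiv schwartz_vderiv u(1) algebra_simps power2_eq_square)
        finally show ?thesis using u(2)[of \<xi>] by simp
      qed
      then show ?case using schwartz_add[OF u(1) v(2)] by metis
    qed (use h in auto)
    then show "rapid g"
      unfolding rapid_def
    proof (intro allI)
      fix N
      obtain u where u: "u \<in> schwartz" "\<And>\<xi>. (1 + (of_real \<xi>)\<^sup>2) ^ N * fourier h \<xi> = fourier u \<xi>"
        using \<open>\<And>N. \<exists>u\<in>schwartz. \<forall>\<xi>. (1 + (of_real \<xi>)\<^sup>2) ^ N * fourier h \<xi> = fourier u \<xi>\<close> by blast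
      have "(1 + \<xi>\<^sup>2) ^ N * cmod (g \<xi>) \<le> (LINT x|lborel. cmod (u x))" for \<xi>
      proof -
        have "(1 + \<xi>\<^sup>2) ^ N * cmod (g \<xi>) = cmod (of_real (1 + \<xi>\<^sup>2) ^ N * fourier h \<xi>)"
          unfolding norm_mult norm_power norm_of_real h(2) by simp
        also have "\<dots> = cmod (fourier u \<xi>)" using u(2)[of \<xi>] by simp
        finally show ?thesis using fourier_norm_le[of u \<xi>] by simp
      qed
      then show "\<exists>C. \<forall>x. (1 + x\<^sup>2) ^ N * cmod (g x) \<le> C" by blast
    qed
    show "\<exists>g'\<in>fourier ` schwartz. \<forall>x. (g has_vector_derivative g' x) (at x)"
    proof (intro bexI[of _ "fourier (\<lambda>x. - \<i> * of_real x * h x)"] allI)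
      show "(g has_vector_derivative fourier (\<lambda>x. - \<i> * of_real x * h x) \<xi>) (at \<xi>)" for \<xi>
        unfolding h(2) by (intro fourier_has_vector_derivative schwartz_integrable schwartz_times_x h)
      show "fourier (\<lambda>x. - \<i> * of_real x * h x) \<in> fourier ` schwartz"
        using schwartz_scale[OF schwartz_times_x[OF h(1)], of "- \<i>"] by (simp add: mult.assoc)
    qed
  qed (use f in blast)
  then show ?thesis by (simp add: schwartz_altdef)
qed

lemma schwartz_inv_fourier: "f \<in> schwartz \<Longrightarrow> inv_fourier f \<in> schwartz"
  using schwartz_cnj[OF schwartz_fourier[OF schwartz_cnj[of f]]]
  by (simp add: inv_fourier_eq_cnj[abs_def])

lemma integrable_tensor:
  fixes f g :: "real \<Rightarrow> 'a :: {real_normed_field, banach, second_countable_topology}"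
  assumes f: "integrable lborel f" and g: "integrable lborel g"
  shows "integrable (lborel \<Otimes>\<^sub>M lborel) (\<lambda>(x, y). f x * g y)"
proof -
  have [measurable]: "f \<in> borel_measurable borel" "g \<in> borel_measurable borel" using f g by auto
  show ?thesis
  proof (rule lborel_pair.Fubini_integrable)
    have "(\<lambda>x. LINT y|lborel. norm (case (x, y) of (x, y) \<Rightarrow> f x * g y))
      = (\<lambda>x. norm (f x) * (LINT y|lborel. norm (g y)))" by (simp add: norm_mult)
    then show "integrable lborel (\<lambda>x. LINT y|lborel. norm (case (x, y) of (x, y) \<Rightarrow> f x * g y))"
      using f by simp
  qed (use g in auto)
qed

lemma integral_swap:
  fixes f :: "real \<Rightarrow> real \<Rightarrow> complex"
  assumes "integrable (lborel \<Otimes>\<^sub>M lborel) (\<lambda>(x, y). f x y)"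
  shows "(LINT x|lborel. LINT y|lborel. f x y) = (LINT y|lborel. LINT x|lborel. f x y)"
  using lborel_pair.Fubini_integral[OF assms] by simp

lemma std_normal_fourier:
  "(LINT s|lborel. exp (\<i> * complex_of_real (t * s)) * of_real (std_normal_density s))
     = of_real (exp (- t\<^sup>2 / 2))"
proof -
  have "of_real (exp (- t\<^sup>2 / 2)) = char std_normal_distribution t"
    by (simp add: char_std_normal_distribution)
  also have "\<dots> = (LINT s|lborel. std_normal_density s *\<^sub>R exp (\<i> * complex_of_real (t * s)))"
    unfolding char_def by (subst integral_density) auto
  finally show ?thesis by (simp add: scaleR_conv_of_real mult.commute)
qed

text \<open>
  Gaussian regularisation: insert the factor \<open>\<gamma>(\<xi>/n)\<close> with the standard normal density \<open>\<gamma>\<close> into the inversion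
  integral. By Fubini and the known transform of \<open>\<gamma>\<close> the regularised integral is the mean
  \<open>\<integral> \<gamma>(s) f(x + s/n) ds\<close>, which tends to \<open>f x\<close>. No further constant appears because \<open>\<gamma>(0)\<close> equals the
  normalisation constant of the Fourier transform.
\<close>

theorem fourier_inversion:
  assumes f: "f \<in> schwartz"
  shows "inv_fourier (fourier f) x = f x"
proof -
  define h where "h = fourier f"
  have h: "h \<in> schwartz" unfolding h_def by (rule schwartz_fourier[OF f])
  let ?\<gamma> = std_normal_density
  have [measurable]: "f \<in> borel_measurable borel" "h \<in> borel_measurable borel" using f h by measurable
  have \<gamma>int: "integrable lborel (\<lambda>s. complex_of_real (?\<gamma> s))" by simp
  have \<gamma>0: "?\<gamma> s \<le> 1 / sqrt (2 * pi)" for s by (simp add: std_normal_density_def divide_right_mono)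
  have \<gamma>eq: "exp (- t\<^sup>2 / 2) = sqrt (2 * pi) * ?\<gamma> t" for t by (simp add: std_normal_density_def)
  define I where "I n = (LINT \<xi>|lborel. of_real (?\<gamma> (\<xi> / real (Suc n))) * (exp (\<i> * complex_of_real (x * \<xi>)) * h \<xi>))" for n
  have "I \<longlonglongrightarrow> (LINT \<xi>|lborel. of_real (?\<gamma> 0) * (exp (\<i> * complex_of_real (x * \<xi>)) * h \<xi>))"
    unfolding I_def
  proof (rule integral_dominated_convergence[where w="\<lambda>\<xi>. 1 / sqrt (2 * pi) * norm (h \<xi>)"])
    show "AE \<xi> in lborel. (\<lambda>n. of_real (?\<gamma> (\<xi> / real (Suc n))) * (exp (\<i> * complex_of_real (x * \<xi>)) * h \<xi>))
        \<longlonglongrightarrow> of_real (?\<gamma> 0) * (exp (\<i> * complex_of_real (x * \<xi>)) * h \<xi>)"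
    proof (intro AE_I2 tendsto_mult tendsto_const tendsto_of_real)
      fix \<xi>
      have "(\<lambda>n. \<xi> * (1 / real (Suc n))) \<longlonglongrightarrow> \<xi> * 0" by (intro tendsto_mult tendsto_const LIMSEQ_Suc[OF lim_1_over_n])
      moreover have "isCont ?\<gamma> 0" unfolding std_normal_density_def by (intro continuous_intros) auto
      ultimately show "(\<lambda>n. ?\<gamma> (\<xi> / real (Suc n))) \<longlonglongrightarrow> ?\<gamma> 0"
        using isCont_tendsto_compose[of 0 ?\<gamma>] by simp
    qed
    show "integrable lborel (\<lambda>\<xi>. 1 / sqrt (2 * pi) * norm (h \<xi>))"
      by (intro integrable_mult_right integrable_norm schwartz_integrable h)
    show "AE \<xi> in lborel. norm (of_real (?\<gamma> (\<xi> / real (Suc n))) * (exp (\<i> * complex_of_real (x * \<xi>)) * h \<xi>))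
       \<le> 1 / sqrt (2 * pi) * norm (h \<xi>)" for n
      unfolding norm_mult norm_of_real norm_exp_times_i
      by (intro AE_I2) (simp only: abs_of_nonneg[OF normal_density_nonneg] mult_1 mult_right_mono[OF \<gamma>0 norm_ge_zero])
  qed measurable
  then have lim1: "I \<longlonglongrightarrow> inv_fourier h x"
    unfolding inv_fourier_def fconst_eq std_normal_density_def by simp
  have I_eq: "I n = (LINT s|lborel. of_real (?\<gamma> s) * f (x + s / real (Suc n)))" for n
  proof -
    define r where "r = real (Suc n)"
    have r: "r > 0" by (simp add: r_def)
    have gint: "integrable lborel (\<lambda>\<xi>. complex_of_real (?\<gamma> (\<xi> / r)))"
      using lborel_integrable_real_affine[OF \<gamma>int, of "1 / r" 0] r by simp
    have "I n = (LINT \<xi>|lborel. LINT y|lborel. fconst * (of_real (?\<gamma> (\<xi> / r)) * (exp (\<i> * complex_of_real ((x - y) * \<xi>)) * f y)))"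
    proof -
      have "of_real (?\<gamma> (\<xi> / r)) * (exp (\<i> * complex_of_real (x * \<xi>)) * h \<xi>)
        = (LINT y|lborel. fconst * (of_real (?\<gamma> (\<xi> / r)) * (exp (\<i> * complex_of_real ((x - y) * \<xi>)) * f y)))" for \<xi>
      proof -
        have "exp (\<i> * complex_of_real ((x - y) * \<xi>)) = exp (\<i> * complex_of_real (x * \<xi>)) * exp (- \<i> * complex_of_real (\<xi> * y))" for y
          by (simp add: algebra_simps flip: exp_add)
        then have "(\<lambda>y. fconst * (of_real (?\<gamma> (\<xi> / r)) * (exp (\<i> * complex_of_real ((x - y) * \<xi>)) * f y)))
          = (\<lambda>y. (fconst * of_real (?\<gamma> (\<xi> / r)) * exp (\<i> * complex_of_real (x * \<xi>))) * (exp (- \<i> * complex_of_real (\<xi> * y)) * f y))"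
          by (simp add: mult_ac)
        then show ?thesis
          by (simp only: integral_mult_right_zero h_def fourier_def) (simp add: mult_ac)
      qed
      then show ?thesis unfolding I_def r_def[symmetric] by (intro Bochner_Integration.integral_cong refl)
    qed
    also have "\<dots> = (LINT y|lborel. LINT \<xi>|lborel. fconst * (of_real (?\<gamma> (\<xi> / r)) * (exp (\<i> * complex_of_real ((x - y) * \<xi>)) * f y)))"
    proof (rule integral_swap, rule Bochner_Integration.integrable_bound)
      show "integrable (lborel \<Otimes>\<^sub>M lborel) (\<lambda>p. fconst * (\<lambda>(\<xi>, y). of_real (?\<gamma> (\<xi> / r)) * f y) p)"
        by (intro integrable_mult_right integrable_tensor gint schwartz_integrable f)
    qed (measurable, auto simp: norm_mult)
    also have "\<dots> = (LINT y|lborel. of_real (r * ?\<gamma> (r * (y - x))) * f y)"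
    proof (rule Bochner_Integration.integral_cong[OF refl])
      fix y
      have "(LINT \<xi>|lborel. exp (\<i> * complex_of_real ((x - y) * \<xi>)) * of_real (?\<gamma> (\<xi> / r)))
        = r *\<^sub>R (LINT s|lborel. exp (\<i> * complex_of_real ((x - y) * r * s)) * of_real (?\<gamma> s))"
        using r by (subst lborel_integral_real_affine[of r _ 0]) (simp_all add: mult.assoc)
      also have "\<dots> = r *\<^sub>R of_real (exp (- ((x - y) * r)\<^sup>2 / 2))"
        by (simp only: std_normal_fourier)
      also have "((x - y) * r)\<^sup>2 = (r * (y - x))\<^sup>2" by (simp add: power2_eq_square algebra_simps)
      finally have inner: "(LINT \<xi>|lborel. exp (\<i> * complex_of_real ((x - y) * \<xi>)) * of_real (?\<gamma> (\<xi> / r)))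
        = of_real (r * (sqrt (2 * pi) * ?\<gamma> (r * (y - x))))"
        by (simp only: \<gamma>eq scaleR_conv_of_real of_real_mult)
      have "(\<lambda>\<xi>. fconst * (of_real (?\<gamma> (\<xi> / r)) * (exp (\<i> * complex_of_real ((x - y) * \<xi>)) * f y)))
        = (\<lambda>\<xi>. (fconst * f y) * (exp (\<i> * complex_of_real ((x - y) * \<xi>)) * of_real (?\<gamma> (\<xi> / r))))"
        by (simp add: mult_ac)
      then have "(LINT \<xi>|lborel. fconst * (of_real (?\<gamma> (\<xi> / r)) * (exp (\<i> * complex_of_real ((x - y) * \<xi>)) * f y)))
        = (fconst * f y) * of_real (r * (sqrt (2 * pi) * ?\<gamma> (r * (y - x))))"
        by (simp only: integral_mult_right_zero inner)
      then show "(LINT \<xi>|lborel. fconst * (of_real (?\<gamma> (\<xi> / r)) * (exp (\<i> * complex_of_real ((x - y) * \<xi>)) * f y)))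
        = of_real (r * ?\<gamma> (r * (y - x))) * f y"
        unfolding fconst_eq by simp
    qed
    also have "\<dots> = \<bar>1 / r\<bar> *\<^sub>R (LINT s|lborel. of_real (r * ?\<gamma> s) * f (x + s / r))"
      using r by (subst lborel_integral_real_affine[of "1 / r" _ x]) simp_all
    also have "\<dots> = (LINT s|lborel. of_real (?\<gamma> s) * f (x + s / r))"
      using r by (simp add: scaleR_conv_of_real mult.assoc)
    finally show ?thesis by (simp add: r_def)
  qed
  have "I \<longlonglongrightarrow> (LINT s|lborel. of_real (?\<gamma> s) * f x)"
    unfolding I_eq[abs_def]
  proof -
    obtain C where C: "\<And>x. (1 + x\<^sup>2) ^ 0 * cmod (f x) \<le> C" using schwartz_decay[OF f] by blast
    show "(\<lambda>n. LINT s|lborel. of_real (?\<gamma> s) * f (x + s / real (Suc n))) \<longlonglongrightarrow> (LINT s|lborel. of_real (?\<gamma> s) * f x)"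
    proof (rule integral_dominated_convergence[where w="\<lambda>s. ?\<gamma> s * C"])
      show "AE s in lborel. (\<lambda>n. of_real (?\<gamma> s) * f (x + s / real (Suc n))) \<longlonglongrightarrow> of_real (?\<gamma> s) * f x"
      proof (intro AE_I2 tendsto_mult tendsto_const)
        fix s
        have "(\<lambda>n. x + s * (1 / real (Suc n))) \<longlonglongrightarrow> x + s * 0"
          by (intro tendsto_intros LIMSEQ_Suc[OF lim_1_over_n])
        moreover have "isCont f x"
          using schwartz_continuous[OF f, of UNIV] continuous_on_eq_continuous_at[of UNIV] by auto
        ultimately show "(\<lambda>n. f (x + s / real (Suc n))) \<longlonglongrightarrow> f x"
          using isCont_tendsto_compose[of x f] by simp
      qed
      show "AE s in lborel. norm (of_real (?\<gamma> s) * f (x + s / real (Suc n))) \<le> ?\<gamma> s * C" for n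
        using C by (intro AE_I2) (auto simp: norm_mult abs_of_nonneg[OF normal_density_nonneg] intro!: mult_left_mono)
    qed (auto simp: borel_measurable_times)
  qed
  moreover have "(LINT s|lborel. of_real (?\<gamma> s) * f x) = f x"
    using integral_std_normal_moment_even[of 0] by simp
  ultimately have "I \<longlonglongrightarrow> f x" by simp
  then show ?thesis using LIMSEQ_unique[OF lim1] by (simp add: h_def)
qed

lemma inv_fourier_fourier: "f \<in> schwartz \<Longrightarrow> inv_fourier (fourier f) = f"
  by (rule ext) (rule fourier_inversion)

lemma fourier_inv_fourier:
  assumes f: "f \<in> schwartz" shows "fourier (inv_fourier f) = f"
proof
  fix x
  define u where "u = fourier (\<lambda>y. cnj (f y))"
  have "cnj (f x) = inv_fourier u x"
    unfolding u_def using fourier_inversion[OF schwartz_cnj[OF f]] by simp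
  also have "\<dots> = cnj (fourier (\<lambda>y. cnj (u y)) x)" by (rule inv_fourier_eq_cnj)
  finally show "fourier (inv_fourier f) x = f x"
    by (simp add: u_def inv_fourier_eq_cnj[abs_def])
qed

lemma inv_fourier_adjoint:
  assumes f: "f \<in> schwartz" and g: "g \<in> schwartz"
  shows "L2_inner (inv_fourier f) g = L2_inner f (fourier g)"
proof -
  have [measurable]: "f \<in> borel_measurable borel" "g \<in> borel_measurable borel" using f g by measurable
  let ?k = "\<lambda>x y. fconst * (exp (- \<i> * complex_of_real (x * y)) * (cnj (f y) * g x))"
  have "L2_inner (inv_fourier f) g = (LINT x|lborel. LINT y|lborel. ?k x y)"
    unfolding L2_inner_def
  proof (rule Bochner_Integration.integral_cong[OF refl])
    fix x
    have "(\<lambda>y. ?k x y) = (\<lambda>y. (fconst * g x) * (exp (- \<i> * complex_of_real (x * y)) * cnj (f y)))"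
      by (simp add: mult_ac)
    then have "(LINT y|lborel. ?k x y) = (fconst * g x) * (LINT y|lborel. exp (- \<i> * complex_of_real (x * y)) * cnj (f y))"
      by (simp only: integral_mult_right_zero)
    moreover have "cnj (inv_fourier f x) = fconst * (LINT y|lborel. exp (- \<i> * complex_of_real (x * y)) * cnj (f y))"
      by (simp only: inv_fourier_eq_cnj fourier_def complex_cnj_cnj)
    ultimately show "cnj (inv_fourier f x) * g x = (LINT y|lborel. ?k x y)"
      by (simp only: mult.assoc) (simp only: mult.commute[of "g x"])
  qed
  also have "\<dots> = (LINT y|lborel. LINT x|lborel. ?k x y)"
  proof (rule integral_swap, rule Bochner_Integration.integrable_bound)
    show "integrable (lborel \<Otimes>\<^sub>M lborel) (\<lambda>p. fconst * (\<lambda>(x, y). g x * cnj (f y)) p)"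
      by (intro integrable_mult_right integrable_tensor schwartz_integrable schwartz_cnj f g)
  qed (measurable, auto simp: norm_mult)
  also have "\<dots> = L2_inner f (fourier g)"
    unfolding L2_inner_def
  proof (rule Bochner_Integration.integral_cong[OF refl])
    fix y
    have "(\<lambda>x. ?k x y) = (\<lambda>x. (fconst * cnj (f y)) * (exp (- \<i> * complex_of_real (y * x)) * g x))"
      by (simp add: mult_ac)
    then have "(LINT x|lborel. ?k x y) = (fconst * cnj (f y)) * (LINT x|lborel. exp (- \<i> * complex_of_real (y * x)) * g x)"
      by (simp only: integral_mult_right_zero)
    then show "(LINT x|lborel. ?k x y) = cnj (f y) * fourier g y"
      unfolding fourier_def by (simp only: mult.assoc mult.left_commute[of fconst])
  qed
  finally show ?thesis .
qed

theorem fourier_unitary: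
  "f \<in> schwartz \<Longrightarrow> g \<in> schwartz \<Longrightarrow> L2_inner (fourier f) (fourier g) = L2_inner f g"
  using inv_fourier_adjoint[OF schwartz_fourier[of f], of g] by (simp add: inv_fourier_fourier)

lemma fourier_norm:
  assumes "f \<in> schwartz" shows "L2_norm (fourier f) = L2_norm f"
proof -
  have "complex_of_real ((L2_norm (fourier f))\<^sup>2) = complex_of_real ((L2_norm f)\<^sup>2)"
    using fourier_unitary[OF assms assms] by (simp only: L2_inner_self)
  then show ?thesis by (simp only: of_real_eq_iff) (simp add: power2_eq_iff_nonneg)
qed

lemma inv_fourier_norm: "f \<in> schwartz \<Longrightarrow> L2_norm (inv_fourier f) = L2_norm f"
  using fourier_norm[OF schwartz_inv_fourier[of f]] by (simp add: fourier_inv_fourier)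

lemma inv_fourier_add:
  "f \<in> schwartz \<Longrightarrow> g \<in> schwartz \<Longrightarrow> inv_fourier (\<lambda>x. f x + g x) = (\<lambda>x. inv_fourier f x + inv_fourier g x)"
  by (simp add: inv_fourier_eq_cnj[abs_def] fourier_add schwartz_integrable schwartz_cnj)

lemma inv_fourier_scale: "inv_fourier (\<lambda>x. c * f x) = (\<lambda>x. c * inv_fourier f x)"
  by (simp add: inv_fourier_eq_cnj[abs_def] fourier_scale)

lemma schwartz_fourier_add:
  "f \<in> schwartz \<Longrightarrow> g \<in> schwartz \<Longrightarrow> fourier (\<lambda>x. f x + g x) = (\<lambda>x. fourier f x + fourier g x)"
  by (rule ext) (intro fourier_add schwartz_integrable)

lemma fourier_modulated:
  "fourier (\<lambda>x. exp (\<i> * complex_of_real (h * x)) * f x) \<xi> = fourier f (\<xi> - h)"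
proof -
  have "exp (- \<i> * complex_of_real (\<xi> * x)) * (exp (\<i> * complex_of_real (h * x)) * f x)
    = exp (- \<i> * complex_of_real ((\<xi> - h) * x)) * f x" for x
    by (simp only: mult.assoc[symmetric] exp_add[symmetric]) (simp add: algebra_simps)
  then show ?thesis by (simp only: fourier_def)
qed

text \<open>
  The convolution is an inner product of \<open>fourier g\<close> with a translate of \<open>fourier f\<close>, and translation corresponds
  to modulation; so this is an instance of unitarity.
\<close>

theorem fourier_convolution:
  assumes f: "f \<in> schwartz" and g: "g \<in> schwartz"
  shows "fourier (\<lambda>x. cnj (g x) * f x) \<zeta> = fconst * (LINT \<eta>|lborel. cnj (fourier g \<eta>) * fourier f (\<zeta> + \<eta>))"
proof -
  let ?f = "\<lambda>x. exp (\<i> * complex_of_real (- \<zeta> * x)) * f x"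
  have fs: "?f \<in> schwartz" by (rule schwartz_mult_slow[OF slow_exp_i f])
  have "fourier (\<lambda>x. cnj (g x) * f x) \<zeta> = fconst * L2_inner g ?f"
    by (simp add: fourier_def L2_inner_def mult_ac)
  also have "L2_inner g ?f = L2_inner (fourier g) (fourier ?f)"
    by (rule fourier_unitary[OF g fs, symmetric])
  finally show ?thesis
    by (simp only: L2_inner_def fourier_modulated) (simp add: add.commute)
qed

section \<open>The Fourier transform on \<open>L\<^sup>2\<close>\<close>

text \<open>
  Defined by duality, as for tempered distributions. The norm bound is included in the choice; it is what the
  representation theorem provides and what makes the transform an isometry.
\<close>

definition L2_fourier :: "(real \<Rightarrow> complex) \<Rightarrow> real \<Rightarrow> complex" where
  "L2_fourier f = (SOME g. g \<in> L2 \<and> L2_norm g \<le> L2_norm f \<and>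
     (\<forall>\<psi>\<in>schwartz. L2_inner (inv_fourier \<psi>) f = L2_inner \<psi> g))"

lemma L2_fourier:
  assumes f: "f \<in> L2"
  shows "L2_fourier f \<in> L2" "L2_norm (L2_fourier f) \<le> L2_norm f"
    "\<And>\<psi>. \<psi> \<in> schwartz \<Longrightarrow> L2_inner (inv_fourier \<psi>) f = L2_inner \<psi> (L2_fourier f)"
proof -
  obtain g where "g \<in> L2" "\<And>\<psi>. \<psi> \<in> schwartz \<Longrightarrow> L2_inner (inv_fourier \<psi>) f = L2_inner \<psi> g"
    "L2_norm f \<ge> 0 \<Longrightarrow> L2_norm g \<le> L2_norm f"
  proof (rule L2_Riesz[OF L2_subspace_schwartz, of "\<lambda>\<psi>. L2_inner (inv_fourier \<psi>) f" "L2_norm f"])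
    show "L2_inner (inv_fourier (\<lambda>x. \<phi> x + \<psi> x)) f = L2_inner (inv_fourier \<phi>) f + L2_inner (inv_fourier \<psi>) f"
      if "\<phi> \<in> schwartz" "\<psi> \<in> schwartz" for \<phi> \<psi>
      using that f by (simp add: inv_fourier_add L2_inner_add_left schwartz_L2 schwartz_inv_fourier)
    show "L2_inner (inv_fourier (\<lambda>x. c * \<psi> x)) f = cnj c * L2_inner (inv_fourier \<psi>) f" for c \<psi>
      by (simp add: inv_fourier_scale L2_inner_scale_left)
    show "cmod (L2_inner (inv_fourier \<psi>) f) \<le> L2_norm f * L2_norm \<psi>" if "\<psi> \<in> schwartz" for \<psi>
      using L2_Cauchy_Schwarz[OF schwartz_L2[OF schwartz_inv_fourier[OF that]] f]
      by (simp add: mult.commute inv_fourier_norm that)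
  qed (use that in blast)
  then have "\<exists>g. g \<in> L2 \<and> L2_norm g \<le> L2_norm f \<and>
     (\<forall>\<psi>\<in>schwartz. L2_inner (inv_fourier \<psi>) f = L2_inner \<psi> g)" by auto
  from someI_ex[OF this, folded L2_fourier_def]
  show "L2_fourier f \<in> L2" "L2_norm (L2_fourier f) \<le> L2_norm f"
    "\<And>\<psi>. \<psi> \<in> schwartz \<Longrightarrow> L2_inner (inv_fourier \<psi>) f = L2_inner \<psi> (L2_fourier f)" by auto
qed

lemma L2_fourier_test:
  "f \<in> L2 \<Longrightarrow> \<psi> \<in> schwartz \<Longrightarrow> L2_inner (fourier \<psi>) (L2_fourier f) = L2_inner \<psi> f"
  using L2_fourier(3)[of f "fourier \<psi>"] by (simp add: schwartz_fourier inv_fourier_fourier)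

lemma L2_fourier_unique:
  assumes "f \<in> L2" "g \<in> L2" "\<And>\<psi>. \<psi> \<in> schwartz \<Longrightarrow> L2_inner \<psi> f = L2_inner (fourier \<psi>) g"
  shows "AE x in lborel. L2_fourier f x = g x"
proof (rule L2_eq_by_schwartz_tests[OF L2_fourier(1)[OF assms(1)] assms(2)])
  fix \<psi> assume \<psi>: "\<psi> \<in> schwartz"
  have "L2_inner \<psi> (L2_fourier f) = L2_inner (inv_fourier \<psi>) f"
    by (rule L2_fourier(3)[OF assms(1) \<psi>, symmetric])
  also have "\<dots> = L2_inner (fourier (inv_fourier \<psi>)) g"
    by (rule assms(3)[OF schwartz_inv_fourier[OF \<psi>]])
  finally show "L2_inner \<psi> (L2_fourier f) = L2_inner \<psi> g" by (simp add: fourier_inv_fourier \<psi>)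
qed

lemma L2_fourier_schwartz:
  assumes f: "f \<in> schwartz" shows "AE x in lborel. L2_fourier f x = fourier f x"
  by (rule L2_fourier_unique) (auto simp: f schwartz_L2 schwartz_fourier fourier_unitary)

lemma L2_fourier_diff:
  assumes "f \<in> L2" "g \<in> L2"
  shows "AE x in lborel. L2_fourier (\<lambda>x. f x - g x) x = L2_fourier f x - L2_fourier g x"
  by (rule L2_fourier_unique)
     (auto simp: assms L2_diff L2_fourier L2_inner_diff_right L2_fourier_test schwartz_L2 schwartz_fourier)

lemma L2_fourier_diff_norm:
  assumes "f \<in> L2" "g \<in> L2"
  shows "L2_norm (\<lambda>x. L2_fourier f x - L2_fourier g x) \<le> L2_norm (\<lambda>x. f x - g x)"
proof -
  have "L2_norm (\<lambda>x. L2_fourier f x - L2_fourier g x) = L2_norm (L2_fourier (\<lambda>x. f x - g x))"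
    using L2_fourier_diff[OF assms]
    by (intro L2_norm_cong_AE L2_measurable_borel L2_diff L2_fourier assms) auto
  then show ?thesis using L2_fourier(2)[OF L2_diff[OF assms]] by simp
qed

text \<open>
  The identity holds by definition when the first argument is a Schwartz function. The general case follows by
  density and the norm bound.
\<close>

theorem L2_fourier_unitary:
  assumes e: "e \<in> L2" and f: "f \<in> L2"
  shows "L2_inner (L2_fourier e) (L2_fourier f) = L2_inner e f"
proof -
  obtain u where u: "\<And>n. u n \<in> schwartz" "(\<lambda>n. L2_norm (\<lambda>x. u n x - e x)) \<longlonglongrightarrow> 0"
    using schwartz_dense[OF e] by blast
  have uL2: "u n \<in> L2" for n by (intro schwartz_L2 u)
  have "(\<lambda>n. L2_norm (\<lambda>x. fourier (u n) x - L2_fourier e x)) \<longlonglongrightarrow> 0"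
  proof (rule tendsto_sandwich[of "\<lambda>_. 0"])
    have "L2_norm (\<lambda>x. fourier (u n) x - L2_fourier e x) = L2_norm (\<lambda>x. L2_fourier (u n) x - L2_fourier e x)" for n
      using L2_fourier_schwartz[OF u(1)[of n]]
      by (intro L2_norm_cong_AE L2_measurable_borel L2_diff L2_fourier e schwartz_L2 schwartz_fourier u) auto
    then show "\<forall>\<^sub>F n in sequentially. L2_norm (\<lambda>x. fourier (u n) x - L2_fourier e x) \<le> L2_norm (\<lambda>x. u n x - e x)"
      using L2_fourier_diff_norm[OF uL2 e] by simp
  qed (use u in auto)
  then have "(\<lambda>n. L2_inner (fourier (u n)) (L2_fourier f)) \<longlonglongrightarrow> L2_inner (L2_fourier e) (L2_fourier f)"
    by (intro L2_inner_tendsto L2_fourier e f schwartz_L2 schwartz_fourier u)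
  moreover have "(\<lambda>n. L2_inner (u n) f) \<longlonglongrightarrow> L2_inner e f"
    by (intro L2_inner_tendsto uL2 e f u)
  ultimately show ?thesis
    using LIMSEQ_unique by (simp add: L2_fourier_test f u)
qed

lemma L2_fourier_norm: "f \<in> L2 \<Longrightarrow> L2_norm (L2_fourier f) = L2_norm f"
proof -
  assume "f \<in> L2"
  then have "complex_of_real ((L2_norm (L2_fourier f))\<^sup>2) = complex_of_real ((L2_norm f)\<^sup>2)"
    using L2_fourier_unitary[of f f] by (simp only: L2_inner_self)
  then show ?thesis by (simp only: of_real_eq_iff) (simp add: power2_eq_iff_nonneg)
qed

theorem L2_fourier_surj:
  assumes g: "g \<in> L2"
  obtains f where "f \<in> L2" "AE x in lborel. L2_fourier f x = g x"
proof -
  obtain f where f: "f \<in> L2" "\<And>\<psi>. \<psi> \<in> schwartz \<Longrightarrow> L2_inner (fourier \<psi>) g = L2_inner \<psi> f"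
  proof (rule L2_Riesz[OF L2_subspace_schwartz, of "\<lambda>\<psi>. L2_inner (fourier \<psi>) g" "L2_norm g"])
    show "L2_inner (fourier (\<lambda>x. \<phi> x + \<psi> x)) g = L2_inner (fourier \<phi>) g + L2_inner (fourier \<psi>) g"
      if "\<phi> \<in> schwartz" "\<psi> \<in> schwartz" for \<phi> \<psi>
      using that g by (simp add: schwartz_fourier_add L2_inner_add_left schwartz_L2 schwartz_fourier)
    show "L2_inner (fourier (\<lambda>x. c * \<psi> x)) g = cnj c * L2_inner (fourier \<psi>) g" for c \<psi>
      by (simp add: fourier_scale[abs_def] L2_inner_scale_left)
    show "cmod (L2_inner (fourier \<psi>) g) \<le> L2_norm g * L2_norm \<psi>" if "\<psi> \<in> schwartz" for \<psi>
      using L2_Cauchy_Schwarz[OF schwartz_L2[OF schwartz_fourier[OF that]] g]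
      by (simp add: mult.commute fourier_norm that)
  qed (use that in blast)
  then have "AE x in lborel. L2_fourier f x = g x"
    using g by (intro L2_fourier_unique) auto
  then show ?thesis using f(1) that by blast
qed

lemma L2_multiplier:
  assumes "f \<in> L2" "\<And>x. 0 \<le> m x" "\<And>x. m x \<le> C" and [measurable]: "m \<in> borel_measurable borel"
  shows "(\<lambda>x. complex_of_real (m x) * f x) \<in> L2"
proof (rule L2_bounded_by[OF assms(1), of _ C])
  have [measurable]: "f \<in> borel_measurable borel" using assms(1) by auto
  show "(\<lambda>x. complex_of_real (m x) * f x) \<in> borel_measurable borel" by measurable
qed (use assms in \<open>auto simp: norm_mult intro!: mult_right_mono\<close>)

lemma L2_norm_multiplier_le:
  assumes f: "f \<in> L2" and m: "\<And>x. 0 \<le> m x" "\<And>x. m x \<le> C" and [measurable]: "m \<in> borel_measurable borel"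
  shows "L2_norm (\<lambda>x. complex_of_real (m x) * f x) \<le> C * L2_norm f"
proof -
  have C: "C \<ge> 0" using m[of 0] by linarith
  have "(L2_norm (\<lambda>x. complex_of_real (m x) * f x))\<^sup>2 \<le> (L2_norm (\<lambda>x. complex_of_real C * f x))\<^sup>2"
    unfolding L2_norm_squared
  proof (rule integral_mono)
    show "integrable lborel (\<lambda>x. (cmod (complex_of_real (m x) * f x))\<^sup>2)"
      by (rule L2_integrable[OF L2_multiplier[OF f m]]) measurable
    show "integrable lborel (\<lambda>x. (cmod (complex_of_real C * f x))\<^sup>2)"
      by (rule L2_integrable[OF L2_scale[OF f]])
    show "(cmod (complex_of_real (m x) * f x))\<^sup>2 \<le> (cmod (complex_of_real C * f x))\<^sup>2" for x
      using m[of x] C by (intro power_mono) (auto simp: norm_mult intro!: mult_right_mono)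
  qed
  then have "L2_norm (\<lambda>x. complex_of_real (m x) * f x) \<le> L2_norm (\<lambda>x. complex_of_real C * f x)"
    by (rule power2_le_imp_le) simp
  then show ?thesis using C by (simp add: L2_norm_scale)
qed

section \<open>The sandwiched operator of a Sobolev multiplier\<close>

definition root_symbol :: "real \<Rightarrow> real \<Rightarrow> real" where
  "root_symbol \<kappa> \<xi> = (\<xi>\<^sup>2 + \<kappa>\<^sup>2) powr (- 1 / 2)"

definition bracket :: "real \<Rightarrow> real" where
  "bracket \<xi> = sqrt (1 + \<xi>\<^sup>2)"

definition h1_norm :: "(real \<Rightarrow> complex) \<Rightarrow> real" where
  "h1_norm \<phi> = L2_norm (\<lambda>\<xi>. of_real (bracket \<xi>) * fourier \<phi> \<xi>)"

definition root_op :: "real \<Rightarrow> (real \<Rightarrow> complex) \<Rightarrow> real \<Rightarrow> complex" where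
  "root_op \<kappa> \<psi> = inv_fourier (\<lambda>\<xi>. of_real (root_symbol \<kappa> \<xi>) * fourier \<psi> \<xi>)"

lemma bracket_powr: "(1 + \<xi>\<^sup>2) powr (1 / 2) = bracket \<xi>" "(1 + \<xi>\<^sup>2) powr (- 1 / 2) = 1 / bracket \<xi>"
  using powr_minus_divide[of "1 + \<xi>\<^sup>2" "1/2"] by (simp_all add: bracket_def powr_half_sqrt)

lemma bracket_pos[simp]: "bracket \<xi> > 0" "bracket \<xi> \<noteq> 0" "bracket \<xi> \<ge> 0"
  by (simp_all add: bracket_def)

lemma bracket_ge_1: "bracket \<xi> \<ge> 1"
  by (simp add: bracket_def)

lemma root_symbol_sqrt: "\<kappa> > 0 \<Longrightarrow> root_symbol \<kappa> \<xi> = 1 / sqrt (\<xi>\<^sup>2 + \<kappa>\<^sup>2)"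
  using powr_minus_divide[of "\<xi>\<^sup>2 + \<kappa>\<^sup>2" "1/2"] by (simp add: root_symbol_def powr_half_sqrt)

lemma root_symbol_one: "root_symbol 1 \<xi> = 1 / bracket \<xi>"
  by (simp add: root_symbol_sqrt bracket_def add.commute)

lemma root_symbol_pos: "\<kappa> > 0 \<Longrightarrow> root_symbol \<kappa> \<xi> > 0"
  by (simp add: root_symbol_sqrt add_nonneg_pos)

lemma root_symbol_measurable[measurable]: "root_symbol \<kappa> \<in> borel_measurable borel"
  unfolding root_symbol_def by measurable

lemma bracket_measurable[measurable]: "bracket \<in> borel_measurable borel"
  unfolding bracket_def by measurable

text \<open>
  The root of the resolvent gains one Sobolev order: its symbol compensates the weight of \<open>H\<^sup>1\<close>.
\<close>

lemma bracket_root_symbol_le: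
  assumes "\<kappa> > 0" shows "bracket \<xi> * root_symbol \<kappa> \<xi> \<le> 1 + 1 / \<kappa>"
proof -
  have pos: "0 < \<xi>\<^sup>2 + \<kappa>\<^sup>2" using assms by (simp add: add_nonneg_pos)
  have "sqrt (1 + \<xi>\<^sup>2) \<le> sqrt (((1 + 1 / \<kappa>) * sqrt (\<xi>\<^sup>2 + \<kappa>\<^sup>2))\<^sup>2)"
  proof (rule real_sqrt_le_mono)
    have "1 + \<xi>\<^sup>2 \<le> (1 + 1 / \<kappa>\<^sup>2) * (\<xi>\<^sup>2 + \<kappa>\<^sup>2)"
      using assms by (simp add: field_simps)
    also have "\<dots> \<le> (1 + 1 / \<kappa>)\<^sup>2 * (\<xi>\<^sup>2 + \<kappa>\<^sup>2)"
      using pos assms by (intro mult_right_mono) (simp_all add: power2_sum power_divide)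
    finally show "1 + \<xi>\<^sup>2 \<le> ((1 + 1 / \<kappa>) * sqrt (\<xi>\<^sup>2 + \<kappa>\<^sup>2))\<^sup>2"
      using pos by (simp add: power_mult_distrib)
  qed
  also have "\<dots> = (1 + 1 / \<kappa>) * sqrt (\<xi>\<^sup>2 + \<kappa>\<^sup>2)" using assms pos by (subst real_sqrt_abs) simp
  finally show ?thesis using pos assms by (simp add: root_symbol_sqrt bracket_def pos_divide_le_eq)
qed

lemma slow_powr:
  assumes "\<kappa> > 0" shows "slow (\<lambda>\<xi>. of_real ((\<xi>\<^sup>2 + \<kappa>\<^sup>2) powr r))"
  using slow_quadratic_powr[OF assms, of 1 0 r] by simp

lemma slow_root_symbol: "\<kappa> > 0 \<Longrightarrow> slow (\<lambda>\<xi>. of_real (root_symbol \<kappa> \<xi>))"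
  unfolding root_symbol_def by (rule slow_powr)

lemma slow_inverse_root_symbol: "\<kappa> > 0 \<Longrightarrow> slow (\<lambda>\<xi>. of_real (1 / root_symbol \<kappa> \<xi>))"
  using slow_powr[of \<kappa> "1/2"] by (simp add: root_symbol_sqrt powr_half_sqrt)

lemma slow_bracket: "slow (\<lambda>\<xi>. of_real (bracket \<xi>))"
  using slow_powr[of 1 "1/2"] by (simp add: bracket_powr[symmetric] add.commute)

lemma slow_inverse_bracket: "slow (\<lambda>\<xi>. of_real (1 / bracket \<xi>))"
  using slow_root_symbol[of 1] by (simp add: root_symbol_one)

lemma root_op_schwartz:
  "\<kappa> > 0 \<Longrightarrow> \<psi> \<in> schwartz \<Longrightarrow> root_op \<kappa> \<psi> \<in> schwartz"
  unfolding root_op_def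
  by (intro schwartz_inv_fourier schwartz_mult_slow[OF slow_root_symbol] schwartz_fourier)

lemma fourier_root_op:
  assumes "\<kappa> > 0" "\<psi> \<in> schwartz"
  shows "fourier (root_op \<kappa> \<psi>) = (\<lambda>\<xi>. of_real (root_symbol \<kappa> \<xi>) * fourier \<psi> \<xi>)"
  unfolding root_op_def
  by (intro fourier_inv_fourier schwartz_mult_slow[OF slow_root_symbol] schwartz_fourier assms)

lemma root_op_add:
  assumes "\<kappa> > 0" "\<phi> \<in> schwartz" "\<psi> \<in> schwartz"
  shows "root_op \<kappa> (\<lambda>x. \<phi> x + \<psi> x) = (\<lambda>x. root_op \<kappa> \<phi> x + root_op \<kappa> \<psi> x)"
  unfolding root_op_def using assms
  by (simp add: schwartz_fourier_add distrib_left inv_fourier_add schwartz_mult_slow[OF slow_root_symbol] schwartz_fourier)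

lemma root_op_scale: "root_op \<kappa> (\<lambda>x. c * \<phi> x) = (\<lambda>x. c * root_op \<kappa> \<phi> x)"
  using inv_fourier_scale[of c "\<lambda>\<xi>. of_real (root_symbol \<kappa> \<xi>) * fourier \<phi> \<xi>"]
  by (simp add: root_op_def fourier_scale[abs_def] mult.left_commute)

lemma H0_root_eq: "H0_root \<kappa> T \<psi> = T (root_op \<kappa> \<psi>)"
  by (simp add: H0_root_def dist_inv_fourier_def dist_mult_def dist_fourier_def root_op_def root_symbol_def)

lemma root_op_norm:
  assumes "\<kappa> > 0" "\<psi> \<in> schwartz"
  shows "h1_norm (root_op \<kappa> \<psi>) \<le> (1 + 1 / \<kappa>) * L2_norm \<psi>"
proof -
  have \<psi>: "fourier \<psi> \<in> L2" using assms by (intro schwartz_L2 schwartz_fourier)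
  have "L2_norm (\<lambda>\<xi>. of_real (bracket \<xi> * root_symbol \<kappa> \<xi>) * fourier \<psi> \<xi>) \<le> (1 + 1 / \<kappa>) * L2_norm (fourier \<psi>)"
    by (rule L2_norm_multiplier_le) (use assms bracket_root_symbol_le root_symbol_pos \<psi> in \<open>auto simp: less_imp_le\<close>)
  then show ?thesis
    using assms by (simp add: h1_norm_def fourier_root_op mult.assoc fourier_norm)
qed

text \<open>
  The distributional definition of the \<open>H\<^sup>1\<close> norm reduces to a weighted \<open>L\<^sup>2\<close> norm as soon as the Fourier
  transform of the distribution is a function \<open>h\<close>.
\<close>

lemma sobolev_norm_1:
  assumes h: "(\<lambda>\<xi>. of_real (bracket \<xi>) * h \<xi>) \<in> L2"
    and u: "\<And>\<psi>. \<psi> \<in> schwartz \<Longrightarrow> u \<psi> = L2_inner (fourier \<psi>) h"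
  shows "sobolev_norm 1 u = L2_norm (\<lambda>\<xi>. of_real (bracket \<xi>) * h \<xi>)"
proof -
  have "is_function (sobolev_weighted 1 u) (\<lambda>\<xi>. of_real (bracket \<xi>) * h \<xi>)"
    unfolding is_function_def
  proof (intro conjI ballI)
    fix \<psi> assume \<psi>: "\<psi> \<in> schwartz"
    show "integrable lborel (\<lambda>x. cnj (\<psi> x) * (of_real (bracket x) * h x))"
      by (rule L2_inner_integrable[OF schwartz_L2[OF \<psi>] h])
    have b\<psi>: "(\<lambda>x. of_real (bracket x) * \<psi> x) \<in> schwartz" by (rule schwartz_mult_slow[OF slow_bracket \<psi>])
    have "sobolev_weighted 1 u \<psi> = u (inv_fourier (\<lambda>x. of_real (bracket x) * \<psi> x))"
      by (simp add: sobolev_weighted_def dist_mult_def dist_fourier_def bracket_powr)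
    also have "\<dots> = L2_inner (\<lambda>x. of_real (bracket x) * \<psi> x) h"
      by (simp add: u schwartz_inv_fourier fourier_inv_fourier b\<psi>)
    finally show "sobolev_weighted 1 u \<psi> = dist_of_fun (\<lambda>\<xi>. of_real (bracket \<xi>) * h \<xi>) \<psi>"
      by (simp add: L2_inner_def dist_of_fun_def mult_ac)
  qed (use L2_measurable[OF h] in simp)
  from fun_of_dist_AE[OF this] show ?thesis
    unfolding sobolev_norm_def
    by (intro L2_norm_cong_AE) (use L2_measurable[OF h] in \<open>auto simp: is_function_def\<close>)
qed

lemma schwartz_bracket_L2: "\<phi> \<in> schwartz \<Longrightarrow> (\<lambda>\<xi>. of_real (bracket \<xi>) * fourier \<phi> \<xi>) \<in> L2"
  by (intro schwartz_L2 schwartz_mult_slow[OF slow_bracket] schwartz_fourier)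

lemma sobolev_norm_schwartz:
  assumes "\<phi> \<in> schwartz" shows "sobolev_norm 1 (dist_of_fun \<phi>) = h1_norm \<phi>"
  unfolding h1_norm_def
  by (rule sobolev_norm_1[OF schwartz_bracket_L2[OF assms]])
     (simp add: fourier_unitary assms dist_of_fun_def L2_inner_def[symmetric])

text \<open>
  The bound \<open>C\<close> is a parameter because the final theorem applies the construction to potentials in \<open>H\<^sup>-\<^sup>1\<close> with
  an explicit bound, and to arbitrary Sobolev multipliers with the bound that they come with.
\<close>

locale multiplier =
  fixes V :: dist and \<kappa> :: real and C :: real
  assumes \<kappa>: "\<kappa> > 0" and V: "V \<in> tempered" and C: "C > 0"
    and V_bound: "\<And>\<phi> \<psi>. \<phi> \<in> schwartz \<Longrightarrow> \<psi> \<in> schwartz \<Longrightarrow>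
      cmod (V (\<lambda>x. cnj (\<phi> x) * \<psi> x)) \<le> C * h1_norm \<psi> * h1_norm \<phi>"
begin

lemma V_add: "\<phi> \<in> schwartz \<Longrightarrow> \<psi> \<in> schwartz \<Longrightarrow> V (\<lambda>x. \<phi> x + \<psi> x) = V \<phi> + V \<psi>"
  using V by (auto simp: tempered_def)

lemma V_scale: "\<phi> \<in> schwartz \<Longrightarrow> V (\<lambda>x. c * \<phi> x) = cnj c * V \<phi>"
  using V by (auto simp: tempered_def)

abbreviation "R \<equiv> root_op \<kappa>"

definition form :: "(real \<Rightarrow> complex) \<Rightarrow> (real \<Rightarrow> complex) \<Rightarrow> complex" where
  "form \<phi> \<psi> = V (\<lambda>x. cnj (\<phi> x) * \<psi> x)"

lemma form_add_left:
  "\<phi> \<in> schwartz \<Longrightarrow> \<phi>' \<in> schwartz \<Longrightarrow> \<psi> \<in> schwartz \<Longrightarrow> form (\<lambda>x. \<phi> x + \<phi>' x) \<psi> = form \<phi> \<psi> + form \<phi>' \<psi>"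
  using V_add[of "\<lambda>x. cnj (\<phi> x) * \<psi> x" "\<lambda>x. cnj (\<phi>' x) * \<psi> x"]
  by (simp add: form_def distrib_right schwartz_mult schwartz_cnj)

lemma form_scale_left:
  "\<phi> \<in> schwartz \<Longrightarrow> \<psi> \<in> schwartz \<Longrightarrow> form (\<lambda>x. c * \<phi> x) \<psi> = c * form \<phi> \<psi>"
  using V_scale[of "\<lambda>x. cnj (\<phi> x) * \<psi> x" "cnj c"]
  by (simp add: form_def mult_ac schwartz_mult schwartz_cnj)

lemma form_diff_left:
  "\<phi> \<in> schwartz \<Longrightarrow> \<phi>' \<in> schwartz \<Longrightarrow> \<psi> \<in> schwartz \<Longrightarrow> form (\<lambda>x. \<phi> x - \<phi>' x) \<psi> = form \<phi> \<psi> - form \<phi>' \<psi>"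
  using form_add_left[of \<phi> "\<lambda>x. - 1 * \<phi>' x" \<psi>] form_scale_left[of \<phi>' \<psi> "- 1"] schwartz_scale[of \<phi>' "- 1"] by simp

lemma form_add_right:
  "\<phi> \<in> schwartz \<Longrightarrow> \<psi> \<in> schwartz \<Longrightarrow> \<psi>' \<in> schwartz \<Longrightarrow> form \<phi> (\<lambda>x. \<psi> x + \<psi>' x) = form \<phi> \<psi> + form \<phi> \<psi>'"
  using V_add[of "\<lambda>x. cnj (\<phi> x) * \<psi> x" "\<lambda>x. cnj (\<phi> x) * \<psi>' x"]
  by (simp add: form_def distrib_left schwartz_mult schwartz_cnj)

lemma form_scale_right:
  "\<phi> \<in> schwartz \<Longrightarrow> \<psi> \<in> schwartz \<Longrightarrow> form \<phi> (\<lambda>x. c * \<psi> x) = cnj c * form \<phi> \<psi>"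
  using V_scale[of "\<lambda>x. cnj (\<phi> x) * \<psi> x" c]
  by (simp add: form_def mult_ac schwartz_mult schwartz_cnj)

lemma form_bound:
  "\<phi> \<in> schwartz \<Longrightarrow> \<psi> \<in> schwartz \<Longrightarrow> cmod (form \<phi> \<psi>) \<le> C * h1_norm \<psi> * h1_norm \<phi>"
  using V_bound by (simp add: form_def)

definition K :: real where "K = C * (1 + 1 / \<kappa>) * (1 + 1 / \<kappa>)"

lemma K_pos: "K > 0"
  using C \<kappa> by (simp add: K_def add_pos_pos)

lemma h1_norm_nonneg: "h1_norm \<phi> \<ge> 0" by (simp add: h1_norm_def)

lemma form_root_bound:
  assumes "\<phi> \<in> schwartz" "\<psi> \<in> schwartz"
  shows "cmod (form (R \<phi>) (R \<psi>)) \<le> K * L2_norm \<psi> * L2_norm \<phi>"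
proof -
  have "cmod (form (R \<phi>) (R \<psi>)) \<le> C * h1_norm (R \<psi>) * h1_norm (R \<phi>)"
    by (intro form_bound root_op_schwartz \<kappa> assms)
  also have "\<dots> \<le> C * ((1 + 1 / \<kappa>) * L2_norm \<psi>) * ((1 + 1 / \<kappa>) * L2_norm \<phi>)"
    using C \<kappa> by (intro mult_mono root_op_norm assms mult_nonneg_nonneg h1_norm_nonneg) auto
  finally show ?thesis by (simp add: K_def mult_ac)
qed

abbreviation "state f \<equiv> H0_root \<kappa> (dist_of_fun f)"

lemma h1_distance_to_state:
  assumes f: "f \<in> L2" and \<phi>: "\<phi> \<in> schwartz"
  shows "(\<lambda>\<xi>. of_real (bracket \<xi>) * (fourier \<phi> \<xi> - of_real (root_symbol \<kappa> \<xi>) * L2_fourier f \<xi>)) \<in> L2" (is "?w \<in> L2")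
    "sobolev_norm 1 (\<lambda>\<eta>. dist_of_fun \<phi> \<eta> - state f \<eta>)
      = L2_norm (\<lambda>\<xi>. of_real (bracket \<xi>) * (fourier \<phi> \<xi> - of_real (root_symbol \<kappa> \<xi>) * L2_fourier f \<xi>))"
proof -
  have m: "(\<lambda>\<xi>. of_real (bracket \<xi> * root_symbol \<kappa> \<xi>) * L2_fourier f \<xi>) \<in> L2"
    by (rule L2_multiplier[where C="1 + 1 / \<kappa>"])
       (use \<kappa> bracket_root_symbol_le root_symbol_pos L2_fourier(1)[OF f] in \<open>auto simp: less_imp_le\<close>)
  have m': "(\<lambda>\<xi>. of_real (root_symbol \<kappa> \<xi>) * L2_fourier f \<xi>) \<in> L2"
  proof (rule L2_bounded_by[OF m, of _ 1])
    show "cmod (of_real (root_symbol \<kappa> \<xi>) * L2_fourier f \<xi>) \<le> 1 * cmod (of_real (bracket \<xi> * root_symbol \<kappa> \<xi>) * L2_fourier f \<xi>)" for \<xi>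
      using bracket_ge_1[of \<xi>] root_symbol_pos[OF \<kappa>, of \<xi>]
        mult_right_mono[OF bracket_ge_1[of \<xi>] norm_ge_zero[of "L2_fourier f \<xi>"]]
      by (simp add: norm_mult)
  qed (use L2_measurable_borel[OF L2_fourier(1)[OF f]] in measurable)
  show w: "?w \<in> L2"
    using L2_diff[OF schwartz_bracket_L2[OF \<phi>] m] by (simp add: right_diff_distrib mult.assoc)
  show "sobolev_norm 1 (\<lambda>\<eta>. dist_of_fun \<phi> \<eta> - state f \<eta>) = L2_norm ?w"
  proof (rule sobolev_norm_1[OF w])
    fix \<psi> assume \<psi>: "\<psi> \<in> schwartz"
    have "state f \<psi> = L2_inner (R \<psi>) f"
      by (simp add: H0_root_eq dist_of_fun_def L2_inner_def)
    also have "\<dots> = L2_inner (fourier (R \<psi>)) (L2_fourier f)"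
      by (rule L2_fourier_test[OF f root_op_schwartz[OF \<kappa> \<psi>], symmetric])
    also have "\<dots> = L2_inner (fourier \<psi>) (\<lambda>\<xi>. of_real (root_symbol \<kappa> \<xi>) * L2_fourier f \<xi>)"
      by (simp add: fourier_root_op[OF \<kappa> \<psi>] L2_inner_def mult_ac)
    finally show "dist_of_fun \<phi> \<psi> - state f \<psi>
        = L2_inner (fourier \<psi>) (\<lambda>\<xi>. fourier \<phi> \<xi> - of_real (root_symbol \<kappa> \<xi>) * L2_fourier f \<xi>)"
      using \<psi> \<phi> m'
      by (simp add: L2_inner_diff_right schwartz_L2 schwartz_fourier fourier_unitary dist_of_fun_def L2_inner_def[symmetric])
  qed
qed

text \<open>
  If \<open>u\<^sub>n\<close> are Schwartz functions tending to \<open>f\<close> in \<open>L\<^sup>2\<close>, then \<open>R u\<^sub>n\<close> is an admissible sequence in the definition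
  of \<^const>\<open>multiplier_op\<close> at \<open>state f\<close>. In particular admissible sequences exist.
\<close>

lemma root_op_approximates_state:
  assumes f: "f \<in> L2" and u: "\<And>n :: nat. u n \<in> schwartz" "(\<lambda>n. L2_norm (\<lambda>x. u n x - f x)) \<longlonglongrightarrow> 0"
  shows "(\<lambda>n. sobolev_norm 1 (\<lambda>\<eta>. dist_of_fun (R (u n)) \<eta> - state f \<eta>)) \<longlonglongrightarrow> 0"
proof (rule tendsto_sandwich[of "\<lambda>_. 0"])
  have "sobolev_norm 1 (\<lambda>\<eta>. dist_of_fun (R (u n)) \<eta> - state f \<eta>) \<le> (1 + 1 / \<kappa>) * L2_norm (\<lambda>x. u n x - f x)" for n
  proof -
    have d: "(\<lambda>\<xi>. fourier (u n) \<xi> - L2_fourier f \<xi>) \<in> L2"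
      by (intro L2_diff schwartz_L2 schwartz_fourier L2_fourier u f)
    have "sobolev_norm 1 (\<lambda>\<eta>. dist_of_fun (R (u n)) \<eta> - state f \<eta>)
      = L2_norm (\<lambda>\<xi>. of_real (bracket \<xi> * root_symbol \<kappa> \<xi>) * (fourier (u n) \<xi> - L2_fourier f \<xi>))"
      by (simp add: h1_distance_to_state(2)[OF f root_op_schwartz[OF \<kappa> u(1)]] fourier_root_op \<kappa> u
          right_diff_distrib mult.assoc)
    also have "\<dots> \<le> (1 + 1 / \<kappa>) * L2_norm (\<lambda>\<xi>. fourier (u n) \<xi> - L2_fourier f \<xi>)"
      by (rule L2_norm_multiplier_le) (use \<kappa> bracket_root_symbol_le root_symbol_pos d in \<open>auto simp: less_imp_le\<close>)
    also have "L2_norm (\<lambda>\<xi>. fourier (u n) \<xi> - L2_fourier f \<xi>) = L2_norm (\<lambda>\<xi>. L2_fourier (u n) \<xi> - L2_fourier f \<xi>)"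
      using L2_fourier_schwartz[OF u(1)[of n]] d
      by (intro L2_norm_cong_AE L2_measurable_borel L2_diff L2_fourier schwartz_L2[OF u(1)] schwartz_L2[OF schwartz_fourier[OF u(1)]] f) auto
    also have "(1 + 1 / \<kappa>) * \<dots> \<le> (1 + 1 / \<kappa>) * L2_norm (\<lambda>x. u n x - f x)"
      using \<kappa> by (intro mult_left_mono L2_fourier_diff_norm schwartz_L2[OF u(1)] f) simp
    finally show ?thesis .
  qed
  then show "\<forall>\<^sub>F n in sequentially. sobolev_norm 1 (\<lambda>\<eta>. dist_of_fun (R (u n)) \<eta> - state f \<eta>)
      \<le> (1 + 1 / \<kappa>) * L2_norm (\<lambda>x. u n x - f x)" by simp
  show "(\<lambda>n. (1 + 1 / \<kappa>) * L2_norm (\<lambda>x. u n x - f x)) \<longlonglongrightarrow> 0"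
    using u(2) by (rule tendsto_mult_right_zero)
qed (simp_all add: sobolev_norm_def)

lemma form_difference_bound:
  assumes f: "f \<in> L2" and "\<phi> \<in> schwartz" "\<phi>' \<in> schwartz" "\<psi> \<in> schwartz"
  shows "cmod (form \<phi> \<psi> - form \<phi>' \<psi>) \<le> C * h1_norm \<psi> *
    (sobolev_norm 1 (\<lambda>\<eta>. dist_of_fun \<phi> \<eta> - state f \<eta>) + sobolev_norm 1 (\<lambda>\<eta>. dist_of_fun \<phi>' \<eta> - state f \<eta>))"
proof -
  let ?w = "\<lambda>\<phi> \<xi>. of_real (bracket \<xi>) * (fourier \<phi> \<xi> - of_real (root_symbol \<kappa> \<xi>) * L2_fourier f \<xi>)"
  have w: "?w \<phi> \<in> L2" "?w \<phi>' \<in> L2" using h1_distance_to_state(1)[OF f] assms by blast+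
  have sd: "(\<lambda>x. \<phi> x - \<phi>' x) \<in> schwartz" by (intro schwartz_diff assms)
  have "fourier (\<lambda>x. \<phi> x - \<phi>' x) \<xi> = fourier \<phi> \<xi> - fourier \<phi>' \<xi>" for \<xi>
    using fourier_add[of \<phi> "\<lambda>x. - 1 * \<phi>' x" \<xi>] fourier_scale[of "- 1" \<phi>' \<xi>] assms
    by (simp add: schwartz_integrable)
  then have "h1_norm (\<lambda>x. \<phi> x - \<phi>' x) = L2_norm (\<lambda>\<xi>. ?w \<phi> \<xi> - ?w \<phi>' \<xi>)"
    by (simp add: h1_norm_def right_diff_distrib)
  also have "\<dots> \<le> L2_norm (?w \<phi>) + L2_norm (?w \<phi>')"
    using L2_norm_triangle[OF w(1) L2_scale[OF w(2), of "- 1"]] L2_norm_scale[of "- 1" "?w \<phi>'"] by simp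
  finally have "h1_norm (\<lambda>x. \<phi> x - \<phi>' x) \<le> L2_norm (?w \<phi>) + L2_norm (?w \<phi>')" .
  then have "C * h1_norm \<psi> * h1_norm (\<lambda>x. \<phi> x - \<phi>' x) \<le> C * h1_norm \<psi> * (L2_norm (?w \<phi>) + L2_norm (?w \<phi>'))"
    using C by (intro mult_left_mono mult_nonneg_nonneg h1_norm_nonneg) auto
  moreover have "cmod (form \<phi> \<psi> - form \<phi>' \<psi>) \<le> C * h1_norm \<psi> * h1_norm (\<lambda>x. \<phi> x - \<phi>' x)"
    using form_bound[OF sd assms(4)] form_diff_left[of \<phi> \<phi>' \<psi>] assms by simp
  ultimately show ?thesis using h1_distance_to_state(2)[OF f] assms by simp
qed

text \<open>
  The form bound makes the values along an admissible sequence a Cauchy sequence and shows that any two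
  admissible sequences have the same limit, so the definite description is well defined.
\<close>

lemma multiplier_op_limit:
  assumes f: "f \<in> L2" and \<psi>: "\<psi> \<in> schwartz"
    and u: "\<And>n :: nat. u n \<in> schwartz" "(\<lambda>n. L2_norm (\<lambda>x. u n x - f x)) \<longlonglongrightarrow> 0"
  shows "(\<lambda>n. form (R (u n)) \<psi>) \<longlonglongrightarrow> multiplier_op V (state f) \<psi>"
proof -
  let ?d = "\<lambda>\<phi>. sobolev_norm 1 (\<lambda>\<eta>. dist_of_fun \<phi> \<eta> - state f \<eta>)"
  define M where "M = C * h1_norm \<psi> + 1"
  have M: "M > 0" using C h1_norm_nonneg[of \<psi>] by (simp add: M_def add_nonneg_pos)
  have d_nonneg: "?d \<phi> \<ge> 0" for \<phi> by (simp add: sobolev_norm_def)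
  have diff: "cmod (form \<phi> \<psi> - form \<phi>' \<psi>) \<le> M * (?d \<phi> + ?d \<phi>')" if "\<phi> \<in> schwartz" "\<phi>' \<in> schwartz" for \<phi> \<phi>'
  proof -
    have "C * h1_norm \<psi> * (?d \<phi> + ?d \<phi>') \<le> M * (?d \<phi> + ?d \<phi>')"
      using d_nonneg[of \<phi>] d_nonneg[of \<phi>'] by (intro mult_right_mono) (auto simp: M_def)
    then show ?thesis using form_difference_bound[OF f that \<psi>] by linarith
  qed
  have Ru: "R (u n) \<in> schwartz" for n by (intro root_op_schwartz \<kappa> u)
  have dRu: "(\<lambda>n. ?d (R (u n))) \<longlonglongrightarrow> 0" by (rule root_op_approximates_state[OF f u])
  have "Cauchy (\<lambda>n. form (R (u n)) \<psi>)"
  proof (rule CauchyI)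
    fix e :: real assume "e > 0"
    then have "e / (2 * M) > 0" using M by simp
    from order_tendstoD(2)[OF dRu this] obtain N where N: "\<And>n. n \<ge> N \<Longrightarrow> ?d (R (u n)) < e / (2 * M)"
      by (auto simp: eventually_sequentially)
    have "norm (form (R (u m)) \<psi> - form (R (u n)) \<psi>) < e" if "m \<ge> N" "n \<ge> N" for m n
    proof -
      have "M * (?d (R (u m)) + ?d (R (u n))) < M * (e / (2 * M) + e / (2 * M))"
        using N[OF that(1)] N[OF that(2)] M by (intro mult_strict_left_mono) linarith+
      also have "\<dots> = e" using M by (simp add: field_simps)
      finally show ?thesis using diff[OF Ru Ru, of m n] by linarith
    qed
    then show "\<exists>N. \<forall>m\<ge>N. \<forall>n\<ge>N. norm (form (R (u m)) \<psi> - form (R (u n)) \<psi>) < e" by blast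
  qed
  then obtain z where z: "(\<lambda>n. form (R (u n)) \<psi>) \<longlonglongrightarrow> z"
    using Cauchy_convergent convergent_def by blast
  have "multiplier_op V (state f) \<psi> = z"
    unfolding multiplier_op_def
  proof (rule the_equality, intro allI impI, elim conjE)
    fix \<phi> :: "nat \<Rightarrow> real \<Rightarrow> complex"
    assume \<phi>: "\<forall>n. \<phi> n \<in> schwartz" "(\<lambda>n. ?d (\<phi> n)) \<longlonglongrightarrow> 0"
    have "(\<lambda>n. form (\<phi> n) \<psi> - form (R (u n)) \<psi>) \<longlonglongrightarrow> 0"
    proof (rule Lim_null_comparison)
      show "\<forall>\<^sub>F n in sequentially. norm (form (\<phi> n) \<psi> - form (R (u n)) \<psi>) \<le> M * (?d (\<phi> n) + ?d (R (u n)))"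
        using diff Ru \<phi>(1) by simp
      show "(\<lambda>n. M * (?d (\<phi> n) + ?d (R (u n)))) \<longlonglongrightarrow> 0"
        using tendsto_mult_right_zero[OF tendsto_add_zero[OF \<phi>(2) dRu]] .
    qed
    from tendsto_add[OF this z] show "(\<lambda>n. dist_mult (\<phi> n) V \<psi>) \<longlonglongrightarrow> z"
      by (simp add: dist_mult_def form_def)
  next
    fix z' assume "\<forall>\<phi>. (\<forall>n. \<phi> n \<in> schwartz) \<and> (\<lambda>n. ?d (\<phi> n)) \<longlonglongrightarrow> 0 \<longrightarrow> (\<lambda>n. dist_mult (\<phi> n) V \<psi>) \<longlonglongrightarrow> z'"
    from this[rule_format, of "\<lambda>n. R (u n)"]
    have "(\<lambda>n. dist_mult (R (u n)) V \<psi>) \<longlonglongrightarrow> z'" using Ru dRu by blast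
    then show "z' = z" using LIMSEQ_unique[OF z] by (simp add: dist_mult_def form_def)
  qed
  with z show ?thesis by simp
qed

abbreviation "A \<equiv> sandwiched \<kappa> V"

text \<open>
  The pairing of \<open>\<psi>\<close> with the distribution that represents \<open>A f\<close>, before it is known to be a function.
\<close>

definition weak_value :: "(real \<Rightarrow> complex) \<Rightarrow> (real \<Rightarrow> complex) \<Rightarrow> complex" where
  "weak_value f \<psi> = H0_root \<kappa> (multiplier_op V (state f)) \<psi>"

lemma weak_value_limit:
  assumes "f \<in> L2" "\<psi> \<in> schwartz" "\<And>n :: nat. u n \<in> schwartz" "(\<lambda>n. L2_norm (\<lambda>x. u n x - f x)) \<longlonglongrightarrow> 0"
  shows "(\<lambda>n. form (R (u n)) (R \<psi>)) \<longlonglongrightarrow> weak_value f \<psi>"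
  using multiplier_op_limit[OF assms(1) root_op_schwartz[OF \<kappa> assms(2)] assms(3,4)]
  by (simp add: weak_value_def H0_root_eq)

lemma weak_value_bound:
  assumes f: "f \<in> L2" and \<psi>: "\<psi> \<in> schwartz"
  shows "cmod (weak_value f \<psi>) \<le> K * L2_norm f * L2_norm \<psi>"
proof -
  obtain u where u: "\<And>n. u n \<in> schwartz" "(\<lambda>n. L2_norm (\<lambda>x. u n x - f x)) \<longlonglongrightarrow> 0"
    using schwartz_dense[OF f] by blast
  have "(\<lambda>n. cmod (form (R (u n)) (R \<psi>))) \<longlonglongrightarrow> cmod (weak_value f \<psi>)"
    by (intro tendsto_norm weak_value_limit f \<psi> u)
  moreover have "(\<lambda>n. K * L2_norm \<psi> * L2_norm (u n)) \<longlonglongrightarrow> K * L2_norm \<psi> * L2_norm f"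
    by (intro tendsto_mult tendsto_const L2_norm_tendsto schwartz_L2[OF u(1)] u f)
  ultimately have "cmod (weak_value f \<psi>) \<le> K * L2_norm \<psi> * L2_norm f"
    using form_root_bound[OF u(1) \<psi>] by (intro LIMSEQ_le) auto
  then show ?thesis by (simp add: mult_ac)
qed

lemma weak_value_schwartz:
  assumes "\<phi> \<in> schwartz" "\<psi> \<in> schwartz" shows "weak_value \<phi> \<psi> = form (R \<phi>) (R \<psi>)"
  using weak_value_limit[OF schwartz_L2[OF assms(1)] assms(2), of "\<lambda>_. \<phi>"] assms
  by (simp add: L2_norm_def LIMSEQ_const_iff)

lemma weak_value_add_right:
  assumes f: "f \<in> L2" and "\<phi> \<in> schwartz" "\<psi> \<in> schwartz"
  shows "weak_value f (\<lambda>x. \<phi> x + \<psi> x) = weak_value f \<phi> + weak_value f \<psi>"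
proof -
  obtain u where u: "\<And>n. u n \<in> schwartz" "(\<lambda>n. L2_norm (\<lambda>x. u n x - f x)) \<longlonglongrightarrow> 0"
    using schwartz_dense[OF f] by blast
  have "(\<lambda>n. form (R (u n)) (R \<phi>) + form (R (u n)) (R \<psi>)) \<longlonglongrightarrow> weak_value f \<phi> + weak_value f \<psi>"
    by (intro tendsto_add weak_value_limit f assms u)
  moreover have "form (R (u n)) (R (\<lambda>x. \<phi> x + \<psi> x)) = form (R (u n)) (R \<phi>) + form (R (u n)) (R \<psi>)" for n
    by (simp add: root_op_add \<kappa> assms form_add_right root_op_schwartz u)
  ultimately show ?thesis
    using weak_value_limit[OF f schwartz_add[OF assms(2,3)] u] LIMSEQ_unique by auto
qed

lemma weak_value_scale_right:
  assumes f: "f \<in> L2" and "\<psi> \<in> schwartz"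
  shows "weak_value f (\<lambda>x. c * \<psi> x) = cnj c * weak_value f \<psi>"
proof -
  obtain u where u: "\<And>n. u n \<in> schwartz" "(\<lambda>n. L2_norm (\<lambda>x. u n x - f x)) \<longlonglongrightarrow> 0"
    using schwartz_dense[OF f] by blast
  have "(\<lambda>n. cnj c * form (R (u n)) (R \<psi>)) \<longlonglongrightarrow> cnj c * weak_value f \<psi>"
    by (intro tendsto_mult tendsto_const weak_value_limit f assms u)
  moreover have "form (R (u n)) (R (\<lambda>x. c * \<psi> x)) = cnj c * form (R (u n)) (R \<psi>)" for n
    by (simp add: root_op_scale \<kappa> assms form_scale_right root_op_schwartz u)
  moreover have "(\<lambda>n. form (R (u n)) (R (\<lambda>x. c * \<psi> x))) \<longlonglongrightarrow> weak_value f (\<lambda>x. c * \<psi> x)"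
    by (intro weak_value_limit f schwartz_scale assms u)
  ultimately show ?thesis using LIMSEQ_unique by auto
qed

lemma weak_value_add_left:
  assumes f: "f \<in> L2" and g: "g \<in> L2" and \<psi>: "\<psi> \<in> schwartz"
  shows "weak_value (\<lambda>x. f x + g x) \<psi> = weak_value f \<psi> + weak_value g \<psi>"
proof -
  obtain u where u: "\<And>n. u n \<in> schwartz" "(\<lambda>n. L2_norm (\<lambda>x. u n x - f x)) \<longlonglongrightarrow> 0"
    using schwartz_dense[OF f] by blast
  obtain v where v: "\<And>n. v n \<in> schwartz" "(\<lambda>n. L2_norm (\<lambda>x. v n x - g x)) \<longlonglongrightarrow> 0"
    using schwartz_dense[OF g] by blast
  have "(\<lambda>n. form (R (u n)) (R \<psi>) + form (R (v n)) (R \<psi>)) \<longlonglongrightarrow> weak_value f \<psi> + weak_value g \<psi>"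
    by (intro tendsto_add weak_value_limit f g \<psi> u v)
  moreover have "form (R (\<lambda>x. u n x + v n x)) (R \<psi>) = form (R (u n)) (R \<psi>) + form (R (v n)) (R \<psi>)" for n
    by (simp add: root_op_add \<kappa> \<psi> form_add_left root_op_schwartz u v)
  moreover have "(\<lambda>n. form (R (\<lambda>x. u n x + v n x)) (R \<psi>)) \<longlonglongrightarrow> weak_value (\<lambda>x. f x + g x) \<psi>"
  proof (rule weak_value_limit[OF L2_add[OF f g] \<psi>, of "\<lambda>n x. u n x + v n x"])
    show "(\<lambda>n. L2_norm (\<lambda>x. (u n x + v n x) - (f x + g x))) \<longlonglongrightarrow> 0"
    proof (rule tendsto_sandwich[of "\<lambda>_. 0"])
      show "(\<lambda>n. L2_norm (\<lambda>x. u n x - f x) + L2_norm (\<lambda>x. v n x - g x)) \<longlonglongrightarrow> 0"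
        using tendsto_add_zero[OF u(2) v(2)] .
      show "\<forall>\<^sub>F n in sequentially. L2_norm (\<lambda>x. (u n x + v n x) - (f x + g x))
          \<le> L2_norm (\<lambda>x. u n x - f x) + L2_norm (\<lambda>x. v n x - g x)"
        using L2_norm_triangle[OF L2_diff[OF schwartz_L2[OF u(1)] f] L2_diff[OF schwartz_L2[OF v(1)] g]]
        by (intro always_eventually allI) (simp add: algebra_simps)
    qed auto
  qed (intro schwartz_add u v)
  ultimately show ?thesis using LIMSEQ_unique by auto
qed

lemma weak_value_scale_left:
  assumes f: "f \<in> L2" and \<psi>: "\<psi> \<in> schwartz"
  shows "weak_value (\<lambda>x. c * f x) \<psi> = c * weak_value f \<psi>"
proof -
  obtain u where u: "\<And>n. u n \<in> schwartz" "(\<lambda>n. L2_norm (\<lambda>x. u n x - f x)) \<longlonglongrightarrow> 0"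
    using schwartz_dense[OF f] by blast
  have "(\<lambda>n. c * form (R (u n)) (R \<psi>)) \<longlonglongrightarrow> c * weak_value f \<psi>"
    by (intro tendsto_mult tendsto_const weak_value_limit f \<psi> u)
  moreover have "form (R (\<lambda>x. c * u n x)) (R \<psi>) = c * form (R (u n)) (R \<psi>)" for n
    by (simp add: root_op_scale \<kappa> \<psi> form_scale_left root_op_schwartz u)
  moreover have "(\<lambda>n. form (R (\<lambda>x. c * u n x)) (R \<psi>)) \<longlonglongrightarrow> weak_value (\<lambda>x. c * f x) \<psi>"
  proof (rule weak_value_limit[OF L2_scale[OF f] \<psi>, of "\<lambda>n x. c * u n x"])
    show "(\<lambda>n. L2_norm (\<lambda>x. c * u n x - c * f x)) \<longlonglongrightarrow> 0"
      using tendsto_mult_right_zero[OF u(2), of "cmod c"]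
      by (simp add: L2_norm_scale[symmetric] right_diff_distrib)
  qed (intro schwartz_scale u)
  ultimately show ?thesis using LIMSEQ_unique by auto
qed

text \<open>
  The distribution \<open>weak_value f\<close> is bounded in the \<open>L\<^sup>2\<close> norm of the test function, hence given by an \<open>L\<^sup>2\<close>
  function, and \<^const>\<open>fun_of_dist\<close> selects that function up to a null set.
\<close>

lemma sandwiched_represents:
  assumes f: "f \<in> L2"
  shows "A f \<in> L2" "L2_norm (A f) \<le> K * L2_norm f" "\<And>\<psi>. \<psi> \<in> schwartz \<Longrightarrow> L2_inner \<psi> (A f) = weak_value f \<psi>"
proof -
  obtain g where g: "g \<in> L2" "\<And>\<psi>. \<psi> \<in> schwartz \<Longrightarrow> weak_value f \<psi> = L2_inner \<psi> g"
    "K * L2_norm f \<ge> 0 \<Longrightarrow> L2_norm g \<le> K * L2_norm f"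
    by (rule L2_Riesz[OF L2_subspace_schwartz, of "weak_value f" "K * L2_norm f"])
       (use weak_value_add_right[OF f] weak_value_scale_right[OF f] weak_value_bound[OF f] in auto)
  have isf: "is_function (H0_root \<kappa> (multiplier_op V (state f))) g"
    unfolding is_function_def
    using g by (auto simp: dist_of_fun_def L2_inner_def weak_value_def intro: L2_inner_integrable schwartz_L2)
  have meas: "A f \<in> borel_measurable borel"
    using fun_of_dist_AE(2)[OF isf] by (simp add: sandwiched_def is_function_def)
  have ae: "AE x in lborel. g x = A f x"
    using fun_of_dist_AE(1)[OF isf] by (auto simp: sandwiched_def)
  show "A f \<in> L2" by (rule L2_cong_AE[OF g(1) meas ae])
  have "L2_norm g = L2_norm (A f)" using g(1) meas ae by (intro L2_norm_cong_AE) auto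
  then show "L2_norm (A f) \<le> K * L2_norm f" using g(3) K_pos by simp
  show "L2_inner \<psi> (A f) = weak_value f \<psi>" if "\<psi> \<in> schwartz" for \<psi>
    using g(2)[OF that] L2_inner_cong_AE[OF L2_measurable_borel[OF g(1)] meas schwartz_measurable[OF that] ae] by simp
qed

lemma sandwiched_add:
  assumes "f \<in> L2" "g \<in> L2" shows "AE x in lborel. A (\<lambda>x. f x + g x) x = A f x + A g x"
  using assms
  by (intro L2_eq_by_schwartz_tests sandwiched_represents(1) L2_add)
     (simp_all add: L2_inner_add_right schwartz_L2 sandwiched_represents L2_add weak_value_add_left)

lemma sandwiched_scale:
  assumes "f \<in> L2" shows "AE x in lborel. A (\<lambda>x. c * f x) x = c * A f x"
  using assms
  by (intro L2_eq_by_schwartz_tests sandwiched_represents(1) L2_scale)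
     (simp_all add: L2_inner_scale_right sandwiched_represents L2_scale weak_value_scale_left)

theorem sandwiched_bounded_op: "L2_bounded_op A"
  unfolding L2_bounded_op_def
  using sandwiched_represents(1,2) sandwiched_add sandwiched_scale by blast

theorem sandwiched_schwartz:
  assumes "\<phi> \<in> schwartz" "\<psi> \<in> schwartz"
  shows "L2_inner \<psi> (A \<phi>) = V (\<lambda>x. cnj (R \<phi> x) * R \<psi> x)"
  using sandwiched_represents(3)[OF schwartz_L2[OF assms(1)] assms(2)] weak_value_schwartz[OF assms]
  by (simp add: form_def)

end

lemma sobolev_multiplier_imp_multiplier:
  assumes "sobolev_multiplier V" "\<kappa> > 0" shows "\<exists>C. multiplier V \<kappa> C"
proof -
  obtain C where "V \<in> tempered" "C > 0" "\<forall>\<phi>\<in>schwartz. \<forall>\<psi>\<in>schwartz.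
        cmod (dist_mult \<phi> V \<psi>) \<le> C * sobolev_norm 1 (dist_of_fun \<psi>) * sobolev_norm 1 (dist_of_fun \<phi>)"
    using assms(1) by (auto simp: sobolev_multiplier_def)
  then have "multiplier V \<kappa> C"
    using assms(2) by unfold_locales (auto simp: dist_mult_def sobolev_norm_schwartz)
  then show ?thesis by blast
qed

lemma L2_bounded_op_add:
  "L2_bounded_op A \<Longrightarrow> f \<in> L2 \<Longrightarrow> g \<in> L2 \<Longrightarrow> AE x in lborel. A (\<lambda>y. f y + g y) x = A f x + A g x"
  by (simp add: L2_bounded_op_def)

lemma L2_bounded_op_scale:
  "L2_bounded_op A \<Longrightarrow> f \<in> L2 \<Longrightarrow> AE x in lborel. A (\<lambda>y. c * f y) x = c * A f x"
  by (simp add: L2_bounded_op_def)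

lemma L2_bounded_op_limit:
  assumes A: "L2_bounded_op A" and f: "f \<in> L2" and u: "\<And>n :: nat. u n \<in> L2" "(\<lambda>n. L2_norm (\<lambda>x. u n x - f x)) \<longlonglongrightarrow> 0"
  shows "(\<lambda>n. L2_norm (\<lambda>x. A (u n) x - A f x)) \<longlonglongrightarrow> 0"
proof -
  have AL2: "A f \<in> L2" if "f \<in> L2" for f using A that by (auto simp: L2_bounded_op_def)
  have "\<exists>C. \<forall>f\<in>L2. L2_norm (A f) \<le> C * L2_norm f" using A by (simp add: L2_bounded_op_def)
  then obtain C where C: "\<And>f. f \<in> L2 \<Longrightarrow> L2_norm (A f) \<le> C * L2_norm f" by blast
  have eq: "L2_norm (\<lambda>x. A (u n) x - A f x) = L2_norm (A (\<lambda>x. u n x - f x))" for n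
  proof (rule L2_norm_cong_AE)
    have f': "(\<lambda>x. - 1 * f x) \<in> L2" by (rule L2_scale[OF f])
    have "AE x in lborel. A (\<lambda>x. u n x + - 1 * f x) x = A (u n) x + A (\<lambda>x. - 1 * f x) x"
      by (rule L2_bounded_op_add[OF A u(1) f'])
    moreover have "AE x in lborel. A (\<lambda>x. - 1 * f x) x = - 1 * A f x"
      by (rule L2_bounded_op_scale[OF A f])
    ultimately show "AE x in lborel. A (u n) x - A f x = A (\<lambda>x. u n x - f x) x"
      by eventually_elim simp
  qed (intro L2_measurable_borel L2_diff AL2 u f)+
  show ?thesis
  proof (rule tendsto_sandwich[of "\<lambda>_. 0"])
    show "\<forall>\<^sub>F n in sequentially. L2_norm (\<lambda>x. A (u n) x - A f x) \<le> C * L2_norm (\<lambda>x. u n x - f x)"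
      using C[OF L2_diff[OF u(1) f]] by (simp add: eq)
    show "(\<lambda>n. C * L2_norm (\<lambda>x. u n x - f x)) \<longlonglongrightarrow> 0" by (rule tendsto_mult_right_zero[OF u(2)])
  qed auto
qed

section \<open>Integral operators with square-integrable kernel\<close>

definition kernel_op :: "(real \<Rightarrow> real \<Rightarrow> complex) \<Rightarrow> (real \<Rightarrow> complex) \<Rightarrow> real \<Rightarrow> complex" where
  "kernel_op K f x = (LINT y|lborel. K x y * f y)"

text \<open>
  Sums over a basis are treated as integrals with respect to counting measure in order to exchange them with
  integrals by Tonelli's theorem.
\<close>

lemma has_sum_count_space:
  fixes f :: "'a \<Rightarrow> real"
  assumes "\<And>x. f x \<ge> 0" "S \<ge> 0" "(\<integral>\<^sup>+x. ennreal (f x) \<partial>count_space B) = ennreal S"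
  shows "(f has_sum S) B"
proof -
  have int: "integrable (count_space B) f"
    using assms by (intro integrableI_nn_integral_finite[of _ _ S]) auto
  then have abs: "Infinite_Set_Sum.abs_summable_on f B" by (simp add: Infinite_Set_Sum.abs_summable_on_def)
  have "infsetsum f B = S"
    using assms int by (simp add: infsetsum_def integral_eq_nn_integral)
  then have "infsum f B = S" using infsetsum_infsum[OF abs] by simp
  moreover have "f summable_on B"
    using abs abs_summable_equivalent abs_summable_summable by blast
  ultimately show ?thesis using has_sum_infsum by blast
qed

lemma has_sum_imp_count_space:
  fixes f :: "'a \<Rightarrow> real"
  assumes "\<And>x. f x \<ge> 0" "(f has_sum S) B"
  shows "(\<integral>\<^sup>+x. ennreal (f x) \<partial>count_space B) = ennreal S"
proof -
  have abs: "Infinite_Set_Sum.abs_summable_on f B"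
    using assms summable_on_def[of f B] abs_summable_equivalent[of f B] by auto
  then have "integrable (count_space B) f" by (simp add: Infinite_Set_Sum.abs_summable_on_def)
  then have "(\<integral>\<^sup>+x. ennreal (f x) \<partial>count_space B) = ennreal (integral\<^sup>L (count_space B) f)"
    using assms(1) by (intro nn_integral_eq_integral) auto
  also have "integral\<^sup>L (count_space B) f = S"
    using infsetsum_infsum[OF abs] infsumI[OF assms(2)] by (simp add: infsetsum_def)
  finally show ?thesis .
qed

locale square_integrable_kernel =
  fixes K :: "real \<Rightarrow> real \<Rightarrow> complex" and S :: real
  assumes K_measurable[measurable]: "case_prod K \<in> borel_measurable (lborel \<Otimes>\<^sub>M lborel)"
    and S: "S \<ge> 0" "(\<integral>\<^sup>+x. \<integral>\<^sup>+y. ennreal ((cmod (K x y))\<^sup>2) \<partial>lborel \<partial>lborel) = ennreal S"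
begin

lemma row_measurable[measurable]: "K x \<in> borel_measurable borel"
proof -
  have "(\<lambda>y. case_prod K (x, y)) \<in> borel_measurable lborel" by measurable
  then show ?thesis by simp
qed

lemma rows_L2: "AE x in lborel. K x \<in> L2"
proof -
  have "AE x in lborel. (\<integral>\<^sup>+y. ennreal ((cmod (K x y))\<^sup>2) \<partial>lborel) \<noteq> \<infinity>"
    using S by (intro nn_integral_PInf_AE) auto
  then show ?thesis
    by eventually_elim (intro L2_by_nn_integral row_measurable, simp add: less_top)
qed

lemma kernel_op_inner: "kernel_op K f x = L2_inner (\<lambda>y. cnj (K x y)) f"
  by (simp add: kernel_op_def L2_inner_def)

lemma kernel_op_measurable[measurable]:
  assumes "f \<in> L2" shows "kernel_op K f \<in> borel_measurable borel"
proof -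
  have [measurable]: "f \<in> borel_measurable borel" using assms by auto
  have "(\<lambda>x. LINT y|lborel. case_prod K (x, y) * f y) \<in> borel_measurable lborel" by measurable
  then show ?thesis by (simp add: kernel_op_def[abs_def])
qed

lemma kernel_op_L2:
  assumes f: "f \<in> L2" shows "kernel_op K f \<in> L2" "L2_norm (kernel_op K f) \<le> sqrt S * L2_norm f"
proof -
  have "(\<integral>\<^sup>+x. ennreal ((cmod (kernel_op K f x))\<^sup>2) \<partial>lborel)
     \<le> (\<integral>\<^sup>+x. ennreal ((L2_norm f)\<^sup>2) * (\<integral>\<^sup>+y. ennreal ((cmod (K x y))\<^sup>2) \<partial>lborel) \<partial>lborel)"
  proof (rule nn_integral_mono_AE, use rows_L2 in eventually_elim)
    fix x assume x: "K x \<in> L2"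
    have "cmod (kernel_op K f x) \<le> L2_norm (\<lambda>y. cnj (K x y)) * L2_norm f"
      unfolding kernel_op_inner by (rule L2_Cauchy_Schwarz[OF L2_cnj[OF x] f])
    also have "L2_norm (\<lambda>y. cnj (K x y)) = L2_norm (K x)" by (simp add: L2_norm_def)
    finally have "(cmod (kernel_op K f x))\<^sup>2 \<le> (L2_norm (K x) * L2_norm f)\<^sup>2"
      by (intro power_mono) auto
    then have "ennreal ((cmod (kernel_op K f x))\<^sup>2) \<le> ennreal ((L2_norm f)\<^sup>2 * (L2_norm (K x))\<^sup>2)"
      by (intro ennreal_leI) (simp add: power_mult_distrib mult.commute)
    then show "ennreal ((cmod (kernel_op K f x))\<^sup>2)
        \<le> ennreal ((L2_norm f)\<^sup>2) * (\<integral>\<^sup>+y. ennreal ((cmod (K x y))\<^sup>2) \<partial>lborel)"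
      by (simp add: L2_nn_integral[OF x] ennreal_mult)
  qed
  also have "\<dots> = ennreal ((L2_norm f)\<^sup>2) * ennreal S"
    by (subst nn_integral_cmult) (auto simp: S(2))
  also have "\<dots> = ennreal ((sqrt S * L2_norm f)\<^sup>2)"
    using S(1) by (simp add: ennreal_mult[symmetric] power_mult_distrib mult.commute)
  finally have le: "(\<integral>\<^sup>+x. ennreal ((cmod (kernel_op K f x))\<^sup>2) \<partial>lborel) \<le> ennreal ((sqrt S * L2_norm f)\<^sup>2)" .
  then have "(\<integral>\<^sup>+x. ennreal ((cmod (kernel_op K f x))\<^sup>2) \<partial>lborel) < \<infinity>"
    by (rule order.strict_trans1) simp
  then show kf: "kernel_op K f \<in> L2" by (intro L2_by_nn_integral kernel_op_measurable f)
  show "L2_norm (kernel_op K f) \<le> sqrt S * L2_norm f"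
    using S(1) by (intro L2_norm_le_by_nn_integral kf le) auto
qed

lemma kernel_op_diff_norm:
  assumes "f \<in> L2" "g \<in> L2"
  shows "L2_norm (\<lambda>x. kernel_op K f x - kernel_op K g x) \<le> sqrt S * L2_norm (\<lambda>x. f x - g x)"
proof -
  have "L2_norm (\<lambda>x. kernel_op K f x - kernel_op K g x) = L2_norm (kernel_op K (\<lambda>x. f x - g x))"
  proof (rule L2_norm_cong_AE)
    show "AE x in lborel. kernel_op K f x - kernel_op K g x = kernel_op K (\<lambda>x. f x - g x) x"
      using rows_L2
      by eventually_elim (simp add: kernel_op_inner L2_inner_diff_right L2_cnj assms)
  qed (intro L2_measurable_borel L2_diff kernel_op_L2 assms)+
  then show ?thesis using kernel_op_L2(2)[OF L2_diff[OF assms]] by simp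
qed

text \<open>
  For fixed \<open>x\<close> the values \<open>kernel_op K (E e) x\<close> are, up to conjugation, the coefficients of the row \<open>K x\<close>, so
  Parseval's identity holds row by row. It is integrated over \<open>x\<close>. The family \<open>E\<close> is indexed by \<open>B\<close> instead
  of being a basis itself, because it will consist of the Fourier transforms of the basis elements, which are
  determined only up to null sets.
\<close>

theorem kernel_op_hilbert_schmidt_sum:
  assumes B: "countable B" and E: "\<And>e. e \<in> B \<Longrightarrow> E e \<in> L2"
    and Parseval: "\<And>f. f \<in> L2 \<Longrightarrow> ((\<lambda>e. (cmod (L2_inner (E e) f))\<^sup>2) has_sum (L2_norm f)\<^sup>2) B"
  shows "((\<lambda>e. (L2_norm (kernel_op K (E e)))\<^sup>2) has_sum S) B"
proof (rule has_sum_count_space)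
  have "(\<integral>\<^sup>+e. ennreal ((L2_norm (kernel_op K (E e)))\<^sup>2) \<partial>count_space B)
    = (\<integral>\<^sup>+e. \<integral>\<^sup>+x. ennreal ((cmod (kernel_op K (E e) x))\<^sup>2) \<partial>lborel \<partial>count_space B)"
    by (intro nn_integral_cong) (simp add: L2_nn_integral kernel_op_L2 E)
  also have "\<dots> = (\<integral>\<^sup>+x. \<integral>\<^sup>+e. ennreal ((cmod (kernel_op K (E e) x))\<^sup>2) \<partial>count_space B \<partial>lborel)"
    using kernel_op_measurable[OF E] by (intro nn_integral_count_space_nn_integral[symmetric] B) simp
  also have "\<dots> = (\<integral>\<^sup>+x. \<integral>\<^sup>+y. ennreal ((cmod (K x y))\<^sup>2) \<partial>lborel \<partial>lborel)"
  proof (rule nn_integral_cong_AE, use rows_L2 in eventually_elim)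
    fix x assume x: "K x \<in> L2"
    have "cmod (kernel_op K (E e) x) = cmod (L2_inner (E e) (\<lambda>y. cnj (K x y)))" for e
      unfolding kernel_op_inner L2_inner_commute[of "\<lambda>y. cnj (K x y)"] by simp
    then have "(\<integral>\<^sup>+e. ennreal ((cmod (kernel_op K (E e) x))\<^sup>2) \<partial>count_space B)
      = ennreal ((L2_norm (\<lambda>y. cnj (K x y)))\<^sup>2)"
      using has_sum_imp_count_space[OF _ Parseval[OF L2_cnj[OF x]]] by simp
    then show "(\<integral>\<^sup>+e. ennreal ((cmod (kernel_op K (E e) x))\<^sup>2) \<partial>count_space B)
      = (\<integral>\<^sup>+y. ennreal ((cmod (K x y))\<^sup>2) \<partial>lborel)"
      using L2_nn_integral[OF L2_cnj[OF x]] by simp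
  qed
  finally show "(\<integral>\<^sup>+e. ennreal ((L2_norm (kernel_op K (E e)))\<^sup>2) \<partial>count_space B) = ennreal S"
    using S(2) by simp
qed (use S in auto)

lemma kernel_form_integrable:
  assumes f: "f \<in> L2" and g: "g \<in> L2"
  shows "integrable (lborel \<Otimes>\<^sub>M lborel) (\<lambda>(x, y). cnj (g x) * (K x y * f y))"
proof (rule Bochner_Integration.integrable_bound)
  have [measurable]: "f \<in> borel_measurable borel" "g \<in> borel_measurable borel" using f g by auto
  have 1: "integrable (lborel \<Otimes>\<^sub>M lborel) (\<lambda>(x, y). (cmod (g x))\<^sup>2 * (cmod (f y))\<^sup>2)"
    by (rule integrable_tensor[OF L2_integrable[OF g] L2_integrable[OF f]])
  have 2: "integrable (lborel \<Otimes>\<^sub>M lborel) (\<lambda>(x, y). (cmod (K x y))\<^sup>2)"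
  proof (rule integrableI_nonneg)
    have "(\<integral>\<^sup>+p. ennreal (case p of (x, y) \<Rightarrow> (cmod (K x y))\<^sup>2) \<partial>(lborel \<Otimes>\<^sub>M lborel))
      = (\<integral>\<^sup>+x. \<integral>\<^sup>+y. ennreal ((cmod (K x y))\<^sup>2) \<partial>lborel \<partial>lborel)"
      by (subst lborel.nn_integral_fst[symmetric]) (auto simp: split_beta)
    then show "(\<integral>\<^sup>+p. ennreal (case p of (x, y) \<Rightarrow> (cmod (K x y))\<^sup>2) \<partial>(lborel \<Otimes>\<^sub>M lborel)) < \<infinity>"
      by (simp add: S(2))
  qed auto
  show "integrable (lborel \<Otimes>\<^sub>M lborel) (\<lambda>p. (case p of (x, y) \<Rightarrow> (cmod (g x))\<^sup>2 * (cmod (f y))\<^sup>2)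
      + (case p of (x, y) \<Rightarrow> (cmod (K x y))\<^sup>2))"
    by (intro Bochner_Integration.integrable_add 1 2)
  have "norm (cnj (g x) * (K x y * f y)) \<le> (cmod (g x))\<^sup>2 * (cmod (f y))\<^sup>2 + (cmod (K x y))\<^sup>2" for x y
    using norm_prod_le_squares[of "cnj (g x) * f y" "K x y"] by (simp add: norm_mult power_mult_distrib mult_ac)
  then show "AE p in lborel \<Otimes>\<^sub>M lborel. norm (case p of (x, y) \<Rightarrow> cnj (g x) * (K x y * f y))
      \<le> norm ((case p of (x, y) \<Rightarrow> (cmod (g x))\<^sup>2 * (cmod (f y))\<^sup>2) + (case p of (x, y) \<Rightarrow> (cmod (K x y))\<^sup>2))"
    by (intro AE_I2) (auto simp: split_beta)
  show "(\<lambda>(x, y). cnj (g x) * (K x y * f y)) \<in> borel_measurable (lborel \<Otimes>\<^sub>M lborel)"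
    using K_measurable by (simp add: split_beta)
qed

end

text \<open>
  The substitution \<open>\<zeta> = \<xi> - \<eta>\<close>, under which kernels depending on the difference of their arguments become
  products.
\<close>

lemma nn_integral_shear:
  fixes f :: "real \<Rightarrow> real \<Rightarrow> ennreal"
  assumes [measurable]: "case_prod f \<in> borel_measurable (lborel \<Otimes>\<^sub>M lborel)"
  shows "(\<integral>\<^sup>+\<xi>. \<integral>\<^sup>+\<eta>. f \<xi> \<eta> \<partial>lborel \<partial>lborel) = (\<integral>\<^sup>+\<zeta>. \<integral>\<^sup>+\<eta>. f (\<zeta> + \<eta>) \<eta> \<partial>lborel \<partial>lborel)"
proof -
  have [measurable]: "case_prod f \<in> borel_measurable (borel \<Otimes>\<^sub>M borel)" using assms by simp
  have "(\<integral>\<^sup>+\<xi>. \<integral>\<^sup>+\<eta>. f \<xi> \<eta> \<partial>lborel \<partial>lborel) = (\<integral>\<^sup>+\<eta>. \<integral>\<^sup>+\<xi>. f \<xi> \<eta> \<partial>lborel \<partial>lborel)"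
    using lborel_pair.Fubini[of "case_prod f"] by simp
  also have "\<dots> = (\<integral>\<^sup>+\<eta>. \<integral>\<^sup>+\<zeta>. f (\<zeta> + \<eta>) \<eta> \<partial>lborel \<partial>lborel)"
  proof (rule nn_integral_cong)
    fix \<eta>
    have "(\<lambda>\<xi>. case_prod f (\<xi>, \<eta>)) \<in> borel_measurable borel" by measurable
    then have "(\<integral>\<^sup>+\<xi>. f \<xi> \<eta> \<partial>lborel) = ennreal \<bar>1\<bar> * (\<integral>\<^sup>+\<zeta>. f (\<eta> + 1 * \<zeta>) \<eta> \<partial>lborel)"
      by (intro nn_integral_real_affine) auto
    then show "(\<integral>\<^sup>+\<xi>. f \<xi> \<eta> \<partial>lborel) = (\<integral>\<^sup>+\<zeta>. f (\<zeta> + \<eta>) \<eta> \<partial>lborel)" by (simp add: add.commute)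
  qed
  also have "\<dots> = (\<integral>\<^sup>+\<zeta>. \<integral>\<^sup>+\<eta>. f (\<zeta> + \<eta>) \<eta> \<partial>lborel \<partial>lborel)"
  proof -
    have "(\<lambda>p. case_prod f (fst p + snd p, snd p)) \<in> borel_measurable (borel \<Otimes>\<^sub>M borel)" by measurable
    then show ?thesis using lborel_pair.Fubini[of "\<lambda>p. f (fst p + snd p) (snd p)"] by (simp add: split_beta)
  qed
  finally show ?thesis .
qed

lemma integral_shear:
  fixes f :: "real \<Rightarrow> real \<Rightarrow> complex"
  assumes f: "integrable (lborel \<Otimes>\<^sub>M lborel) (case_prod f)"
  shows "(LINT \<xi>|lborel. LINT \<eta>|lborel. f \<xi> \<eta>) = (LINT \<zeta>|lborel. LINT \<eta>|lborel. f (\<zeta> + \<eta>) \<eta>)"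
proof -
  have [measurable]: "case_prod f \<in> borel_measurable (lborel \<Otimes>\<^sub>M lborel)" using f by auto
  then have [measurable]: "case_prod f \<in> borel_measurable (borel \<Otimes>\<^sub>M borel)" by simp
  have m: "(\<lambda>p. case_prod f (fst p + snd p, snd p)) \<in> borel_measurable (borel \<Otimes>\<^sub>M borel)" by measurable
  have sheared: "integrable (lborel \<Otimes>\<^sub>M lborel) (\<lambda>(\<zeta>, \<eta>). f (\<zeta> + \<eta>) \<eta>)"
  proof (rule integrableI_bounded)
    show m': "(\<lambda>(\<zeta>, \<eta>). f (\<zeta> + \<eta>) \<eta>) \<in> borel_measurable (lborel \<Otimes>\<^sub>M lborel)"
      using m by (simp add: split_beta)
    have "(\<integral>\<^sup>+p. ennreal (norm (case p of (\<zeta>, \<eta>) \<Rightarrow> f (\<zeta> + \<eta>) \<eta>)) \<partial>(lborel \<Otimes>\<^sub>M lborel))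
      = (\<integral>\<^sup>+\<zeta>. \<integral>\<^sup>+\<eta>. ennreal (norm (f (\<zeta> + \<eta>) \<eta>)) \<partial>lborel \<partial>lborel)"
      using m by (subst lborel.nn_integral_fst[symmetric]) (auto simp: split_beta)
    also have "\<dots> = (\<integral>\<^sup>+\<xi>. \<integral>\<^sup>+\<eta>. ennreal (norm (f \<xi> \<eta>)) \<partial>lborel \<partial>lborel)"
      by (rule nn_integral_shear[symmetric]) (simp add: split_beta)
    also have "\<dots> = (\<integral>\<^sup>+p. ennreal (norm (case_prod f p)) \<partial>(lborel \<Otimes>\<^sub>M lborel))"
      by (subst lborel.nn_integral_fst[symmetric]) (auto simp: split_beta)
    also have "\<dots> < \<infinity>" using f by (simp add: integrable_iff_bounded)
    finally show "(\<integral>\<^sup>+p. ennreal (norm (case p of (\<zeta>, \<eta>) \<Rightarrow> f (\<zeta> + \<eta>) \<eta>)) \<partial>(lborel \<Otimes>\<^sub>M lborel)) < \<infinity>" .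
  qed
  have "(LINT \<xi>|lborel. LINT \<eta>|lborel. f \<xi> \<eta>) = (LINT \<eta>|lborel. LINT \<xi>|lborel. f \<xi> \<eta>)"
    by (rule integral_swap[OF f])
  also have "\<dots> = (LINT \<eta>|lborel. LINT \<zeta>|lborel. f (\<zeta> + \<eta>) \<eta>)"
  proof (rule Bochner_Integration.integral_cong[OF refl])
    show "(LINT \<xi>|lborel. f \<xi> \<eta>) = (LINT \<zeta>|lborel. f (\<zeta> + \<eta>) \<eta>)" for \<eta>
      using lborel_integral_real_affine[of 1 "\<lambda>\<xi>. f \<xi> \<eta>" \<eta>] by (simp add: add.commute)
  qed
  also have "\<dots> = (LINT \<zeta>|lborel. LINT \<eta>|lborel. f (\<zeta> + \<eta>) \<eta>)"
    by (rule integral_swap[OF sheared, symmetric])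
  finally show ?thesis .
qed

text \<open>
  Partial fractions: with \<open>b = 1 / (\<zeta>\<^sup>2 + 4\<kappa>\<^sup>2)\<close> and \<open>a = -2b/\<zeta>\<close> the integrand is
  \<open>(a\<eta> + b) / (\<eta>\<^sup>2 + \<kappa>\<^sup>2) + (b - a(\<zeta> + \<eta>)) / ((\<zeta> + \<eta>)\<^sup>2 + \<kappa>\<^sup>2)\<close>. The logarithms in the antiderivative cancel at
  infinity and each arctangent contributes \<open>\<pi> b / \<kappa>\<close>. For \<open>\<zeta> = 0\<close> the decomposition breaks down, but a
  single point does not matter for the integrals over \<open>\<zeta>\<close> in which the formula is used.
\<close>

lemma cauchy_convolution:
  assumes \<kappa>: "\<kappa> > 0" and \<zeta>: "\<zeta> \<noteq> 0"
  shows "(\<integral>\<^sup>+\<eta>. ennreal ((root_symbol \<kappa> (\<zeta> + \<eta>))\<^sup>2 * (root_symbol \<kappa> \<eta>)\<^sup>2) \<partial>lborel)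
    = ennreal (2 * pi / (\<kappa> * (\<zeta>\<^sup>2 + 4 * \<kappa>\<^sup>2)))"
proof -
  define b where "b = 1 / (\<zeta>\<^sup>2 + 4 * \<kappa>\<^sup>2)"
  define a where "a = - 2 * b / \<zeta>"
  define f where "f \<eta> = 1 / (((\<zeta> + \<eta>)\<^sup>2 + \<kappa>\<^sup>2) * (\<eta>\<^sup>2 + \<kappa>\<^sup>2))" for \<eta>
  define F where "F \<eta> = a / 2 * (ln (\<eta>\<^sup>2 + \<kappa>\<^sup>2) - ln ((\<zeta> + \<eta>)\<^sup>2 + \<kappa>\<^sup>2)) + b / \<kappa> * (arctan (\<eta> / \<kappa>) + arctan ((\<zeta> + \<eta>) / \<kappa>))" for \<eta>
  have pos: "0 < y\<^sup>2 + \<kappa>\<^sup>2" for y :: real using \<kappa> by (simp add: add_nonneg_pos)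
  have "0 < \<zeta>\<^sup>2 + 4 * \<kappa>\<^sup>2" using \<kappa> by (simp add: add_nonneg_pos)
  then have b: "b * (\<zeta>\<^sup>2 + 4 * \<kappa>\<^sup>2) = 1" by (simp add: b_def)
  have a\<zeta>: "a * \<zeta> = - 2 * b" using \<zeta> by (simp add: a_def)
  have fact: "(a * \<eta> + b) * ((\<zeta> + \<eta>)\<^sup>2 + \<kappa>\<^sup>2) + (b - a * (\<zeta> + \<eta>)) * (\<eta>\<^sup>2 + \<kappa>\<^sup>2) = 1" for \<eta>
    using b a\<zeta> by algebra
  have deriv: "DERIV F \<eta> :> f \<eta>" for \<eta>
  proof -
    have at: "(1 / \<kappa>) / (1 + (y / \<kappa>)\<^sup>2) = \<kappa> / (y\<^sup>2 + \<kappa>\<^sup>2)" for y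
    proof -
      have "1 + (y / \<kappa>)\<^sup>2 = (y\<^sup>2 + \<kappa>\<^sup>2) / \<kappa>\<^sup>2" using \<kappa> by (simp add: field_simps)
      then show ?thesis using \<kappa> by (simp add: power2_eq_square)
    qed
    have "DERIV F \<eta> :> a / 2 * (2 * \<eta> / (\<eta>\<^sup>2 + \<kappa>\<^sup>2) - 2 * (\<zeta> + \<eta>) / ((\<zeta> + \<eta>)\<^sup>2 + \<kappa>\<^sup>2))
       + b / \<kappa> * ((1 / \<kappa>) / (1 + (\<eta> / \<kappa>)\<^sup>2) + (1 / \<kappa>) / (1 + ((\<zeta> + \<eta>) / \<kappa>)\<^sup>2))"
      unfolding F_def
    proof (intro DERIV_add DERIV_cmult DERIV_diff)
      have d1: "((\<lambda>\<eta>. \<eta> / \<kappa>) has_real_derivative 1 / \<kappa>) (at \<eta>)"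
        and d2: "((\<lambda>\<eta>. (\<zeta> + \<eta>) / \<kappa>) has_real_derivative 1 / \<kappa>) (at \<eta>)"
        using \<kappa> by (auto intro!: derivative_eq_intros)
      show "((\<lambda>\<eta>. ln (\<eta>\<^sup>2 + \<kappa>\<^sup>2)) has_real_derivative 2 * \<eta> / (\<eta>\<^sup>2 + \<kappa>\<^sup>2)) (at \<eta>)"
        using pos[of \<eta>] by (auto intro!: derivative_eq_intros)
      show "((\<lambda>\<eta>. ln ((\<zeta> + \<eta>)\<^sup>2 + \<kappa>\<^sup>2)) has_real_derivative 2 * (\<zeta> + \<eta>) / ((\<zeta> + \<eta>)\<^sup>2 + \<kappa>\<^sup>2)) (at \<eta>)"
        using pos[of "\<zeta> + \<eta>"] by (auto intro!: derivative_eq_intros)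
      show "((\<lambda>\<eta>. arctan (\<eta> / \<kappa>)) has_real_derivative (1 / \<kappa>) / (1 + (\<eta> / \<kappa>)\<^sup>2)) (at \<eta>)"
        using DERIV_chain2[OF DERIV_arctan d1] by (simp add: divide_inverse mult.commute)
      show "((\<lambda>\<eta>. arctan ((\<zeta> + \<eta>) / \<kappa>)) has_real_derivative (1 / \<kappa>) / (1 + ((\<zeta> + \<eta>) / \<kappa>)\<^sup>2)) (at \<eta>)"
        using DERIV_chain2[OF DERIV_arctan d2] by (simp add: divide_inverse mult.commute)
    qed
    also have "a / 2 * (2 * \<eta> / (\<eta>\<^sup>2 + \<kappa>\<^sup>2) - 2 * (\<zeta> + \<eta>) / ((\<zeta> + \<eta>)\<^sup>2 + \<kappa>\<^sup>2))
       + b / \<kappa> * ((1 / \<kappa>) / (1 + (\<eta> / \<kappa>)\<^sup>2) + (1 / \<kappa>) / (1 + ((\<zeta> + \<eta>) / \<kappa>)\<^sup>2))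
       = (a * \<eta> + b) / (\<eta>\<^sup>2 + \<kappa>\<^sup>2) + (b - a * (\<zeta> + \<eta>)) / ((\<zeta> + \<eta>)\<^sup>2 + \<kappa>\<^sup>2)"
      unfolding at using \<kappa> by (simp add: distrib_left right_diff_distrib add_divide_distrib diff_divide_distrib)
    also have "\<dots> = ((a * \<eta> + b) * ((\<zeta> + \<eta>)\<^sup>2 + \<kappa>\<^sup>2) + (b - a * (\<zeta> + \<eta>)) * (\<eta>\<^sup>2 + \<kappa>\<^sup>2))
        / ((\<eta>\<^sup>2 + \<kappa>\<^sup>2) * ((\<zeta> + \<eta>)\<^sup>2 + \<kappa>\<^sup>2))"
      using pos[of \<eta>] pos[of "\<zeta> + \<eta>"] by (intro add_frac_eq) auto
    also have "\<dots> = f \<eta>" unfolding fact by (simp add: f_def mult.commute)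
    finally show ?thesis .
  qed
  have lim_top: "(F \<longlongrightarrow> a / 2 * 0 + b / \<kappa> * (pi / 2 + pi / 2)) at_top"
    unfolding F_def
  proof (intro tendsto_add tendsto_mult tendsto_const)
    show "((\<lambda>\<eta>. ln (\<eta>\<^sup>2 + \<kappa>\<^sup>2) - ln ((\<zeta> + \<eta>)\<^sup>2 + \<kappa>\<^sup>2)) \<longlongrightarrow> 0) at_top" by real_asymp
    show "((\<lambda>\<eta>. arctan (\<eta> / \<kappa>)) \<longlongrightarrow> pi / 2) at_top" using \<kappa> by real_asymp
    show "((\<lambda>\<eta>. arctan ((\<zeta> + \<eta>) / \<kappa>)) \<longlongrightarrow> pi / 2) at_top" using \<kappa> by real_asymp
  qed
  have lim_bot: "(F \<longlongrightarrow> a / 2 * 0 + b / \<kappa> * (- pi / 2 + - pi / 2)) at_bot"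
    unfolding F_def
  proof (intro tendsto_add tendsto_mult tendsto_const)
    show "((\<lambda>\<eta>. ln (\<eta>\<^sup>2 + \<kappa>\<^sup>2) - ln ((\<zeta> + \<eta>)\<^sup>2 + \<kappa>\<^sup>2)) \<longlongrightarrow> 0) at_bot" by real_asymp
    show "((\<lambda>\<eta>. arctan (\<eta> / \<kappa>)) \<longlongrightarrow> - pi / 2) at_bot" using \<kappa> by real_asymp
    show "((\<lambda>\<eta>. arctan ((\<zeta> + \<eta>) / \<kappa>)) \<longlongrightarrow> - pi / 2) at_bot" using \<kappa> by real_asymp
  qed
  have f_nonneg: "f \<eta> \<ge> 0" for \<eta> using pos by (simp add: f_def less_imp_le)
  have "isCont f \<eta>" for \<eta>
    unfolding f_def using pos[of \<eta>] pos[of "\<zeta> + \<eta>"] by (intro continuous_intros) auto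
  note FTC = interval_integral_FTC_nonneg[of "-\<infinity>" \<infinity> F f, OF _ deriv this, unfolded ereal_tendsto_simps, OF _ _ lim_bot lim_top]
  have int: "integrable lborel f"
    using FTC(1) f_nonneg by (simp add: set_integrable_def)
  have "(LINT \<eta>|lborel. f \<eta>) = 2 * pi * b / \<kappa>"
    using FTC(2) f_nonneg by (simp add: interval_lebesgue_integral_def set_lebesgue_integral_def)
  then have "(\<integral>\<^sup>+\<eta>. ennreal (f \<eta>) \<partial>lborel) = ennreal (2 * pi * b / \<kappa>)"
    using nn_integral_eq_integral[OF int] f_nonneg by simp
  moreover have "(root_symbol \<kappa> (\<zeta> + \<eta>))\<^sup>2 * (root_symbol \<kappa> \<eta>)\<^sup>2 = f \<eta>" for \<eta>
    using pos[of \<eta>] pos[of "\<zeta> + \<eta>"] by (simp add: root_symbol_sqrt[OF \<kappa>] f_def power_divide)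
  ultimately show ?thesis by (simp add: b_def mult.commute)
qed

section \<open>Potentials in \<open>H\<^sup>-\<^sup>1\<close>\<close>

lemma L2_fourier_Parseval:
  assumes B: "L2_orthonormal_basis B" and f: "f \<in> L2"
  shows "((\<lambda>e. (cmod (L2_inner (L2_fourier e) f))\<^sup>2) has_sum (L2_norm f)\<^sup>2) B"
proof -
  obtain h where h: "h \<in> L2" "AE x in lborel. L2_fourier h x = f x" using L2_fourier_surj[OF f] .
  have BL2: "e \<in> L2" if "e \<in> B" for e using B that by (auto simp: L2_orthonormal_basis_def)
  have "L2_inner (L2_fourier e) f = L2_inner e h" if "e \<in> B" for e
  proof -
    have "L2_inner (L2_fourier e) (L2_fourier h) = L2_inner (L2_fourier e) f"
      by (intro L2_inner_cong_AE L2_measurable_borel L2_fourier h f BL2 that)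
    then show ?thesis using L2_fourier_unitary[OF BL2[OF that] h(1)] by simp
  qed
  then have "((\<lambda>e. (cmod (L2_inner (L2_fourier e) f))\<^sup>2) has_sum (L2_norm h)\<^sup>2) B
      \<longleftrightarrow> ((\<lambda>e. (cmod (L2_inner e h))\<^sup>2) has_sum (L2_norm h)\<^sup>2) B"
    by (intro has_sum_cong) simp
  moreover have "L2_norm f = L2_norm h"
  proof -
    have "L2_norm (L2_fourier h) = L2_norm f"
      by (intro L2_norm_cong_AE L2_measurable_borel L2_fourier h f)
    then show ?thesis using L2_fourier_norm[OF h(1)] by simp
  qed
  ultimately show ?thesis
    using L2_Parseval[OF B h(1)] by simp
qed

locale negative_sobolev =
  fixes V :: dist and g :: "real \<Rightarrow> complex"
  assumes V: "V \<in> tempered" and g: "g \<in> L2" and Vg: "is_function (sobolev_weighted (-1) V) g"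
begin

text \<open>
  The Fourier transform of \<open>V\<close>, recovered from its weighted version \<open>g\<close>.
\<close>

definition Vhat :: "real \<Rightarrow> complex" where
  "Vhat \<zeta> = of_real (bracket \<zeta>) * g \<zeta>"

lemma Vhat_measurable[measurable]: "Vhat \<in> borel_measurable borel"
proof -
  have [measurable]: "g \<in> borel_measurable borel" using g by auto
  show ?thesis unfolding Vhat_def by measurable
qed

lemma V_test:
  assumes \<theta>: "\<theta> \<in> schwartz"
  shows "V \<theta> = (LINT \<zeta>|lborel. cnj (fourier \<theta> \<zeta>) * Vhat \<zeta>)"
    "integrable lborel (\<lambda>\<zeta>. cnj (fourier \<theta> \<zeta>) * Vhat \<zeta>)"
proof -
  define \<psi> where "\<psi> = (\<lambda>\<zeta>. of_real (bracket \<zeta>) * fourier \<theta> \<zeta>)"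
  have \<psi>: "\<psi> \<in> schwartz" unfolding \<psi>_def by (intro schwartz_mult_slow[OF slow_bracket] schwartz_fourier \<theta>)
  have cnj\<psi>: "cnj (\<psi> \<zeta>) * g \<zeta> = cnj (fourier \<theta> \<zeta>) * Vhat \<zeta>" for \<zeta>
    by (simp add: \<psi>_def Vhat_def mult_ac)
  have "V \<theta> = V (inv_fourier (fourier \<theta>))" by (simp add: inv_fourier_fourier \<theta>)
  also have "fourier \<theta> = (\<lambda>x. cnj (complex_of_real ((1 + x\<^sup>2) powr (- 1 / 2))) * \<psi> x)"
    by (simp only: bracket_powr) (simp add: \<psi>_def)
  also have "V (inv_fourier \<dots>) = sobolev_weighted (-1) V \<psi>"
    by (simp add: sobolev_weighted_def dist_mult_def dist_fourier_def)
  also have "\<dots> = (LINT \<zeta>|lborel. cnj (\<psi> \<zeta>) * g \<zeta>)"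
    using Vg \<psi> by (auto simp: is_function_def dist_of_fun_def)
  finally show "V \<theta> = (LINT \<zeta>|lborel. cnj (fourier \<theta> \<zeta>) * Vhat \<zeta>)" by (simp only: cnj\<psi>)
  show "integrable lborel (\<lambda>\<zeta>. cnj (fourier \<theta> \<zeta>) * Vhat \<zeta>)"
    using L2_inner_integrable[OF schwartz_L2[OF \<psi>] g] by (simp only: cnj\<psi>)
qed

lemma Vhat_is_fourier: "is_function (dist_fourier V) Vhat"
  unfolding is_function_def
proof (intro conjI ballI)
  fix \<psi> assume \<psi>: "\<psi> \<in> schwartz"
  show "integrable lborel (\<lambda>x. cnj (\<psi> x) * Vhat x)" "dist_fourier V \<psi> = dist_of_fun Vhat \<psi>"
    using V_test[OF schwartz_inv_fourier[OF \<psi>]]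
    by (simp_all add: fourier_inv_fourier[OF \<psi>] dist_fourier_def dist_of_fun_def)
qed simp

definition hs_square :: "real \<Rightarrow> real" where
  "hs_square \<kappa> = 1 / \<kappa> * (LINT \<zeta>|lborel. (cmod (Vhat \<zeta>))\<^sup>2 / (\<zeta>\<^sup>2 + 4 * \<kappa>\<^sup>2))"

lemma weighted_integrable:
  assumes \<kappa>: "\<kappa> > 0"
  shows "integrable lborel (\<lambda>\<zeta>. (cmod (Vhat \<zeta>))\<^sup>2 / (\<zeta>\<^sup>2 + 4 * \<kappa>\<^sup>2))"
proof -
  have "(\<lambda>\<zeta>. of_real (bracket \<zeta> * root_symbol (2 * \<kappa>) \<zeta>) * g \<zeta>) \<in> L2"
    by (rule L2_multiplier[where C="1 + 1 / (2 * \<kappa>)"])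
       (use g \<kappa> bracket_root_symbol_le[of "2 * \<kappa>"] root_symbol_pos[of "2 * \<kappa>"] in \<open>auto simp: less_imp_le\<close>)
  then have "integrable lborel (\<lambda>\<zeta>. (cmod (of_real (bracket \<zeta> * root_symbol (2 * \<kappa>) \<zeta>) * g \<zeta>))\<^sup>2)"
    by (rule L2_integrable)
  moreover have "(cmod (of_real (bracket \<zeta> * root_symbol (2 * \<kappa>) \<zeta>) * g \<zeta>))\<^sup>2 = (cmod (Vhat \<zeta>))\<^sup>2 / (\<zeta>\<^sup>2 + 4 * \<kappa>\<^sup>2)" for \<zeta>
  proof -
    have "0 \<le> \<zeta>\<^sup>2 + 4 * \<kappa>\<^sup>2" by (simp add: add_nonneg_nonneg)
    then show ?thesis
      using \<kappa> by (simp add: root_symbol_sqrt Vhat_def norm_mult norm_divide power_divide power_mult_distrib)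
  qed
  ultimately show ?thesis by simp
qed

definition kernel :: "real \<Rightarrow> real \<Rightarrow> real \<Rightarrow> complex" where
  "kernel \<kappa> \<xi> \<eta> = fconst * (of_real (root_symbol \<kappa> \<xi> * root_symbol \<kappa> \<eta>) * Vhat (\<xi> - \<eta>))"

lemma hs_square_nonneg: "\<kappa> > 0 \<Longrightarrow> hs_square \<kappa> \<ge> 0"
  unfolding hs_square_def
  by (intro mult_nonneg_nonneg integral_nonneg_AE AE_I2 divide_nonneg_nonneg) (auto simp: add_nonneg_nonneg)

lemma kernel_square_integrable:
  assumes \<kappa>: "\<kappa> > 0" shows "square_integrable_kernel (kernel \<kappa>) (hs_square \<kappa>)"
proof
  have "case_prod (kernel \<kappa>) \<in> borel_measurable (borel \<Otimes>\<^sub>M borel)"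
    unfolding kernel_def split_beta by measurable
  then show meas: "case_prod (kernel \<kappa>) \<in> borel_measurable (lborel \<Otimes>\<^sub>M lborel)" by simp
  show "hs_square \<kappa> \<ge> 0" by (rule hs_square_nonneg[OF \<kappa>])
  have "(\<integral>\<^sup>+\<xi>. \<integral>\<^sup>+\<eta>. ennreal ((cmod (kernel \<kappa> \<xi> \<eta>))\<^sup>2) \<partial>lborel \<partial>lborel)
    = (\<integral>\<^sup>+\<zeta>. \<integral>\<^sup>+\<eta>. ennreal ((cmod (kernel \<kappa> (\<zeta> + \<eta>) \<eta>))\<^sup>2) \<partial>lborel \<partial>lborel)"
    using meas by (intro nn_integral_shear) (simp add: split_beta)
  also have "\<dots> = (\<integral>\<^sup>+\<zeta>. ennreal (1 / \<kappa> * ((cmod (Vhat \<zeta>))\<^sup>2 / (\<zeta>\<^sup>2 + 4 * \<kappa>\<^sup>2))) \<partial>lborel)"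
  proof (rule nn_integral_cong_AE, use AE_lborel_singleton[of 0] in eventually_elim)
    fix \<zeta> :: real assume \<zeta>: "\<zeta> \<noteq> 0"
    have "0 < \<zeta>\<^sup>2 + 4 * \<kappa>\<^sup>2" using \<kappa> by (simp add: add_nonneg_pos)
    have "(cmod (kernel \<kappa> (\<zeta> + \<eta>) \<eta>))\<^sup>2
       = (cmod (Vhat \<zeta>))\<^sup>2 / (2 * pi) * ((root_symbol \<kappa> (\<zeta> + \<eta>))\<^sup>2 * (root_symbol \<kappa> \<eta>)\<^sup>2)" for \<eta>
      unfolding kernel_def fconst_eq norm_mult norm_of_real power_mult_distrib
      by (simp add: power_divide power_mult_distrib)
    then have "ennreal ((cmod (kernel \<kappa> (\<zeta> + \<eta>) \<eta>))\<^sup>2) = ennreal ((cmod (Vhat \<zeta>))\<^sup>2 / (2 * pi))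
        * ennreal ((root_symbol \<kappa> (\<zeta> + \<eta>))\<^sup>2 * (root_symbol \<kappa> \<eta>)\<^sup>2)" for \<eta>
      by (simp only:) (rule ennreal_mult; simp)
    then have "(\<integral>\<^sup>+\<eta>. ennreal ((cmod (kernel \<kappa> (\<zeta> + \<eta>) \<eta>))\<^sup>2) \<partial>lborel)
      = ennreal ((cmod (Vhat \<zeta>))\<^sup>2 / (2 * pi)) *
        (\<integral>\<^sup>+\<eta>. ennreal ((root_symbol \<kappa> (\<zeta> + \<eta>))\<^sup>2 * (root_symbol \<kappa> \<eta>)\<^sup>2) \<partial>lborel)"
      by (simp only:) (rule nn_integral_cmult, measurable)
    also have "\<dots> = ennreal ((cmod (Vhat \<zeta>))\<^sup>2 / (2 * pi) * (2 * pi / (\<kappa> * (\<zeta>\<^sup>2 + 4 * \<kappa>\<^sup>2))))"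
      using \<open>0 < \<zeta>\<^sup>2 + 4 * \<kappa>\<^sup>2\<close> \<kappa> by (simp only: cauchy_convolution[OF \<kappa> \<zeta>]) (rule ennreal_mult[symmetric]; simp)
    also have "(cmod (Vhat \<zeta>))\<^sup>2 / (2 * pi) * (2 * pi / (\<kappa> * (\<zeta>\<^sup>2 + 4 * \<kappa>\<^sup>2)))
        = 1 / \<kappa> * ((cmod (Vhat \<zeta>))\<^sup>2 / (\<zeta>\<^sup>2 + 4 * \<kappa>\<^sup>2))" by simp
    finally show "(\<integral>\<^sup>+\<eta>. ennreal ((cmod (kernel \<kappa> (\<zeta> + \<eta>) \<eta>))\<^sup>2) \<partial>lborel)
      = ennreal (1 / \<kappa> * ((cmod (Vhat \<zeta>))\<^sup>2 / (\<zeta>\<^sup>2 + 4 * \<kappa>\<^sup>2)))" .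
  qed
  also have "\<dots> = ennreal (LINT \<zeta>|lborel. 1 / \<kappa> * ((cmod (Vhat \<zeta>))\<^sup>2 / (\<zeta>\<^sup>2 + 4 * \<kappa>\<^sup>2)))"
    using weighted_integrable[OF \<kappa>] \<kappa>
    by (intro nn_integral_eq_integral integrable_mult_right AE_I2) (auto simp: add_nonneg_nonneg)
  also have "\<dots> = ennreal (hs_square \<kappa>)" by (simp only: hs_square_def integral_mult_right_zero)
  finally show "(\<integral>\<^sup>+\<xi>. \<integral>\<^sup>+\<eta>. ennreal ((cmod (kernel \<kappa> \<xi> \<eta>))\<^sup>2) \<partial>lborel \<partial>lborel) = ennreal (hs_square \<kappa>)" .
qed

text \<open>
  The pairing of \<open>V\<close> with a product is a double integral against the transform of that product, which is a
  convolution; the substitution \<open>\<xi> = \<zeta> + \<eta>\<close> brings it into the form of the integral operator. Dividing the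
  transforms by the symbol undoes the two roots contained in the kernel.
\<close>

theorem V_form_kernel:
  assumes \<kappa>: "\<kappa> > 0" and \<phi>: "\<phi> \<in> schwartz" and \<psi>: "\<psi> \<in> schwartz"
  shows "V (\<lambda>x. cnj (\<phi> x) * \<psi> x) = L2_inner (\<lambda>\<xi>. of_real (1 / root_symbol \<kappa> \<xi>) * fourier \<psi> \<xi>)
      (kernel_op (kernel \<kappa>) (\<lambda>\<eta>. of_real (1 / root_symbol \<kappa> \<eta>) * fourier \<phi> \<eta>))"
proof -
  interpret square_integrable_kernel "kernel \<kappa>" "hs_square \<kappa>" by (rule kernel_square_integrable[OF \<kappa>])
  define a where "a = (\<lambda>\<eta>. of_real (1 / root_symbol \<kappa> \<eta>) * fourier \<phi> \<eta>)"
  define b where "b = (\<lambda>\<xi>. of_real (1 / root_symbol \<kappa> \<xi>) * fourier \<psi> \<xi>)"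
  have ab: "a \<in> L2" "b \<in> L2"
    unfolding a_def b_def
    by (intro schwartz_L2 schwartz_mult_slow[OF slow_inverse_root_symbol[OF \<kappa>]] schwartz_fourier \<phi> \<psi>)+
  have m: "root_symbol \<kappa> x \<noteq> 0" for x using root_symbol_pos[OF \<kappa>, of x] by simp
  have "L2_inner b (kernel_op (kernel \<kappa>) a) = (LINT \<xi>|lborel. LINT \<eta>|lborel. cnj (b \<xi>) * (kernel \<kappa> \<xi> \<eta> * a \<eta>))"
    by (simp only: L2_inner_def kernel_op_def integral_mult_right_zero)
  also have "\<dots> = (LINT \<zeta>|lborel. LINT \<eta>|lborel. cnj (b (\<zeta> + \<eta>)) * (kernel \<kappa> (\<zeta> + \<eta>) \<eta> * a \<eta>))"
    by (rule integral_shear) (use kernel_form_integrable[OF ab] in simp)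
  also have "\<dots> = (LINT \<zeta>|lborel. cnj (fourier (\<lambda>x. cnj (\<phi> x) * \<psi> x) \<zeta>) * Vhat \<zeta>)"
  proof (rule Bochner_Integration.integral_cong[OF refl])
    fix \<zeta>
    have "cnj (b (\<zeta> + \<eta>)) * (kernel \<kappa> (\<zeta> + \<eta>) \<eta> * a \<eta>)
      = (fconst * Vhat \<zeta>) * cnj (cnj (fourier \<phi> \<eta>) * fourier \<psi> (\<zeta> + \<eta>))" for \<eta>
      using m[of \<eta>] m[of "\<zeta> + \<eta>"] by (simp add: a_def b_def kernel_def)
    then have "(LINT \<eta>|lborel. cnj (b (\<zeta> + \<eta>)) * (kernel \<kappa> (\<zeta> + \<eta>) \<eta> * a \<eta>))
      = (fconst * Vhat \<zeta>) * cnj (LINT \<eta>|lborel. cnj (fourier \<phi> \<eta>) * fourier \<psi> (\<zeta> + \<eta>))"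
      by (simp only: integral_mult_right_zero Bochner_Integration.integral_cnj)
    then show "(LINT \<eta>|lborel. cnj (b (\<zeta> + \<eta>)) * (kernel \<kappa> (\<zeta> + \<eta>) \<eta> * a \<eta>))
      = cnj (fourier (\<lambda>x. cnj (\<phi> x) * \<psi> x) \<zeta>) * Vhat \<zeta>"
      unfolding fourier_convolution[OF \<psi> \<phi>]
      by (simp only: complex_cnj_mult complex_cnj_complex_of_real mult_ac)
  qed
  also have "\<dots> = V (\<lambda>x. cnj (\<phi> x) * \<psi> x)"
    by (rule V_test(1)[OF schwartz_mult[OF schwartz_cnj[OF \<phi>] \<psi>], symmetric])
  finally show ?thesis by (simp only: a_def b_def)
qed

text \<open>
  For \<open>\<kappa> = 1\<close> the inverse symbol is exactly the weight of the \<open>H\<^sup>1\<close> norm, so the norm of the corresponding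
  integral operator bounds the form of \<open>V\<close>. This bound serves every \<open>\<kappa>\<close>.
\<close>

lemma V_multiplier:
  assumes \<kappa>: "\<kappa> > 0"
  shows "multiplier V \<kappa> (sqrt (hs_square 1) + 1)"
proof
  interpret square_integrable_kernel "kernel 1" "hs_square 1" by (rule kernel_square_integrable) simp
  fix \<phi> \<psi> assume \<phi>: "\<phi> \<in> schwartz" and \<psi>: "\<psi> \<in> schwartz"
  let ?a = "\<lambda>\<phi> \<xi>. of_real (1 / root_symbol 1 \<xi>) * fourier \<phi> \<xi>"
  have a: "?a \<phi> \<in> L2" "?a \<psi> \<in> L2"
    by (intro schwartz_L2 schwartz_mult_slow[OF slow_inverse_root_symbol] schwartz_fourier \<phi> \<psi> zero_less_one)+
  have norm: "L2_norm (?a \<theta>) = h1_norm \<theta>" for \<theta> by (simp add: h1_norm_def root_symbol_one)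
  have "cmod (V (\<lambda>x. cnj (\<phi> x) * \<psi> x)) \<le> L2_norm (?a \<psi>) * L2_norm (kernel_op (kernel 1) (?a \<phi>))"
    unfolding V_form_kernel[OF zero_less_one \<phi> \<psi>] by (intro L2_Cauchy_Schwarz a kernel_op_L2)
  also have "\<dots> \<le> L2_norm (?a \<psi>) * (sqrt (hs_square 1) * L2_norm (?a \<phi>))"
    by (intro mult_left_mono kernel_op_L2 a) simp
  also have "\<dots> \<le> L2_norm (?a \<psi>) * ((sqrt (hs_square 1) + 1) * L2_norm (?a \<phi>))"
    by (intro mult_left_mono mult_right_mono) auto
  finally show "cmod (V (\<lambda>x. cnj (\<phi> x) * \<psi> x)) \<le> (sqrt (hs_square 1) + 1) * h1_norm \<psi> * h1_norm \<phi>"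
    unfolding norm by (simp add: mult_ac)
qed (use \<kappa> V hs_square_nonneg[of 1] in \<open>auto simp: add_nonneg_pos\<close>)

text \<open>
  Both sides are bounded operators applied to \<open>f\<close> that agree for Schwartz \<open>f\<close>, where the two roots in
  \<open>sandwiched_schwartz\<close> cancel the inverse symbols in \<open>V_form_kernel\<close>.
\<close>

theorem sandwiched_fourier:
  assumes \<kappa>: "\<kappa> > 0" and f: "f \<in> L2"
  shows "AE \<xi> in lborel. L2_fourier (sandwiched \<kappa> V f) \<xi> = kernel_op (kernel \<kappa>) (L2_fourier f) \<xi>"
proof -
  interpret square_integrable_kernel "kernel \<kappa>" "hs_square \<kappa>" by (rule kernel_square_integrable[OF \<kappa>])
  interpret multiplier V \<kappa> "sqrt (hs_square 1) + 1" by (rule V_multiplier[OF \<kappa>])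
  have m: "root_symbol \<kappa> x \<noteq> 0" for x using root_symbol_pos[OF \<kappa>, of x] by simp
  have cancel: "(\<lambda>\<xi>. of_real (1 / root_symbol \<kappa> \<xi>) * fourier (root_op \<kappa> \<psi>) \<xi>) = fourier \<psi>" if "\<psi> \<in> schwartz" for \<psi>
    using m by (simp add: fourier_root_op[OF \<kappa> that])
  show ?thesis
  proof (rule L2_fourier_unique)
    show "sandwiched \<kappa> V f \<in> L2" by (rule sandwiched_represents(1)[OF f])
    show "kernel_op (kernel \<kappa>) (L2_fourier f) \<in> L2" by (intro kernel_op_L2 L2_fourier f)
    fix \<psi> assume \<psi>: "\<psi> \<in> schwartz"
    obtain u where u: "\<And>n. u n \<in> schwartz" "(\<lambda>n. L2_norm (\<lambda>x. u n x - f x)) \<longlonglongrightarrow> 0"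
      using schwartz_dense[OF f] by blast
    have Fu: "fourier (u n) \<in> L2" "u n \<in> L2" for n
      using schwartz_L2 schwartz_fourier u(1) by blast+
    have eq: "L2_inner \<psi> (sandwiched \<kappa> V (u n)) = L2_inner (fourier \<psi>) (kernel_op (kernel \<kappa>) (fourier (u n)))" for n
      using V_form_kernel[OF \<kappa> root_op_schwartz[OF \<kappa> u(1)] root_op_schwartz[OF \<kappa> \<psi>]]
      by (simp only: sandwiched_schwartz[OF u(1) \<psi>] cancel[OF \<psi>] cancel[OF u(1)])
    have "(\<lambda>n. L2_inner \<psi> (sandwiched \<kappa> V (u n))) \<longlonglongrightarrow> L2_inner \<psi> (sandwiched \<kappa> V f)"
      by (intro L2_inner_tendsto(1) sandwiched_represents(1) Fu f schwartz_L2[OF \<psi>]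
          L2_bounded_op_limit[OF sandwiched_bounded_op] u(2))
    moreover have "(\<lambda>n. L2_inner (fourier \<psi>) (kernel_op (kernel \<kappa>) (fourier (u n))))
      \<longlonglongrightarrow> L2_inner (fourier \<psi>) (kernel_op (kernel \<kappa>) (L2_fourier f))"
    proof (intro L2_inner_tendsto(1) kernel_op_L2 Fu L2_fourier f schwartz_L2[OF schwartz_fourier[OF \<psi>]])
      show "(\<lambda>n. L2_norm (\<lambda>x. kernel_op (kernel \<kappa>) (fourier (u n)) x - kernel_op (kernel \<kappa>) (L2_fourier f) x)) \<longlonglongrightarrow> 0"
      proof (rule tendsto_sandwich[of "\<lambda>_. 0"])
        have "L2_norm (\<lambda>x. kernel_op (kernel \<kappa>) (fourier (u n)) x - kernel_op (kernel \<kappa>) (L2_fourier f) x)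
          \<le> sqrt (hs_square \<kappa>) * L2_norm (\<lambda>x. u n x - f x)" for n
        proof -
          have "L2_norm (\<lambda>x. fourier (u n) x - L2_fourier f x) = L2_norm (\<lambda>x. L2_fourier (u n) x - L2_fourier f x)"
            using L2_fourier_schwartz[OF u(1)[of n]]
            by (intro L2_norm_cong_AE L2_measurable_borel L2_diff Fu L2_fourier f) auto
          then have "L2_norm (\<lambda>x. fourier (u n) x - L2_fourier f x) \<le> L2_norm (\<lambda>x. u n x - f x)"
            using L2_fourier_diff_norm[OF Fu(2) f] by simp
          then have "sqrt (hs_square \<kappa>) * L2_norm (\<lambda>x. fourier (u n) x - L2_fourier f x)
             \<le> sqrt (hs_square \<kappa>) * L2_norm (\<lambda>x. u n x - f x)"
            using hs_square_nonneg[OF \<kappa>] by (intro mult_left_mono) auto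
          then show ?thesis using kernel_op_diff_norm[OF Fu(1)[of n] L2_fourier(1)[OF f]] by linarith
        qed
        then show "\<forall>\<^sub>F n in sequentially. L2_norm (\<lambda>x. kernel_op (kernel \<kappa>) (fourier (u n)) x - kernel_op (kernel \<kappa>) (L2_fourier f) x)
          \<le> sqrt (hs_square \<kappa>) * L2_norm (\<lambda>x. u n x - f x)" by simp
        show "(\<lambda>n. sqrt (hs_square \<kappa>) * L2_norm (\<lambda>x. u n x - f x)) \<longlonglongrightarrow> 0"
          by (rule tendsto_mult_right_zero[OF u(2)])
      qed auto
    qed
    ultimately show "L2_inner \<psi> (sandwiched \<kappa> V f) = L2_inner (fourier \<psi>) (kernel_op (kernel \<kappa>) (L2_fourier f))"
      using LIMSEQ_unique by (simp only: eq) blast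
  qed
qed

theorem hilbert_schmidt_sum:
  assumes \<kappa>: "\<kappa> > 0" and B: "L2_orthonormal_basis B"
  shows "((\<lambda>e. (L2_norm (sandwiched \<kappa> V e))\<^sup>2) has_sum hs_square \<kappa>) B"
proof -
  interpret square_integrable_kernel "kernel \<kappa>" "hs_square \<kappa>" by (rule kernel_square_integrable[OF \<kappa>])
  interpret multiplier V \<kappa> "sqrt (hs_square 1) + 1" by (rule V_multiplier[OF \<kappa>])
  have BL2: "e \<in> L2" if "e \<in> B" for e using B that by (auto simp: L2_orthonormal_basis_def)
  have "((\<lambda>e. (L2_norm (kernel_op (kernel \<kappa>) (L2_fourier e)))\<^sup>2) has_sum hs_square \<kappa>) B"
    by (rule kernel_op_hilbert_schmidt_sum)
       (auto intro: L2_orthonormal_bases_countable[OF B] L2_fourier(1) BL2 L2_fourier_Parseval[OF B])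
  moreover have "L2_norm (kernel_op (kernel \<kappa>) (L2_fourier e)) = L2_norm (sandwiched \<kappa> V e)" if "e \<in> B" for e
  proof -
    note e = BL2[OF that]
    have "L2_norm (L2_fourier (sandwiched \<kappa> V e)) = L2_norm (kernel_op (kernel \<kappa>) (L2_fourier e))"
      by (intro L2_norm_cong_AE L2_measurable_borel L2_fourier kernel_op_L2 sandwiched_represents(1)
          sandwiched_fourier[OF \<kappa>] e)
    then show ?thesis using L2_fourier_norm[OF sandwiched_represents(1)[OF e]] by simp
  qed
  ultimately show ?thesis by (simp cong: has_sum_cong)
qed

theorem sandwiched_hilbert_schmidt:
  assumes \<kappa>: "\<kappa> > 0"
  shows "hilbert_schmidt (sandwiched \<kappa> V)" "(hs_norm (sandwiched \<kappa> V))\<^sup>2 = hs_square \<kappa>"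
proof -
  interpret multiplier V \<kappa> "sqrt (hs_square 1) + 1" by (rule V_multiplier[OF \<kappa>])
  obtain B where "L2_orthonormal_basis B" using L2_orthonormal_basis_exists by blast
  then show "hilbert_schmidt (sandwiched \<kappa> V)"
    unfolding hilbert_schmidt_def
    using sandwiched_bounded_op hilbert_schmidt_sum[OF \<kappa>] by (auto simp: summable_on_def)
  have "L2_orthonormal_basis (SOME B. L2_orthonormal_basis B)"
    using L2_orthonormal_basis_exists by (rule someI_ex)
  from infsumI[OF hilbert_schmidt_sum[OF \<kappa> this]]
  show "(hs_norm (sandwiched \<kappa> V))\<^sup>2 = hs_square \<kappa>"
    using hs_square_nonneg[OF \<kappa>] by (simp add: hs_norm_def)
qed

lemma hs_square_fun_of_dist:
  assumes \<kappa>: "\<kappa> > 0"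
  shows "integrable lborel (\<lambda>\<xi>. (cmod (fun_of_dist (dist_fourier V) \<xi>))\<^sup>2 / (\<xi>\<^sup>2 + 4 * \<kappa>\<^sup>2))"
    "hs_square \<kappa> = 1 / \<kappa> * (LINT \<xi>|lborel. (cmod (fun_of_dist (dist_fourier V) \<xi>))\<^sup>2 / (\<xi>\<^sup>2 + 4 * \<kappa>\<^sup>2))"
proof -
  note V = fun_of_dist_AE[OF Vhat_is_fourier]
  have [measurable]: "fun_of_dist (dist_fourier V) \<in> borel_measurable borel"
    using V(2) by (simp add: is_function_def)
  have ae: "AE \<xi> in lborel. (cmod (Vhat \<xi>))\<^sup>2 / (\<xi>\<^sup>2 + 4 * \<kappa>\<^sup>2)
      = (cmod (fun_of_dist (dist_fourier V) \<xi>))\<^sup>2 / (\<xi>\<^sup>2 + 4 * \<kappa>\<^sup>2)"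
    using V(1) by eventually_elim simp
  show "integrable lborel (\<lambda>\<xi>. (cmod (fun_of_dist (dist_fourier V) \<xi>))\<^sup>2 / (\<xi>\<^sup>2 + 4 * \<kappa>\<^sup>2))"
    using integrable_cong_AE_imp[OF weighted_integrable[OF \<kappa>] _ ae] by simp
  have "(LINT \<xi>|lborel. (cmod (Vhat \<xi>))\<^sup>2 / (\<xi>\<^sup>2 + 4 * \<kappa>\<^sup>2))
    = (LINT \<xi>|lborel. (cmod (fun_of_dist (dist_fourier V) \<xi>))\<^sup>2 / (\<xi>\<^sup>2 + 4 * \<kappa>\<^sup>2))"
    by (rule integral_cong_AE[OF _ _ ae]) measurable
  then show "hs_square \<kappa> = 1 / \<kappa> * (LINT \<xi>|lborel. (cmod (fun_of_dist (dist_fourier V) \<xi>))\<^sup>2 / (\<xi>\<^sup>2 + 4 * \<kappa>\<^sup>2))"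
    by (simp add: hs_square_def)
qed

text \<open>
  The weighted integral is decreasing in \<open>\<kappa>\<close>, so the prefactor \<open>1/\<kappa>\<close> alone forces convergence.
\<close>

theorem hs_norm_tendsto_zero: "((\<lambda>\<kappa>. hs_norm (sandwiched \<kappa> V)) \<longlongrightarrow> 0) at_top"
proof -
  have le: "hs_norm (sandwiched \<kappa> V) \<le> sqrt (hs_square 1 / \<kappa>)" if \<kappa>: "\<kappa> \<ge> 1" for \<kappa>
  proof (rule real_le_rsqrt)
    have "(LINT \<zeta>|lborel. (cmod (Vhat \<zeta>))\<^sup>2 / (\<zeta>\<^sup>2 + 4 * \<kappa>\<^sup>2)) \<le> (LINT \<zeta>|lborel. (cmod (Vhat \<zeta>))\<^sup>2 / (\<zeta>\<^sup>2 + 4 * 1\<^sup>2))"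
    proof (rule integral_mono)
      fix \<zeta> :: real
      have "1\<^sup>2 \<le> \<kappa>\<^sup>2" using \<kappa> by (intro power_mono) auto
      moreover have "0 < \<zeta>\<^sup>2 + 4 * 1\<^sup>2" by (simp add: add_nonneg_pos)
      ultimately show "(cmod (Vhat \<zeta>))\<^sup>2 / (\<zeta>\<^sup>2 + 4 * \<kappa>\<^sup>2) \<le> (cmod (Vhat \<zeta>))\<^sup>2 / (\<zeta>\<^sup>2 + 4 * 1\<^sup>2)"
        by (intro divide_left_mono mult_pos_pos) auto
    qed (use \<kappa> weighted_integrable[of 1] weighted_integrable[of \<kappa>] in auto)
    then show "(hs_norm (sandwiched \<kappa> V))\<^sup>2 \<le> hs_square 1 / \<kappa>"
      using \<kappa> by (simp add: sandwiched_hilbert_schmidt(2) hs_square_def divide_right_mono)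
  qed
  have nonneg: "0 \<le> hs_norm (sandwiched \<kappa> V)" for \<kappa>
    unfolding hs_norm_def by (intro real_sqrt_ge_zero infsum_nonneg) simp
  show ?thesis
  proof (rule tendsto_sandwich[of "\<lambda>_. 0"])
    show "\<forall>\<^sub>F \<kappa> in at_top. hs_norm (sandwiched \<kappa> V) \<le> sqrt (hs_square 1 / \<kappa>)"
      using eventually_ge_at_top[of 1] by eventually_elim (rule le)
    have "((\<lambda>\<kappa>. hs_square 1 / \<kappa>) \<longlongrightarrow> 0) at_top"
      by (intro tendsto_divide_0[OF tendsto_const] filterlim_at_top_imp_at_infinity filterlim_ident)
    then show "((\<lambda>\<kappa>. sqrt (hs_square 1 / \<kappa>)) \<longlongrightarrow> 0) at_top"
      using tendsto_real_sqrt by fastforce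
  qed (use nonneg in auto)
qed

end

section \<open>Gaussian damping\<close>

definition gauss :: "real \<Rightarrow> real \<Rightarrow> complex" where
  "gauss \<epsilon> x = of_real (exp (- (\<epsilon> * x)\<^sup>2 / 2))"

definition gauss_hat :: "real \<Rightarrow> real \<Rightarrow> real" where
  "gauss_hat \<epsilon> t = exp (- (t / \<epsilon>)\<^sup>2 / 2) / \<epsilon>"

text \<open>
  A bound, uniform in \<open>\<epsilon> \<le> 1\<close>, for the integral of \<open>(1 + |t|)\<close> against the transform of \<open>gauss \<epsilon>\<close>.
\<close>

definition gauss_mass :: real where
  "gauss_mass = sqrt (2 * pi) * (LINT s|lborel. std_normal_density s * (1 + \<bar>s\<bar>))"

lemma gauss_schwartz: "\<epsilon> > 0 \<Longrightarrow> gauss \<epsilon> \<in> schwartz"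
  using schwartz_poly_gaussian[of "\<epsilon>\<^sup>2 / 2" 1] by (simp add: gauss_def[abs_def] power_mult_distrib)

lemma cnj_gauss[simp]: "cnj (gauss \<epsilon> x) = gauss \<epsilon> x"
  by (simp add: gauss_def)

lemma gauss_hat_measurable[measurable]: "gauss_hat \<epsilon> \<in> borel_measurable borel"
  unfolding gauss_hat_def by measurable

lemma gauss_hat_nonneg: "\<epsilon> > 0 \<Longrightarrow> gauss_hat \<epsilon> t \<ge> 0"
  by (simp add: gauss_hat_def)

lemma fourier_gauss:
  assumes \<epsilon>: "\<epsilon> > 0" shows "fourier (gauss \<epsilon>) \<xi> = of_real (gauss_hat \<epsilon> \<xi>)"
proof -
  have e: "exp (- s\<^sup>2 / 2) = sqrt (2 * pi) * std_normal_density s" for s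
    by (simp add: std_normal_density_def)
  have "(LINT x|lborel. exp (- \<i> * complex_of_real (\<xi> * x)) * gauss \<epsilon> x)
    = (1 / \<epsilon>) *\<^sub>R (LINT s|lborel. of_real (sqrt (2 * pi)) * (exp (\<i> * complex_of_real (- \<xi> / \<epsilon> * s)) * of_real (std_normal_density s)))"
    using \<epsilon> e by (subst lborel_integral_real_affine[of "1 / \<epsilon>" _ 0]) (simp_all add: gauss_def mult_ac)
  also have "\<dots> = of_real (1 / \<epsilon> * (sqrt (2 * pi) * exp (- (- \<xi> / \<epsilon>)\<^sup>2 / 2)))"
    by (simp only: integral_mult_right_zero std_normal_fourier scaleR_conv_of_real) (simp only: of_real_mult)
  also have "(- \<xi> / \<epsilon>)\<^sup>2 = (\<xi> / \<epsilon>)\<^sup>2" by (simp add: power2_eq_square)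
  finally show ?thesis by (simp add: fourier_def fconst_eq[simplified] gauss_hat_def)
qed

lemma gauss_mass_nonneg: "gauss_mass \<ge> 0"
  unfolding gauss_mass_def by (intro mult_nonneg_nonneg integral_nonneg_AE AE_I2) auto

lemma gauss_hat_mass:
  assumes \<epsilon>: "\<epsilon> > 0" "\<epsilon> \<le> 1"
  shows "(\<integral>\<^sup>+t. ennreal ((1 + \<bar>t\<bar>) * gauss_hat \<epsilon> t) \<partial>lborel) \<le> ennreal gauss_mass"
proof -
  have "(\<integral>\<^sup>+t. ennreal ((1 + \<bar>t\<bar>) * gauss_hat \<epsilon> t) \<partial>lborel)
    = ennreal \<bar>\<epsilon>\<bar> * (\<integral>\<^sup>+s. ennreal ((1 + \<bar>0 + \<epsilon> * s\<bar>) * gauss_hat \<epsilon> (0 + \<epsilon> * s)) \<partial>lborel)"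
    using \<epsilon> by (intro nn_integral_real_affine) auto
  also have "\<dots> = (\<integral>\<^sup>+s. ennreal (\<epsilon> * ((1 + \<bar>0 + \<epsilon> * s\<bar>) * gauss_hat \<epsilon> (0 + \<epsilon> * s))) \<partial>lborel)"
    using \<epsilon> by (subst nn_integral_cmult[symmetric]) (auto simp: ennreal_mult'[symmetric] abs_of_pos)
  also have "\<dots> \<le> (\<integral>\<^sup>+s. ennreal (sqrt (2 * pi) * (std_normal_density s * (1 + \<bar>s\<bar>))) \<partial>lborel)"
  proof (intro nn_integral_mono ennreal_leI)
    fix s :: real
    have "\<epsilon> * ((1 + \<bar>0 + \<epsilon> * s\<bar>) * gauss_hat \<epsilon> (0 + \<epsilon> * s)) = (1 + \<epsilon> * \<bar>s\<bar>) * exp (- s\<^sup>2 / 2)"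
      using \<epsilon> by (simp add: gauss_hat_def abs_mult)
    also have "\<dots> \<le> (1 + 1 * \<bar>s\<bar>) * exp (- s\<^sup>2 / 2)"
      using \<epsilon> by (intro mult_right_mono add_left_mono) auto
    also have "\<dots> = sqrt (2 * pi) * (std_normal_density s * (1 + \<bar>s\<bar>))"
      by (simp add: std_normal_density_def)
    finally show "\<epsilon> * ((1 + \<bar>0 + \<epsilon> * s\<bar>) * gauss_hat \<epsilon> (0 + \<epsilon> * s)) \<le> sqrt (2 * pi) * (std_normal_density s * (1 + \<bar>s\<bar>))" .
  qed
  also have "\<dots> = ennreal (LINT s|lborel. sqrt (2 * pi) * (std_normal_density s * (1 + \<bar>s\<bar>)))"
  proof (rule nn_integral_eq_integral)
    have "integrable lborel (\<lambda>s. std_normal_density s + std_normal_density s * \<bar>s\<bar>)"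
      using integrable_std_normal_moment_abs[of 1] by simp
    from integrable_mult_right[OF this, of "sqrt (2 * pi)"]
    show "integrable lborel (\<lambda>s. sqrt (2 * pi) * (std_normal_density s * (1 + \<bar>s\<bar>)))"
      by (simp add: distrib_left)
  qed auto
  also have "\<dots> = ennreal gauss_mass"
    by (simp only: gauss_mass_def integral_mult_right_zero)
  finally show ?thesis .
qed

text \<open>
  Peetre's inequality: it lets Sobolev weights be moved across a convolution at the cost of a factor that the
  Gaussian absorbs.
\<close>

lemma bracket_Peetre: "bracket \<eta> \<le> bracket h * (1 + \<bar>\<eta> - h\<bar>)"
proof -
  have "bracket \<eta> \<le> bracket h + \<bar>\<eta> - h\<bar>"
    using real_sqrt_sum_squares_triangle_ineq[of 1 0 h "\<eta> - h"] by (simp add: bracket_def)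
  also have "\<dots> \<le> bracket h + bracket h * \<bar>\<eta> - h\<bar>"
    using mult_right_mono[OF bracket_ge_1[of h], of "\<bar>\<eta> - h\<bar>"] by simp
  finally show ?thesis by (simp add: distrib_left)
qed

lemma vderiv_power_add:
  "f \<in> schwartz \<Longrightarrow> g \<in> schwartz \<Longrightarrow>
    (vderiv ^^ k) (\<lambda>x. f x + g x) = (\<lambda>x. (vderiv ^^ k) f x + (vderiv ^^ k) g x)"
proof (induction k arbitrary: f g)
  case (Suc k)
  have "vderiv (\<lambda>x. f x + g x) = (\<lambda>x. vderiv f x + vderiv g x)"
    unfolding vderiv_def[of "\<lambda>x. f x + g x"]
    by (rule ext, rule vector_derivative_at) (intro has_vector_derivative_add schwartz_has_vector_derivative Suc.prems)
  then show ?case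
    using Suc by (simp add: funpow_Suc_right schwartz_vderiv del: funpow.simps)
qed simp

lemma vderiv_power_scale:
  "f \<in> schwartz \<Longrightarrow> (vderiv ^^ k) (\<lambda>x. c * f x) = (\<lambda>x. c * (vderiv ^^ k) f x)"
proof (induction k arbitrary: f)
  case (Suc k)
  have "vderiv (\<lambda>x. c * f x) = (\<lambda>x. c * vderiv f x)"
    unfolding vderiv_def[of "\<lambda>x. c * f x"]
    by (rule ext, rule vector_derivative_at) (intro has_vector_derivative_mult_right schwartz_has_vector_derivative Suc.prems)
  then show ?case
    using Suc by (simp add: funpow_Suc_right schwartz_vderiv del: funpow.simps)
qed simp

lemma schwartz_vderiv_power: "f \<in> schwartz \<Longrightarrow> (vderiv ^^ k) f \<in> schwartz"
  by (induction k) (auto intro: schwartz_vderiv)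

text \<open>
  Induction on the order of the derivative, for all Schwartz functions simultaneously. Write \<open>d \<theta> = (g - 1) \<theta>\<close>
  with \<open>g = gauss \<epsilon>\<close>. Since \<open>g' = -\<epsilon>\<^sup>2 x g\<close>, the derivative of \<open>d \<theta>\<close> is \<open>d \<theta>' - \<epsilon>\<^sup>2 (d (x\<theta>) + x\<theta>)\<close>, which again consists of
  damped Schwartz functions and a term of order \<open>\<epsilon>\<^sup>2\<close>. The base case is \<open>|g - 1| \<le> \<epsilon>\<^sup>2x\<^sup>2/2\<close>.
\<close>

lemma gauss_damping_bound:
  assumes "\<theta> \<in> schwartz"
  shows "\<exists>C. \<forall>\<epsilon>\<in>{0<..1}. \<forall>x. cmod (x ^ j *\<^sub>R (vderiv ^^ k) (\<lambda>x. gauss \<epsilon> x * \<theta> x - \<theta> x) x) \<le> C * \<epsilon>\<^sup>2"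
  using assms
proof (induction k arbitrary: \<theta>)
  case 0
  obtain C where C: "\<And>x. cmod (x ^ (j + 2) *\<^sub>R \<theta> x) \<le> C"
    using schwartz_rapid[OF 0] unfolding rapid_iff by (meson bounded_iff rangeI)
  have "cmod (x ^ j *\<^sub>R (gauss \<epsilon> x * \<theta> x - \<theta> x)) \<le> C * \<epsilon>\<^sup>2" for \<epsilon> x
  proof -
    define y where "y = (\<epsilon> * x)\<^sup>2 / 2"
    have y: "y \<ge> 0" by (simp add: y_def)
    have "1 - exp (- y) \<le> y" using exp_ge_add_one_self[of "- y"] by simp
    then have le: "\<bar>exp (- y) - 1\<bar> \<le> y" using y by simp
    have "gauss \<epsilon> x * \<theta> x - \<theta> x = of_real (exp (- y) - 1) * \<theta> x" by (simp add: gauss_def y_def left_diff_distrib)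
    then have "cmod (x ^ j *\<^sub>R (gauss \<epsilon> x * \<theta> x - \<theta> x)) = \<bar>x\<bar> ^ j * (\<bar>exp (- y) - 1\<bar> * cmod (\<theta> x))"
      by (simp only: norm_scaleR norm_mult norm_of_real power_abs)
    also have "\<dots> \<le> \<bar>x\<bar> ^ j * (y * cmod (\<theta> x))"
      by (intro mult_left_mono mult_right_mono le) auto
    also have "\<dots> = \<epsilon>\<^sup>2 / 2 * cmod (x ^ (j + 2) *\<^sub>R \<theta> x)"
      by (simp add: y_def power_mult_distrib power_add power_abs abs_mult power2_eq_square)
    also have "\<dots> \<le> \<epsilon>\<^sup>2 / 2 * C" by (intro mult_left_mono C) simp
    also have "\<dots> \<le> C * \<epsilon>\<^sup>2" using C[of 0] norm_ge_zero[of "0 ^ (j + 2) *\<^sub>R \<theta> 0"] by (simp del: norm_ge_zero)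
    finally show ?thesis .
  qed
  then show ?case by auto
next
  case (Suc k)
  define d where "d \<epsilon> \<theta> = (\<lambda>x. gauss \<epsilon> x * \<theta> x - \<theta> x)" for \<epsilon> and \<theta> :: "real \<Rightarrow> complex"
  note \<theta> = Suc.prems
  let ?x\<theta> = "\<lambda>x. of_real x * \<theta> x"
  have x\<theta>: "?x\<theta> \<in> schwartz" by (rule schwartz_times_x[OF \<theta>])
  obtain C1 where C1: "\<And>\<epsilon> x. \<epsilon> \<in> {0<..1} \<Longrightarrow> cmod (x ^ j *\<^sub>R (vderiv ^^ k) (d \<epsilon> (vderiv \<theta>)) x) \<le> C1 * \<epsilon>\<^sup>2"
    using Suc.IH[OF schwartz_vderiv[OF \<theta>]] unfolding d_def by blast
  obtain C2 where C2: "\<And>\<epsilon> x. \<epsilon> \<in> {0<..1} \<Longrightarrow> cmod (x ^ j *\<^sub>R (vderiv ^^ k) (d \<epsilon> ?x\<theta>) x) \<le> C2 * \<epsilon>\<^sup>2"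
    using Suc.IH[OF x\<theta>] unfolding d_def by blast
  obtain C3 where C3: "\<And>x. cmod (x ^ j *\<^sub>R (vderiv ^^ k) ?x\<theta> x) \<le> C3"
    using schwartz_rapid[OF schwartz_vderiv_power[OF x\<theta>, of k]] unfolding rapid_iff by (meson bounded_iff rangeI)
  have "cmod (x ^ j *\<^sub>R (vderiv ^^ Suc k) (d \<epsilon> \<theta>) x) \<le> (C1 + C2 + C3) * \<epsilon>\<^sup>2" if \<epsilon>: "\<epsilon> \<in> {0<..1}" for \<epsilon> x
  proof -
    have dS: "d \<epsilon> f \<in> schwartz" if "f \<in> schwartz" for f
      unfolding d_def using \<epsilon> that by (intro schwartz_diff schwartz_mult gauss_schwartz) auto
    have "vderiv (d \<epsilon> \<theta>) x = d \<epsilon> (vderiv \<theta>) x + (- (of_real \<epsilon>)\<^sup>2) * (d \<epsilon> ?x\<theta> x + ?x\<theta> x)" for x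
    proof -
      have "((\<lambda>x. exp (- (\<epsilon> * x)\<^sup>2 / 2)) has_real_derivative - \<epsilon>\<^sup>2 * x * exp (- (\<epsilon> * x)\<^sup>2 / 2)) (at x)"
        by (auto intro!: derivative_eq_intros simp: power2_eq_square)
      then have g: "(gauss \<epsilon> has_vector_derivative of_real (- \<epsilon>\<^sup>2 * x * exp (- (\<epsilon> * x)\<^sup>2 / 2))) (at x)"
        unfolding gauss_def[abs_def]
        by (intro has_vector_derivative_of_real) (simp only: has_real_derivative_iff_has_vector_derivative)
      have "(d \<epsilon> \<theta> has_vector_derivative
          (gauss \<epsilon> x * vderiv \<theta> x + of_real (- \<epsilon>\<^sup>2 * x * exp (- (\<epsilon> * x)\<^sup>2 / 2)) * \<theta> x) - vderiv \<theta> x) (at x)"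
        unfolding d_def by (intro has_vector_derivative_diff has_vector_derivative_mult g schwartz_has_vector_derivative[OF \<theta>])
      then show ?thesis
        by (simp add: vderiv_def[of "d \<epsilon> \<theta>"] vector_derivative_at) (simp add: d_def gauss_def algebra_simps)
    qed
    then have "vderiv (d \<epsilon> \<theta>) = (\<lambda>x. d \<epsilon> (vderiv \<theta>) x + (- (of_real \<epsilon>)\<^sup>2) * (d \<epsilon> ?x\<theta> x + ?x\<theta> x))"
      by (rule ext)
    then have "(vderiv ^^ Suc k) (d \<epsilon> \<theta>) = (vderiv ^^ k) (\<lambda>x. d \<epsilon> (vderiv \<theta>) x + (- (of_real \<epsilon>)\<^sup>2) * (d \<epsilon> ?x\<theta> x + ?x\<theta> x))"
      by (simp only: funpow_Suc_right comp_apply)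
    also have "\<dots> = (\<lambda>x. (vderiv ^^ k) (d \<epsilon> (vderiv \<theta>)) x
        + (- (of_real \<epsilon>)\<^sup>2) * ((vderiv ^^ k) (d \<epsilon> ?x\<theta>) x + (vderiv ^^ k) ?x\<theta> x))"
      by (simp only: vderiv_power_add vderiv_power_scale dS[OF schwartz_vderiv[OF \<theta>]]
          schwartz_scale schwartz_add dS[OF x\<theta>] x\<theta>)
    finally have eq: "x ^ j *\<^sub>R (vderiv ^^ Suc k) (d \<epsilon> \<theta>) x = x ^ j *\<^sub>R (vderiv ^^ k) (d \<epsilon> (vderiv \<theta>)) x
        + (- (of_real \<epsilon>)\<^sup>2) * (x ^ j *\<^sub>R (vderiv ^^ k) (d \<epsilon> ?x\<theta>) x + x ^ j *\<^sub>R (vderiv ^^ k) ?x\<theta> x)"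
      by (simp add: scaleR_conv_of_real algebra_simps)
    have "cmod (x ^ j *\<^sub>R (vderiv ^^ Suc k) (d \<epsilon> \<theta>) x) \<le> C1 * \<epsilon>\<^sup>2 + \<epsilon>\<^sup>2 * (C2 * \<epsilon>\<^sup>2 + C3)"
      unfolding eq
    proof (rule norm_triangle_le, rule add_mono[OF C1[OF \<epsilon>]])
      have "cmod (x ^ j *\<^sub>R (vderiv ^^ k) (d \<epsilon> ?x\<theta>) x + x ^ j *\<^sub>R (vderiv ^^ k) ?x\<theta> x) \<le> C2 * \<epsilon>\<^sup>2 + C3"
        by (rule norm_triangle_le, rule add_mono[OF C2[OF \<epsilon>] C3])
      then show "cmod (- (of_real \<epsilon>)\<^sup>2 * (x ^ j *\<^sub>R (vderiv ^^ k) (d \<epsilon> ?x\<theta>) x + x ^ j *\<^sub>R (vderiv ^^ k) ?x\<theta> x)) \<le> \<epsilon>\<^sup>2 * (C2 * \<epsilon>\<^sup>2 + C3)"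
        by (simp add: norm_mult norm_power mult_left_mono)
    qed
    also have "\<epsilon>\<^sup>2 * (C2 * \<epsilon>\<^sup>2 + C3) \<le> \<epsilon>\<^sup>2 * (C2 + C3)"
    proof -
      have "0 \<le> C2 * \<epsilon>\<^sup>2" by (rule order.trans[OF norm_ge_zero C2[OF \<epsilon>, of 0]])
      then have "0 \<le> C2" using \<epsilon> by (simp add: zero_le_mult_iff)
      moreover have "\<epsilon>\<^sup>2 \<le> 1" using \<epsilon> by (simp add: power_le_one)
      ultimately have "C2 * \<epsilon>\<^sup>2 \<le> C2" by (simp add: mult_left_le)
      then show ?thesis by (intro mult_left_mono) auto
    qed
    finally show ?thesis by (simp add: algebra_simps)
  qed
  then show ?case unfolding d_def by blast
qed

lemma tempered_gauss_damping:
  assumes V: "V \<in> tempered" and \<theta>: "\<theta> \<in> schwartz"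
  shows "(\<lambda>n. V (\<lambda>x. gauss (1 / real (Suc n)) x * \<theta> x)) \<longlonglongrightarrow> V \<theta>"
proof -
  have "\<exists>C N. \<forall>\<phi>\<in>schwartz. cmod (V \<phi>) \<le> C * (\<Sum>j\<le>N. \<Sum>k\<le>N. schwartz_seminorm j k \<phi>)"
    using V by (simp add: tempered_def)
  then obtain C N where CN: "\<And>\<phi>. \<phi> \<in> schwartz \<Longrightarrow> cmod (V \<phi>) \<le> C * (\<Sum>j\<le>N. \<Sum>k\<le>N. schwartz_seminorm j k \<phi>)" by blast
  define d where "d \<epsilon> = (\<lambda>x. gauss \<epsilon> x * \<theta> x - \<theta> x)" for \<epsilon>
  have "\<forall>j k. \<exists>c. \<forall>\<epsilon>\<in>{0<..1}. \<forall>x. cmod (x ^ j *\<^sub>R (vderiv ^^ k) (d \<epsilon>) x) \<le> c * \<epsilon>\<^sup>2"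
    using gauss_damping_bound[OF \<theta>] by (auto simp: d_def)
  then obtain c where c: "\<And>j k \<epsilon> x. \<epsilon> \<in> {0<..1} \<Longrightarrow> cmod (x ^ j *\<^sub>R (vderiv ^^ k) (d \<epsilon>) x) \<le> c j k * \<epsilon>\<^sup>2" by metis
  have seminorm: "schwartz_seminorm j k (d \<epsilon>) \<le> c j k * \<epsilon>\<^sup>2" if "\<epsilon> \<in> {0<..1}" for j k \<epsilon>
    unfolding schwartz_seminorm_def by (rule cSUP_least) (use c that in auto)
  define D where "D = \<bar>C\<bar> * (\<Sum>j\<le>N. \<Sum>k\<le>N. c j k)"
  have V_le: "cmod (V (\<lambda>x. gauss \<epsilon> x * \<theta> x) - V \<theta>) \<le> D * \<epsilon>\<^sup>2" if \<epsilon>: "\<epsilon> \<in> {0<..1}" for \<epsilon>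
  proof -
    have g\<theta>: "(\<lambda>x. gauss \<epsilon> x * \<theta> x) \<in> schwartz" using \<epsilon> \<theta> by (intro schwartz_mult gauss_schwartz) auto
    then have dS: "d \<epsilon> \<in> schwartz" unfolding d_def by (intro schwartz_diff \<theta>)
    have "V (\<lambda>x. d \<epsilon> x + \<theta> x) = V (d \<epsilon>) + V \<theta>"
      using V dS \<theta> by (auto simp: tempered_def)
    then have "V (\<lambda>x. gauss \<epsilon> x * \<theta> x) - V \<theta> = V (d \<epsilon>)" by (simp add: d_def)
    moreover have "cmod (V (d \<epsilon>)) \<le> \<bar>C\<bar> * (\<Sum>j\<le>N. \<Sum>k\<le>N. c j k * \<epsilon>\<^sup>2)"
    proof -
      have nonneg: "0 \<le> schwartz_seminorm j k (d \<epsilon>)" for j k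
      proof -
        have "norm (0 ^ j *\<^sub>R (vderiv ^^ k) (d \<epsilon>) 0) \<le> schwartz_seminorm j k (d \<epsilon>)"
          unfolding schwartz_seminorm_def
          by (rule cSUP_upper) (use c[OF \<epsilon>] in \<open>auto intro!: bdd_aboveI2\<close>)
        then show ?thesis using norm_ge_zero order.trans by blast
      qed
      have "cmod (V (d \<epsilon>)) \<le> C * (\<Sum>j\<le>N. \<Sum>k\<le>N. schwartz_seminorm j k (d \<epsilon>))" by (rule CN[OF dS])
      also have "\<dots> \<le> \<bar>C\<bar> * (\<Sum>j\<le>N. \<Sum>k\<le>N. schwartz_seminorm j k (d \<epsilon>))"
        by (intro mult_right_mono sum_nonneg nonneg) auto
      also have "\<dots> \<le> \<bar>C\<bar> * (\<Sum>j\<le>N. \<Sum>k\<le>N. c j k * \<epsilon>\<^sup>2)"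
        by (intro mult_left_mono sum_mono seminorm \<epsilon>) auto
      finally show ?thesis .
    qed
    ultimately show ?thesis by (simp add: D_def sum_distrib_right mult.assoc)
  qed
  have "(\<lambda>n. V (\<lambda>x. gauss (1 / real (Suc n)) x * \<theta> x) - V \<theta>) \<longlonglongrightarrow> 0"
  proof (rule Lim_null_comparison)
    show "\<forall>\<^sub>F n in sequentially. norm (V (\<lambda>x. gauss (1 / real (Suc n)) x * \<theta> x) - V \<theta>) \<le> D * (1 / real (Suc n))\<^sup>2"
      by (intro always_eventually allI V_le) simp
    have "(\<lambda>n. D * (1 / real (Suc n))\<^sup>2) \<longlonglongrightarrow> D * 0\<^sup>2"
      by (intro tendsto_intros LIMSEQ_Suc[OF lim_1_over_n])
    then show "(\<lambda>n. D * (1 / real (Suc n))\<^sup>2) \<longlonglongrightarrow> 0" by simp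
  qed
  then show ?thesis by (simp add: LIM_zero_iff)
qed

section \<open>Hilbert--Schmidt multipliers lie in \<open>H\<^sup>-\<^sup>1\<close>\<close>

lemma L2_translate:
  assumes "f \<in> L2" shows "(\<lambda>x. f (x - h)) \<in> L2"
proof (rule L2I)
  have [measurable]: "f \<in> borel_measurable borel" using assms by auto
  show "(\<lambda>x. f (x - h)) \<in> borel_measurable lborel" by measurable
  show "integrable lborel (\<lambda>x. (cmod (f (x - h)))\<^sup>2)"
    using lborel_integrable_real_affine[OF L2_integrable[OF assms], of 1 "- h"] by simp
qed

lemma L2_bounded_op_sum:
  assumes A: "L2_bounded_op A" and "finite F" "F \<subseteq> L2"
  shows "AE x in lborel. A (\<lambda>y. \<Sum>e\<in>F. c e * e y) x = (\<Sum>e\<in>F. c e * A e x)"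
  using assms(2,3)
proof (induction F rule: finite_induct)
  case empty
  show ?case using L2_bounded_op_scale[OF A L2_zero, of 0] by simp
next
  case (insert e F)
  have L2: "(\<lambda>y. c e * e y) \<in> L2" "(\<lambda>y. \<Sum>e\<in>F. c e * e y) \<in> L2"
    using insert by (auto intro!: L2_scale L2_sum)
  have "AE x in lborel. A (\<lambda>y. \<Sum>e\<in>F. c e * e y) x = (\<Sum>e\<in>F. c e * A e x)"
    using insert by auto
  moreover have "AE x in lborel. A (\<lambda>y. c e * e y) x = c e * A e x"
    using insert by (intro L2_bounded_op_scale[OF A]) auto
  ultimately show ?case
    using L2_bounded_op_add[OF A L2]
    by eventually_elim (use insert in simp)
qed

locale damped_multiplier = multiplier V 1 C for V :: dist and C :: real +
  fixes \<epsilon> :: real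
  assumes \<epsilon>: "0 < \<epsilon>" "\<epsilon> \<le> 1"
begin

abbreviation "gh \<equiv> gauss_hat \<epsilon>"

text \<open>
  Since \<open>gauss \<epsilon>\<close> lies in \<open>H\<^sup>1\<close>, the form bound shows that \<open>gauss \<epsilon> \<cdot> V\<close> is a functional on \<open>H\<^sup>1\<close>. The function \<open>G\<close> is
  its Fourier transform divided by the weight.
\<close>

lemma damped_density_exists:
  "\<exists>G. G \<in> L2 \<and> (\<forall>a\<in>schwartz. V (\<lambda>x. gauss \<epsilon> x * a x) = L2_inner (\<lambda>\<xi>. of_real (bracket \<xi>) * fourier a \<xi>) G)"
proof -
  have g: "gauss \<epsilon> \<in> schwartz" by (rule gauss_schwartz[OF \<epsilon>(1)])
  obtain G0 where G0: "G0 \<in> L2" "\<And>\<psi>. \<psi> \<in> schwartz \<Longrightarrow> form (gauss \<epsilon>) (R \<psi>) = L2_inner \<psi> G0"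
  proof (rule L2_Riesz[OF L2_subspace_schwartz, of "\<lambda>\<psi>. form (gauss \<epsilon>) (R \<psi>)" "C * (1 + 1 / 1) * h1_norm (gauss \<epsilon>)"])
    show "form (gauss \<epsilon>) (R (\<lambda>x. \<phi> x + \<psi> x)) = form (gauss \<epsilon>) (R \<phi>) + form (gauss \<epsilon>) (R \<psi>)"
      if "\<phi> \<in> schwartz" "\<psi> \<in> schwartz" for \<phi> \<psi>
      using that g by (simp add: root_op_add \<kappa> form_add_right root_op_schwartz)
    show "form (gauss \<epsilon>) (R (\<lambda>x. c * \<psi> x)) = cnj c * form (gauss \<epsilon>) (R \<psi>)" if "\<psi> \<in> schwartz" for c \<psi>
      using that g by (simp add: root_op_scale \<kappa> form_scale_right root_op_schwartz)
    show "cmod (form (gauss \<epsilon>) (R \<psi>)) \<le> C * (1 + 1 / 1) * h1_norm (gauss \<epsilon>) * L2_norm \<psi>" if \<psi>: "\<psi> \<in> schwartz" for \<psi>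
    proof -
      have "cmod (form (gauss \<epsilon>) (R \<psi>)) \<le> C * h1_norm (R \<psi>) * h1_norm (gauss \<epsilon>)"
        by (intro form_bound g root_op_schwartz \<psi> \<kappa>)
      also have "\<dots> \<le> C * ((1 + 1 / 1) * L2_norm \<psi>) * h1_norm (gauss \<epsilon>)"
        using C by (intro mult_left_mono mult_right_mono root_op_norm \<psi> \<kappa> h1_norm_nonneg) auto
      finally show ?thesis by (simp add: mult_ac)
    qed
  qed (use that in blast)
  have "V (\<lambda>x. gauss \<epsilon> x * a x) = L2_inner (\<lambda>\<xi>. of_real (bracket \<xi>) * fourier a \<xi>) (L2_fourier G0)" if a: "a \<in> schwartz" for a
  proof -
    define \<psi> where "\<psi> = inv_fourier (\<lambda>\<xi>. of_real (bracket \<xi>) * fourier a \<xi>)"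
    have ba: "(\<lambda>\<xi>. of_real (bracket \<xi>) * fourier a \<xi>) \<in> schwartz"
      by (intro schwartz_mult_slow[OF slow_bracket] schwartz_fourier a)
    have \<psi>: "\<psi> \<in> schwartz" unfolding \<psi>_def by (rule schwartz_inv_fourier[OF ba])
    have F\<psi>: "fourier \<psi> = (\<lambda>\<xi>. of_real (bracket \<xi>) * fourier a \<xi>)" unfolding \<psi>_def by (rule fourier_inv_fourier[OF ba])
    have "R \<psi> = inv_fourier (fourier a)"
      unfolding root_op_def F\<psi> by (simp add: root_symbol_one)
    then have "R \<psi> = a" by (simp add: inv_fourier_fourier a)
    then have "V (\<lambda>x. gauss \<epsilon> x * a x) = form (gauss \<epsilon>) (R \<psi>)" by (simp add: form_def)
    also have "\<dots> = L2_inner (fourier \<psi>) (L2_fourier G0)"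
      using G0 \<psi> by (simp add: L2_fourier_test)
    finally show ?thesis by (simp only: F\<psi>)
  qed
  then show ?thesis using L2_fourier(1)[OF G0(1)] by blast
qed

definition density :: "real \<Rightarrow> complex" where
  "density = (SOME G. G \<in> L2 \<and> (\<forall>a\<in>schwartz. V (\<lambda>x. gauss \<epsilon> x * a x) = L2_inner (\<lambda>\<xi>. of_real (bracket \<xi>) * fourier a \<xi>) G))"

lemma density:
  "density \<in> L2"
  "a \<in> schwartz \<Longrightarrow> V (\<lambda>x. gauss \<epsilon> x * a x) = L2_inner (\<lambda>\<xi>. of_real (bracket \<xi>) * fourier a \<xi>) density"
  using someI_ex[OF damped_density_exists, folded density_def] by auto

text \<open>
  The Fourier transform of \<open>gauss \<epsilon> \<cdot> V\<close>. It is a function, in contrast to the transform of \<open>V\<close>.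
\<close>

definition What :: "real \<Rightarrow> complex" where
  "What \<xi> = of_real (bracket \<xi>) * density \<xi>"

lemma What_measurable[measurable]: "What \<in> borel_measurable borel"
proof -
  have [measurable]: "density \<in> borel_measurable borel" using density(1) by auto
  show ?thesis unfolding What_def by measurable
qed

text \<open>
  Chosen such that the root of the resolvent maps \<open>packet h\<close> to the modulated Gaussian \<open>e\<^sup>i\<^sup>h\<^sup>x g\<^sub>\<epsilon>(x)\<close>
  (\<open>root_op_packet\<close>).
\<close>

definition packet :: "real \<Rightarrow> real \<Rightarrow> complex" where
  "packet h = inv_fourier (\<lambda>\<eta>. of_real (bracket \<eta>) * of_real (gh (\<eta> - h)))"

lemma modulated_gauss:
  shows "(\<lambda>x. exp (\<i> * complex_of_real (h * x)) * gauss \<epsilon> x) \<in> schwartz"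
    "fourier (\<lambda>x. exp (\<i> * complex_of_real (h * x)) * gauss \<epsilon> x) = (\<lambda>\<eta>. of_real (gh (\<eta> - h)))"
proof -
  show "(\<lambda>x. exp (\<i> * complex_of_real (h * x)) * gauss \<epsilon> x) \<in> schwartz"
    by (rule schwartz_mult_slow[OF slow_exp_i gauss_schwartz[OF \<epsilon>(1)]])
  show "fourier (\<lambda>x. exp (\<i> * complex_of_real (h * x)) * gauss \<epsilon> x) = (\<lambda>\<eta>. of_real (gh (\<eta> - h)))"
    by (rule ext) (simp only: fourier_modulated fourier_gauss[OF \<epsilon>(1)])
qed

lemma packet_fourier_schwartz: "(\<lambda>\<eta>. of_real (bracket \<eta>) * complex_of_real (gh (\<eta> - h))) \<in> schwartz"
  using schwartz_mult_slow[OF slow_bracket schwartz_fourier[OF modulated_gauss(1)[of h]]]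
  by (simp only: modulated_gauss(2))

lemma packet_schwartz: "packet h \<in> schwartz"
  unfolding packet_def by (intro schwartz_inv_fourier packet_fourier_schwartz)

lemma fourier_packet: "fourier (packet h) = (\<lambda>\<eta>. of_real (bracket \<eta>) * of_real (gh (\<eta> - h)))"
  unfolding packet_def by (intro fourier_inv_fourier packet_fourier_schwartz)

lemma root_op_packet: "R (packet h) = (\<lambda>x. exp (\<i> * complex_of_real (h * x)) * gauss \<epsilon> x)"
proof -
  have "R (packet h) = inv_fourier (fourier (\<lambda>x. exp (\<i> * complex_of_real (h * x)) * gauss \<epsilon> x))"
    unfolding root_op_def fourier_packet modulated_gauss(2) by (simp add: root_symbol_one)
  then show ?thesis by (simp only: inv_fourier_fourier[OF modulated_gauss(1)])
qed

lemma shifted_What_L2: "(\<lambda>\<xi>. of_real (1 / bracket \<xi>) * What (\<xi> - h)) \<in> L2"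
proof -
  have "(\<lambda>\<xi>. of_real (bracket (\<xi> - h) / bracket \<xi>) * density (\<xi> - h)) \<in> L2"
  proof (rule L2_multiplier[OF L2_translate[OF density(1)], of _ "1 + \<bar>h\<bar>"])
    show "bracket (\<xi> - h) / bracket \<xi> \<le> 1 + \<bar>h\<bar>" for \<xi>
      using bracket_Peetre[of "\<xi> - h" \<xi>] by (simp add: divide_le_eq mult.commute)
  qed auto
  then show ?thesis by (simp add: What_def)
qed

text \<open>
  In \<open>\<langle>\<psi>, A (packet h)\<rangle> = \<langle>R \<psi>, V e\<^sup>i\<^sup>h\<^sup>x g\<^sub>\<epsilon>\<rangle>\<close> the modulation can be moved to the test function, where it becomes a
  translation on the Fourier side.
\<close>

lemma sandwiched_packet:
  "AE \<xi> in lborel. L2_fourier (A (packet h)) \<xi> = of_real (1 / bracket \<xi>) * What (\<xi> - h)"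
proof (rule L2_fourier_unique[OF _ shifted_What_L2])
  show "A (packet h) \<in> L2" by (intro sandwiched_represents schwartz_L2 packet_schwartz)
  fix \<psi> assume \<psi>: "\<psi> \<in> schwartz"
  let ?a = "\<lambda>x. exp (\<i> * complex_of_real (- h * x)) * R \<psi> x"
  have R\<psi>: "R \<psi> \<in> schwartz" by (rule root_op_schwartz[OF \<kappa> \<psi>])
  have a: "?a \<in> schwartz" by (rule schwartz_mult_slow[OF slow_exp_i R\<psi>])
  have Fa: "fourier ?a \<xi> = of_real (1 / bracket (\<xi> + h)) * fourier \<psi> (\<xi> + h)" for \<xi>
    by (simp only: fourier_modulated fourier_root_op[OF \<kappa> \<psi>] root_symbol_one) simp
  have "L2_inner \<psi> (A (packet h)) = V (\<lambda>x. gauss \<epsilon> x * ?a x)"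
    unfolding sandwiched_schwartz[OF packet_schwartz \<psi>] root_op_packet
    by (simp add: exp_cnj mult_ac)
  also have "\<dots> = L2_inner (\<lambda>\<xi>. of_real (bracket \<xi>) * fourier ?a \<xi>) density"
    by (rule density(2)[OF a])
  also have "\<dots> = (LINT \<xi>|lborel. cnj (fourier \<psi> (\<xi> + h)) * (of_real (1 / bracket (\<xi> + h)) * What \<xi>))"
    unfolding L2_inner_def Fa by (simp add: What_def mult_ac)
  also have "\<dots> = L2_inner (fourier \<psi>) (\<lambda>\<xi>. of_real (1 / bracket \<xi>) * What (\<xi> - h))"
    unfolding L2_inner_def
    using lborel_integral_real_affine[of 1 "\<lambda>\<xi>. cnj (fourier \<psi> \<xi>) * (of_real (1 / bracket \<xi>) * What (\<xi> - h))" h]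
    by (simp add: add.commute)
  finally show "L2_inner \<psi> (A (packet h)) = L2_inner (fourier \<psi>) (\<lambda>\<xi>. of_real (1 / bracket \<xi>) * What (\<xi> - h))" .
qed

lemma sandwiched_packet_norm:
  "ennreal ((L2_norm (A (packet h)))\<^sup>2) = (\<integral>\<^sup>+\<xi>. ennreal ((cmod (What (\<xi> - h)) / bracket \<xi>)\<^sup>2) \<partial>lborel)"
proof -
  have Ap: "A (packet h) \<in> L2" by (intro sandwiched_represents schwartz_L2 packet_schwartz)
  have "L2_norm (A (packet h)) = L2_norm (\<lambda>\<xi>. of_real (1 / bracket \<xi>) * What (\<xi> - h))"
    unfolding L2_fourier_norm[OF Ap, symmetric]
    by (intro L2_norm_cong_AE L2_measurable_borel L2_fourier Ap shifted_What_L2 sandwiched_packet)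
  then show ?thesis
    using L2_nn_integral[OF shifted_What_L2[of h]] by (simp add: norm_mult norm_divide)
qed

lemma packet_inner:
  assumes f: "f \<in> L2"
  shows "L2_inner f (packet h) = (LINT \<eta>|lborel. cnj (L2_fourier f \<eta>) * of_real (bracket \<eta> * gh (\<eta> - h)))"
proof -
  have "L2_inner f (packet h) = cnj (L2_inner (fourier (packet h)) (L2_fourier f))"
    unfolding L2_fourier_test[OF f packet_schwartz] by (rule L2_inner_commute)
  also have "\<dots> = L2_inner (L2_fourier f) (fourier (packet h))" by (rule L2_inner_commute[symmetric])
  finally show ?thesis by (simp add: L2_inner_def fourier_packet)
qed

lemma packet_inner_measurable:
  assumes f: "f \<in> L2" shows "(\<lambda>h. L2_inner f (packet h)) \<in> borel_measurable borel"
proof -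
  have [measurable]: "L2_fourier f \<in> borel_measurable borel" using L2_fourier(1)[OF f] by auto
  have "(\<lambda>h. LINT \<eta>|lborel. cnj (L2_fourier f \<eta>) * of_real (bracket \<eta> * gh (\<eta> - h))) \<in> borel_measurable borel"
    by measurable
  then show ?thesis by (simp only: packet_inner[OF f])
qed

lemma packet_weight_mass:
  "(\<integral>\<^sup>+\<eta>. ennreal (bracket \<eta> * gh (\<eta> - h)) \<partial>lborel) \<le> ennreal (gauss_mass * bracket h)"
proof -
  have "(\<integral>\<^sup>+\<eta>. ennreal (bracket \<eta> * gh (\<eta> - h)) \<partial>lborel)
    \<le> (\<integral>\<^sup>+\<eta>. ennreal (bracket h * ((1 + \<bar>\<eta> - h\<bar>) * gh (\<eta> - h))) \<partial>lborel)"
    using gauss_hat_nonneg[OF \<epsilon>(1)] mult_right_mono[OF bracket_Peetre]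
    by (intro nn_integral_mono ennreal_leI) (simp add: mult.assoc[symmetric])
  also have "\<dots> = ennreal (bracket h) * (\<integral>\<^sup>+\<eta>. ennreal ((1 + \<bar>\<eta> - h\<bar>) * gh (\<eta> - h)) \<partial>lborel)"
    by (subst nn_integral_cmult[symmetric]) (auto simp: ennreal_mult'[symmetric])
  also have "(\<integral>\<^sup>+\<eta>. ennreal ((1 + \<bar>\<eta> - h\<bar>) * gh (\<eta> - h)) \<partial>lborel) = (\<integral>\<^sup>+t. ennreal ((1 + \<bar>t\<bar>) * gh t) \<partial>lborel)"
    using nn_integral_real_affine[of "\<lambda>\<eta>. ennreal ((1 + \<bar>\<eta> - h\<bar>) * gh (\<eta> - h))" 1 h] by simp
  also have "ennreal (bracket h) * \<dots> \<le> ennreal (bracket h) * ennreal gauss_mass"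
    by (intro mult_left_mono gauss_hat_mass \<epsilon>) simp
  finally show ?thesis using gauss_mass_nonneg by (simp add: ennreal_mult mult.commute)
qed

text \<open>
  Cauchy--Schwarz with the weight \<open>w \<eta> = bracket \<eta> * gh (\<eta> - h)\<close> divided equally between the two factors, as in
  Schur's test.
\<close>

lemma packet_inner_square:
  assumes f: "f \<in> L2"
  shows "ennreal ((cmod (L2_inner f (packet h)))\<^sup>2)
    \<le> ennreal (gauss_mass * bracket h) * (\<integral>\<^sup>+\<eta>. ennreal ((cmod (L2_fourier f \<eta>))\<^sup>2 * (bracket \<eta> * gh (\<eta> - h))) \<partial>lborel)"
proof -
  define w where "w \<eta> = bracket \<eta> * gh (\<eta> - h)" for \<eta>
  have w: "w \<eta> \<ge> 0" for \<eta> using gauss_hat_nonneg[OF \<epsilon>(1)] by (simp add: w_def)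
  have [measurable]: "w \<in> borel_measurable borel" unfolding w_def by measurable
  have [measurable]: "L2_fourier f \<in> borel_measurable borel" using L2_fourier(1)[OF f] by auto
  have sqrtw: "(\<lambda>\<eta>. complex_of_real (sqrt (w \<eta>))) \<in> L2"
  proof (rule L2_by_nn_integral)
    show "(\<integral>\<^sup>+\<eta>. ennreal ((cmod (complex_of_real (sqrt (w \<eta>))))\<^sup>2) \<partial>lborel) < \<infinity>"
      using order.strict_trans1[OF packet_weight_mass[of h]] w by (simp add: w_def)
  qed measurable
  obtain D where D: "\<And>\<eta>. cmod (of_real (w \<eta>)) \<le> D"
  proof -
    obtain D where "\<And>\<eta>. (1 + \<eta>\<^sup>2) ^ 0 * cmod (of_real (bracket \<eta>) * complex_of_real (gh (\<eta> - h))) \<le> D"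
      using schwartz_decay[OF packet_fourier_schwartz[of h]] by metis
    then show ?thesis using that[of D] by (simp add: w_def)
  qed
  have fw: "(\<lambda>\<eta>. of_real (sqrt (w \<eta>)) * L2_fourier f \<eta>) \<in> L2"
    using D w by (intro L2_multiplier[where C="sqrt D"] L2_fourier f) (auto intro: real_sqrt_le_mono)
  have "L2_inner f (packet h) = L2_inner (\<lambda>\<eta>. of_real (sqrt (w \<eta>)) * L2_fourier f \<eta>) (\<lambda>\<eta>. of_real (sqrt (w \<eta>)))"
    unfolding packet_inner[OF f] unfolding L2_inner_def
  proof (rule Bochner_Integration.integral_cong[OF refl])
    fix \<eta>
    have "w \<eta> = sqrt (w \<eta>) * sqrt (w \<eta>)" using w by simp
    then have "complex_of_real (w \<eta>) = of_real (sqrt (w \<eta>)) * of_real (sqrt (w \<eta>))"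
      by (simp only: of_real_mult[symmetric])
    then show "cnj (L2_fourier f \<eta>) * of_real (bracket \<eta> * gh (\<eta> - h))
        = cnj (of_real (sqrt (w \<eta>)) * L2_fourier f \<eta>) * of_real (sqrt (w \<eta>))"
      by (simp add: w_def[symmetric] del: of_real_mult)
  qed
  then have "cmod (L2_inner f (packet h)) \<le> L2_norm (\<lambda>\<eta>. of_real (sqrt (w \<eta>)) * L2_fourier f \<eta>) * L2_norm (\<lambda>\<eta>. of_real (sqrt (w \<eta>)))"
    using L2_Cauchy_Schwarz[OF fw sqrtw] by simp
  then have "(cmod (L2_inner f (packet h)))\<^sup>2
    \<le> (L2_norm (\<lambda>\<eta>. of_real (sqrt (w \<eta>)) * L2_fourier f \<eta>) * L2_norm (\<lambda>\<eta>. of_real (sqrt (w \<eta>))))\<^sup>2"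
    by (intro power_mono) auto
  then have "ennreal ((cmod (L2_inner f (packet h)))\<^sup>2)
    \<le> ennreal ((L2_norm (\<lambda>\<eta>. of_real (sqrt (w \<eta>))))\<^sup>2) * ennreal ((L2_norm (\<lambda>\<eta>. of_real (sqrt (w \<eta>)) * L2_fourier f \<eta>))\<^sup>2)"
    by (simp add: ennreal_mult[symmetric] power_mult_distrib mult.commute)
  also have "\<dots> = (\<integral>\<^sup>+\<eta>. ennreal (w \<eta>) \<partial>lborel) * (\<integral>\<^sup>+\<eta>. ennreal ((cmod (L2_fourier f \<eta>))\<^sup>2 * w \<eta>) \<partial>lborel)"
    unfolding L2_nn_integral[OF fw, symmetric] L2_nn_integral[OF sqrtw, symmetric]
    using w by (simp add: norm_mult power_mult_distrib mult.commute)
  also have "\<dots> \<le> ennreal (gauss_mass * bracket h) * (\<integral>\<^sup>+\<eta>. ennreal ((cmod (L2_fourier f \<eta>))\<^sup>2 * w \<eta>) \<partial>lborel)"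
    using packet_weight_mass[of h] by (intro mult_right_mono) (simp_all add: w_def)
  finally show ?thesis by (simp add: w_def)
qed

text \<open>
  Schur's test for the operator with kernel \<open>bracket \<eta> * gh (\<eta> - h) / bracket h\<close>. By Peetre's inequality both
  marginal integrals are at most \<open>gauss_mass\<close>.
\<close>

theorem packet_frame_bound:
  assumes f: "f \<in> L2"
  shows "(\<integral>\<^sup>+h. ennreal ((cmod (L2_inner f (packet h)))\<^sup>2 / (bracket h)\<^sup>2) \<partial>lborel) \<le> ennreal (gauss_mass\<^sup>2 * (L2_norm f)\<^sup>2)"
proof -
  have [measurable]: "L2_fourier f \<in> borel_measurable borel" using L2_fourier(1)[OF f] by auto
  let ?p = "\<lambda>\<eta>. (cmod (L2_fourier f \<eta>))\<^sup>2"
  have gh0: "gh t \<ge> 0" for t by (rule gauss_hat_nonneg[OF \<epsilon>(1)])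
  have "(\<integral>\<^sup>+h. ennreal ((cmod (L2_inner f (packet h)))\<^sup>2 / (bracket h)\<^sup>2) \<partial>lborel)
    \<le> (\<integral>\<^sup>+h. ennreal gauss_mass * (\<integral>\<^sup>+\<eta>. ennreal (?p \<eta> * ((1 + \<bar>\<eta> - h\<bar>) * gh (\<eta> - h))) \<partial>lborel) \<partial>lborel)"
  proof (rule nn_integral_mono)
    fix h
    have "ennreal ((cmod (L2_inner f (packet h)))\<^sup>2 / (bracket h)\<^sup>2)
      = ennreal (1 / (bracket h)\<^sup>2) * ennreal ((cmod (L2_inner f (packet h)))\<^sup>2)"
      by (simp add: ennreal_mult[symmetric])
    also have "\<dots> \<le> ennreal (1 / (bracket h)\<^sup>2) * (ennreal (gauss_mass * bracket h) *
        (\<integral>\<^sup>+\<eta>. ennreal (?p \<eta> * (bracket \<eta> * gh (\<eta> - h))) \<partial>lborel))"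
      by (intro mult_left_mono packet_inner_square[OF f]) simp
    also have "\<dots> = ennreal gauss_mass * (ennreal (1 / bracket h) *
        (\<integral>\<^sup>+\<eta>. ennreal (?p \<eta> * (bracket \<eta> * gh (\<eta> - h))) \<partial>lborel))"
    proof -
      have "1 / (bracket h)\<^sup>2 * (gauss_mass * bracket h) = gauss_mass * (1 / bracket h)"
        by (simp add: power2_eq_square)
      then have "ennreal (1 / (bracket h)\<^sup>2) * ennreal (gauss_mass * bracket h) = ennreal gauss_mass * ennreal (1 / bracket h)"
        using gauss_mass_nonneg by (simp only: ennreal_mult[symmetric] mult_nonneg_nonneg bracket_pos zero_le_divide_1_iff zero_le_power)
      then show ?thesis by (simp only: mult.assoc[symmetric])
    qed
    also have "ennreal (1 / bracket h) * (\<integral>\<^sup>+\<eta>. ennreal (?p \<eta> * (bracket \<eta> * gh (\<eta> - h))) \<partial>lborel)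
      = (\<integral>\<^sup>+\<eta>. ennreal (1 / bracket h * (?p \<eta> * (bracket \<eta> * gh (\<eta> - h)))) \<partial>lborel)"
      by (subst nn_integral_cmult[symmetric]) (auto simp: ennreal_mult'[symmetric])
    also have "\<dots> \<le> (\<integral>\<^sup>+\<eta>. ennreal (?p \<eta> * ((1 + \<bar>\<eta> - h\<bar>) * gh (\<eta> - h))) \<partial>lborel)"
    proof (intro nn_integral_mono ennreal_leI)
      fix \<eta>
      have "bracket \<eta> / bracket h \<le> 1 + \<bar>\<eta> - h\<bar>"
        using bracket_Peetre[of \<eta> h] by (simp add: divide_le_eq mult.commute)
      then have "?p \<eta> * (bracket \<eta> / bracket h * gh (\<eta> - h)) \<le> ?p \<eta> * ((1 + \<bar>\<eta> - h\<bar>) * gh (\<eta> - h))"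
        by (intro mult_left_mono mult_right_mono gh0) auto
      then show "1 / bracket h * (?p \<eta> * (bracket \<eta> * gh (\<eta> - h))) \<le> ?p \<eta> * ((1 + \<bar>\<eta> - h\<bar>) * gh (\<eta> - h))"
        by (simp add: mult_ac)
    qed
    finally show "ennreal ((cmod (L2_inner f (packet h)))\<^sup>2 / (bracket h)\<^sup>2)
      \<le> ennreal gauss_mass * (\<integral>\<^sup>+\<eta>. ennreal (?p \<eta> * ((1 + \<bar>\<eta> - h\<bar>) * gh (\<eta> - h))) \<partial>lborel)"
      by (simp add: mult_left_mono)
  qed
  also have "\<dots> = ennreal gauss_mass * (\<integral>\<^sup>+h. \<integral>\<^sup>+\<eta>. ennreal (?p \<eta> * ((1 + \<bar>\<eta> - h\<bar>) * gh (\<eta> - h))) \<partial>lborel \<partial>lborel)"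
    by (rule nn_integral_cmult) measurable
  also have "(\<integral>\<^sup>+h. \<integral>\<^sup>+\<eta>. ennreal (?p \<eta> * ((1 + \<bar>\<eta> - h\<bar>) * gh (\<eta> - h))) \<partial>lborel \<partial>lborel)
    = (\<integral>\<^sup>+\<eta>. \<integral>\<^sup>+h. ennreal (?p \<eta> * ((1 + \<bar>\<eta> - h\<bar>) * gh (\<eta> - h))) \<partial>lborel \<partial>lborel)"
  proof -
    have "(\<lambda>q. ennreal (?p (fst q) * ((1 + \<bar>fst q - snd q\<bar>) * gh (fst q - snd q)))) \<in> borel_measurable (borel \<Otimes>\<^sub>M borel)"
      by measurable
    then show ?thesis
      using lborel_pair.Fubini[of "\<lambda>q. ennreal (?p (fst q) * ((1 + \<bar>fst q - snd q\<bar>) * gh (fst q - snd q)))"] by simp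
  qed
  also have "\<dots> \<le> (\<integral>\<^sup>+\<eta>. ennreal (?p \<eta>) * ennreal gauss_mass \<partial>lborel)"
  proof (rule nn_integral_mono)
    fix \<eta>
    have "(\<integral>\<^sup>+h. ennreal (?p \<eta> * ((1 + \<bar>\<eta> - h\<bar>) * gh (\<eta> - h))) \<partial>lborel)
      = ennreal (?p \<eta>) * (\<integral>\<^sup>+h. ennreal ((1 + \<bar>\<eta> - h\<bar>) * gh (\<eta> - h)) \<partial>lborel)"
      by (subst nn_integral_cmult[symmetric]) (auto simp: ennreal_mult'[symmetric])
    also have "(\<integral>\<^sup>+h. ennreal ((1 + \<bar>\<eta> - h\<bar>) * gh (\<eta> - h)) \<partial>lborel) = (\<integral>\<^sup>+t. ennreal ((1 + \<bar>t\<bar>) * gh t) \<partial>lborel)"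
      using nn_integral_real_affine[of "\<lambda>h. ennreal ((1 + \<bar>\<eta> - h\<bar>) * gh (\<eta> - h))" "-1" \<eta>] by simp
    also have "ennreal (?p \<eta>) * \<dots> \<le> ennreal (?p \<eta>) * ennreal gauss_mass"
      by (intro mult_left_mono gauss_hat_mass \<epsilon>) simp
    finally show "(\<integral>\<^sup>+h. ennreal (?p \<eta> * ((1 + \<bar>\<eta> - h\<bar>) * gh (\<eta> - h))) \<partial>lborel) \<le> ennreal (?p \<eta>) * ennreal gauss_mass" .
  qed
  also have "\<dots> = ennreal ((L2_norm f)\<^sup>2) * ennreal gauss_mass"
    by (subst nn_integral_multc) (auto simp: L2_nn_integral L2_fourier f L2_fourier_norm)
  finally have "(\<integral>\<^sup>+h. ennreal ((cmod (L2_inner f (packet h)))\<^sup>2 / (bracket h)\<^sup>2) \<partial>lborel)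
      \<le> ennreal gauss_mass * (ennreal ((L2_norm f)\<^sup>2) * ennreal gauss_mass)" by (simp add: mult_left_mono)
  also have "\<dots> = ennreal (gauss_mass\<^sup>2 * (L2_norm f)\<^sup>2)"
    using gauss_mass_nonneg by (simp add: ennreal_mult[symmetric] power2_eq_square mult_ac)
  finally show ?thesis .
qed

end

lemma L2_inner_sum_left:
  assumes "g \<in> L2" "\<And>i. i \<in> I \<Longrightarrow> f i \<in> L2"
  shows "L2_inner (\<lambda>x. \<Sum>i\<in>I. f i x) g = (\<Sum>i\<in>I. L2_inner (f i) g)"
proof -
  have "L2_inner (\<lambda>x. \<Sum>i\<in>I. f i x) g = cnj (\<Sum>i\<in>I. L2_inner g (f i))"
    by (subst L2_inner_commute) (simp add: L2_inner_sum_right assms)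
  also have "\<dots> = (\<Sum>i\<in>I. cnj (L2_inner g (f i)))" by simp
  also have "\<dots> = (\<Sum>i\<in>I. L2_inner (f i) g)"
    by (intro sum.cong refl) (rule L2_inner_commute[symmetric])
  finally show ?thesis .
qed

context damped_multiplier
begin

text \<open>
  For a fixed point \<open>x\<close> the truncated sum is \<open>\<langle>q, packet h\<rangle>\<close> with \<open>q = \<Sum>e. cnj (A e x) e\<close> and
  \<open>\<parallel>q\<parallel>\<^sup>2 = \<Sum>e. |A e x|\<^sup>2\<close>. The frame bound for \<open>q\<close> is then integrated over \<open>x\<close>. Truncation ensures that \<open>q\<close> is a
  well-defined function for every \<open>x\<close>.
\<close>

lemma truncated_packet_bound:
  assumes F: "L2_orthonormal F" "finite F"
  shows "(\<integral>\<^sup>+h. ennreal ((L2_norm (\<lambda>x. \<Sum>e\<in>F. L2_inner e (packet h) * A e x))\<^sup>2 / (bracket h)\<^sup>2) \<partial>lborel)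
    \<le> ennreal (gauss_mass\<^sup>2 * (\<Sum>e\<in>F. (L2_norm (A e))\<^sup>2))"
proof -
  have FL2: "e \<in> L2" if "e \<in> F" for e using L2_orthonormal_in_L2[OF F(1) that] .
  have AL2: "A e \<in> L2" if "e \<in> F" for e by (intro sandwiched_represents FL2 that)
  have [measurable]: "A e \<in> borel_measurable borel" if "e \<in> F" for e using AL2[OF that] by auto
  have [measurable]: "(\<lambda>h. L2_inner e (packet h)) \<in> borel_measurable borel" if "e \<in> F" for e
    by (rule packet_inner_measurable[OF FL2[OF that]])
  let ?s = "\<lambda>h x. \<Sum>e\<in>F. L2_inner e (packet h) * A e x"
  have meas: "(\<lambda>q. ?s (snd q) (fst q)) \<in> borel_measurable (borel \<Otimes>\<^sub>M borel)" by measurable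
  have frame: "(\<integral>\<^sup>+h. ennreal ((cmod (?s h x))\<^sup>2 / (bracket h)\<^sup>2) \<partial>lborel)
      \<le> ennreal (gauss_mass\<^sup>2) * (\<Sum>e\<in>F. ennreal ((cmod (A e x))\<^sup>2))" for x
  proof -
    define q where "q = (\<lambda>y. \<Sum>e\<in>F. cnj (A e x) * e y)"
    have q: "q \<in> L2" unfolding q_def by (intro L2_sum L2_scale FL2)
    have "L2_inner q (packet h) = ?s h x" for h
      unfolding q_def
      by (simp add: L2_inner_sum_left schwartz_L2 packet_schwartz L2_scale FL2 L2_inner_scale_left)
         (simp add: mult.commute)
    moreover have "(L2_norm q)\<^sup>2 = (\<Sum>e\<in>F. (cmod (A e x))\<^sup>2)"
      using L2_distance_to_combination[OF F(1) F(2) order.refl L2_zero, of "\<lambda>e. cnj (A e x)"]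
        L2_norm_scale[of "- 1" q]
      by (simp add: q_def L2_inner_def L2_norm_def sum_nonneg)
    ultimately have "(\<integral>\<^sup>+h. ennreal ((cmod (?s h x))\<^sup>2 / (bracket h)\<^sup>2) \<partial>lborel)
        \<le> ennreal (gauss_mass\<^sup>2 * (\<Sum>e\<in>F. (cmod (A e x))\<^sup>2))"
      using packet_frame_bound[OF q] by simp
    also have "\<dots> = ennreal (gauss_mass\<^sup>2) * (\<Sum>e\<in>F. ennreal ((cmod (A e x))\<^sup>2))"
      by (simp add: ennreal_mult sum_nonneg sum_ennreal)
    finally show ?thesis .
  qed
  have "(\<integral>\<^sup>+h. ennreal ((L2_norm (?s h))\<^sup>2 / (bracket h)\<^sup>2) \<partial>lborel)
    = (\<integral>\<^sup>+h. \<integral>\<^sup>+x. ennreal ((cmod (?s h x))\<^sup>2 / (bracket h)\<^sup>2) \<partial>lborel \<partial>lborel)"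
  proof (rule nn_integral_cong)
    fix h
    have s: "?s h \<in> L2" by (intro L2_sum L2_scale AL2)
    have "ennreal ((L2_norm (?s h))\<^sup>2 / (bracket h)\<^sup>2) = ennreal (1 / (bracket h)\<^sup>2) * (\<integral>\<^sup>+x. ennreal ((cmod (?s h x))\<^sup>2) \<partial>lborel)"
      unfolding L2_nn_integral[OF s] by (simp add: ennreal_mult[symmetric])
    also have "\<dots> = (\<integral>\<^sup>+x. ennreal ((cmod (?s h x))\<^sup>2 / (bracket h)\<^sup>2) \<partial>lborel)"
      using L2_measurable_borel[OF s]
      by (subst nn_integral_cmult[symmetric]) (auto simp: ennreal_mult[symmetric])
    finally show "ennreal ((L2_norm (?s h))\<^sup>2 / (bracket h)\<^sup>2) = (\<integral>\<^sup>+x. ennreal ((cmod (?s h x))\<^sup>2 / (bracket h)\<^sup>2) \<partial>lborel)" .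
  qed
  also have "\<dots> = (\<integral>\<^sup>+x. \<integral>\<^sup>+h. ennreal ((cmod (?s h x))\<^sup>2 / (bracket h)\<^sup>2) \<partial>lborel \<partial>lborel)"
    using lborel_pair.Fubini[of "\<lambda>q. ennreal ((cmod (?s (snd q) (fst q)))\<^sup>2 / (bracket (snd q))\<^sup>2)"] meas by simp
  also have "\<dots> \<le> (\<integral>\<^sup>+x. ennreal (gauss_mass\<^sup>2) * (\<Sum>e\<in>F. ennreal ((cmod (A e x))\<^sup>2)) \<partial>lborel)"
    by (intro nn_integral_mono frame)
  also have "\<dots> = ennreal (gauss_mass\<^sup>2) * (\<integral>\<^sup>+x. (\<Sum>e\<in>F. ennreal ((cmod (A e x))\<^sup>2)) \<partial>lborel)"
    by (rule nn_integral_cmult) measurable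
  also have "(\<integral>\<^sup>+x. (\<Sum>e\<in>F. ennreal ((cmod (A e x))\<^sup>2)) \<partial>lborel)
      = (\<Sum>e\<in>F. \<integral>\<^sup>+x. ennreal ((cmod (A e x))\<^sup>2) \<partial>lborel)"
    by (rule nn_integral_sum) measurable
  also have "ennreal (gauss_mass\<^sup>2) * \<dots> = ennreal (gauss_mass\<^sup>2 * (\<Sum>e\<in>F. (L2_norm (A e))\<^sup>2))"
    by (simp add: L2_nn_integral AL2 ennreal_mult sum_nonneg sum_ennreal)
  finally show ?thesis .
qed

text \<open>
  Boundedness of \<open>A\<close> gives convergence of the truncations for every \<open>h\<close>, and Fatou's lemma removes the
  truncation.
\<close>

lemma packet_sum_bound:
  assumes B: "L2_orthonormal_basis B" and S: "((\<lambda>e. (L2_norm (A e))\<^sup>2) has_sum S) B"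
  shows "(\<integral>\<^sup>+h. ennreal ((L2_norm (A (packet h)))\<^sup>2 / (bracket h)\<^sup>2) \<partial>lborel) \<le> ennreal (gauss_mass\<^sup>2 * S)"
proof -
  have on: "L2_orthonormal B" using B by (simp add: L2_orthonormal_basis_altdef)
  obtain F :: "nat \<Rightarrow> (real \<Rightarrow> complex) set" where F: "\<And>n. finite (F n)" "\<And>n. F n \<subseteq> B"
    and expand: "\<And>f. f \<in> L2 \<Longrightarrow> (\<lambda>n. L2_norm (\<lambda>x. (\<Sum>e\<in>F n. L2_inner e f * e x) - f x)) \<longlonglongrightarrow> 0"
    using L2_expansion[OF B L2_orthonormal_bases_countable[OF B]] by blast
  have Fon: "L2_orthonormal (F n)" for n using on F(2)[of n] by (auto simp: L2_orthonormal_def subset_iff)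
  have FL2: "e \<in> L2" if "e \<in> F n" for e n using L2_orthonormal_in_L2[OF Fon that] .
  let ?s = "\<lambda>n h x. \<Sum>e\<in>F n. L2_inner e (packet h) * A e x"
  have p: "packet h \<in> L2" for h by (intro schwartz_L2 packet_schwartz)
  have sL2: "?s n h \<in> L2" for n h by (intro L2_sum L2_scale sandwiched_represents(1) FL2)
  have lim: "(\<lambda>n. L2_norm (?s n h)) \<longlonglongrightarrow> L2_norm (A (packet h))" for h
  proof -
    let ?u = "\<lambda>n x. \<Sum>e\<in>F n. L2_inner e (packet h) * e x"
    have u: "?u n \<in> L2" for n by (intro L2_sum L2_scale FL2)
    have "(\<lambda>n. L2_norm (A (?u n))) \<longlonglongrightarrow> L2_norm (A (packet h))"
      by (intro L2_norm_tendsto L2_bounded_op_limit[OF sandwiched_bounded_op] sandwiched_represents(1) u p expand)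
    moreover have "L2_norm (A (?u n)) = L2_norm (?s n h)" for n
      using F(1) FL2
      by (intro L2_norm_cong_AE L2_bounded_op_sum[OF sandwiched_bounded_op] L2_measurable_borel sandwiched_represents(1) u sL2) auto
    ultimately show ?thesis by simp
  qed
  have [measurable]: "(\<lambda>h. L2_norm (?s n h)) \<in> borel_measurable borel" for n
  proof -
    have [measurable]: "A e \<in> borel_measurable borel" if "e \<in> F n" for e
      using sandwiched_represents(1)[OF FL2[OF that]] by auto
    have [measurable]: "(\<lambda>h. L2_inner e (packet h)) \<in> borel_measurable borel" if "e \<in> F n" for e
      by (rule packet_inner_measurable[OF FL2[OF that]])
    show ?thesis unfolding L2_norm_def by measurable
  qed
  have "(\<integral>\<^sup>+h. ennreal ((L2_norm (A (packet h)))\<^sup>2 / (bracket h)\<^sup>2) \<partial>lborel)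
    = (\<integral>\<^sup>+h. liminf (\<lambda>n. ennreal ((L2_norm (?s n h))\<^sup>2 / (bracket h)\<^sup>2)) \<partial>lborel)"
  proof (rule nn_integral_cong)
    fix h
    have "(\<lambda>n. ennreal ((L2_norm (?s n h))\<^sup>2 / (bracket h)\<^sup>2)) \<longlonglongrightarrow> ennreal ((L2_norm (A (packet h)))\<^sup>2 / (bracket h)\<^sup>2)"
      by (intro tendsto_ennrealI tendsto_intros lim) simp
    from lim_imp_Liminf[OF sequentially_bot this]
    show "ennreal ((L2_norm (A (packet h)))\<^sup>2 / (bracket h)\<^sup>2) = liminf (\<lambda>n. ennreal ((L2_norm (?s n h))\<^sup>2 / (bracket h)\<^sup>2))"
      by (rule sym)
  qed
  also have "\<dots> \<le> liminf (\<lambda>n. \<integral>\<^sup>+h. ennreal ((L2_norm (?s n h))\<^sup>2 / (bracket h)\<^sup>2) \<partial>lborel)"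
    by (intro nn_integral_liminf) measurable
  also have "\<dots> \<le> ennreal (gauss_mass\<^sup>2 * S)"
  proof (rule Liminf_le)
    have "(\<integral>\<^sup>+h. ennreal ((L2_norm (?s n h))\<^sup>2 / (bracket h)\<^sup>2) \<partial>lborel) \<le> ennreal (gauss_mass\<^sup>2 * S)" for n
    proof -
      have "(\<Sum>e\<in>F n. (L2_norm (A e))\<^sup>2) \<le> S"
        using finite_sum_le_has_sum[OF S F(1,2)] by simp
      then have "ennreal (gauss_mass\<^sup>2 * (\<Sum>e\<in>F n. (L2_norm (A e))\<^sup>2)) \<le> ennreal (gauss_mass\<^sup>2 * S)"
        by (intro ennreal_leI mult_left_mono) auto
      then show ?thesis using truncated_packet_bound[OF Fon F(1)] order.trans by blast
    qed
    then show "\<forall>\<^sub>F n in sequentially. (\<integral>\<^sup>+h. ennreal ((L2_norm (?s n h))\<^sup>2 / (bracket h)\<^sup>2) \<partial>lborel) \<le> ennreal (gauss_mass\<^sup>2 * S)"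
      by simp
  qed simp
  finally show ?thesis .
qed

text \<open>
  By \<open>sandwiched_packet_norm\<close> and the shear substitution the right-hand side equals
  \<open>\<integral> |What \<zeta>|\<^sup>2 2\<pi> / (\<zeta>\<^sup>2 + 4) d\<zeta>\<close>. The constant \<open>\<pi>/2\<close> comes from \<open>(1 + \<zeta>\<^sup>2) / (\<zeta>\<^sup>2 + 4) \<ge> 1/4\<close>.
\<close>

lemma density_le_packet_sum:
  "ennreal (pi / 2 * (L2_norm density)\<^sup>2) \<le> (\<integral>\<^sup>+h. ennreal ((L2_norm (A (packet h)))\<^sup>2 / (bracket h)\<^sup>2) \<partial>lborel)"
proof -
  let ?f = "\<lambda>\<xi> h. ennreal ((cmod (What (\<xi> - h)) / bracket \<xi>)\<^sup>2 / (bracket h)\<^sup>2)"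
  have meas: "(\<lambda>q. ?f (fst q) (snd q)) \<in> borel_measurable (borel \<Otimes>\<^sub>M borel)" by measurable
  have [measurable]: "density \<in> borel_measurable borel" using density(1) by auto
  have "ennreal (pi / 2 * (L2_norm density)\<^sup>2) = (\<integral>\<^sup>+\<zeta>. ennreal (pi / 2 * (cmod (density \<zeta>))\<^sup>2) \<partial>lborel)"
  proof -
    have "(\<integral>\<^sup>+\<zeta>. ennreal (pi / 2 * (cmod (density \<zeta>))\<^sup>2) \<partial>lborel)
      = (\<integral>\<^sup>+\<zeta>. ennreal (pi / 2) * ennreal ((cmod (density \<zeta>))\<^sup>2) \<partial>lborel)"
      by (intro nn_integral_cong ennreal_mult) auto
    also have "\<dots> = ennreal (pi / 2) * ennreal ((L2_norm density)\<^sup>2)"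
      by (subst nn_integral_cmult) (auto simp: L2_nn_integral[OF density(1)])
    also have "\<dots> = ennreal (pi / 2 * (L2_norm density)\<^sup>2)"
      by (rule ennreal_mult[symmetric]) auto
    finally show ?thesis by (rule sym)
  qed
  also have "\<dots> \<le> (\<integral>\<^sup>+\<zeta>. \<integral>\<^sup>+h. ?f (\<zeta> + h) h \<partial>lborel \<partial>lborel)"
  proof (rule nn_integral_mono_AE, use AE_lborel_singleton[of 0] in eventually_elim)
    fix \<zeta> :: real assume \<zeta>: "\<zeta> \<noteq> 0"
    have pos: "0 < \<zeta>\<^sup>2 + 4 * 1\<^sup>2" by (simp add: add_nonneg_pos)
    have "pi / 2 * (cmod (density \<zeta>))\<^sup>2 \<le> (cmod (What \<zeta>))\<^sup>2 * (2 * pi / (1 * (\<zeta>\<^sup>2 + 4 * 1\<^sup>2)))"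
    proof -
      have "1 / 4 \<le> (1 + \<zeta>\<^sup>2) / (\<zeta>\<^sup>2 + 4 * 1\<^sup>2)" using pos by (simp add: field_simps)
      then have "(2 * pi * (cmod (density \<zeta>))\<^sup>2) * (1 / 4) \<le> (2 * pi * (cmod (density \<zeta>))\<^sup>2) * ((1 + \<zeta>\<^sup>2) / (\<zeta>\<^sup>2 + 4 * 1\<^sup>2))"
        by (intro mult_left_mono) auto
      also have "\<dots> = (cmod (What \<zeta>))\<^sup>2 * (2 * pi / (1 * (\<zeta>\<^sup>2 + 4 * 1\<^sup>2)))"
        by (simp add: What_def norm_mult power_mult_distrib bracket_def)
      finally show ?thesis by simp
    qed
    then have "ennreal (pi / 2 * (cmod (density \<zeta>))\<^sup>2) \<le> ennreal ((cmod (What \<zeta>))\<^sup>2) * ennreal (2 * pi / (1 * (\<zeta>\<^sup>2 + 4 * 1\<^sup>2)))"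
      using pos by (subst ennreal_mult[symmetric]) (auto intro: ennreal_leI)
    also have "\<dots> = (\<integral>\<^sup>+h. ennreal ((cmod (What \<zeta>))\<^sup>2) * ennreal ((root_symbol 1 (\<zeta> + h))\<^sup>2 * (root_symbol 1 h)\<^sup>2) \<partial>lborel)"
      using cauchy_convolution[OF zero_less_one \<zeta>] by (subst nn_integral_cmult) auto
    also have "\<dots> = (\<integral>\<^sup>+h. ?f (\<zeta> + h) h \<partial>lborel)"
      by (intro nn_integral_cong) (simp add: root_symbol_one ennreal_mult[symmetric] power_divide)
    finally show "ennreal (pi / 2 * (cmod (density \<zeta>))\<^sup>2) \<le> (\<integral>\<^sup>+h. ?f (\<zeta> + h) h \<partial>lborel)" .
  qed
  also have "\<dots> = (\<integral>\<^sup>+\<xi>. \<integral>\<^sup>+h. ?f \<xi> h \<partial>lborel \<partial>lborel)"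
    using meas by (intro nn_integral_shear[symmetric]) (simp add: split_beta)
  also have "\<dots> = (\<integral>\<^sup>+h. \<integral>\<^sup>+\<xi>. ?f \<xi> h \<partial>lborel \<partial>lborel)"
    using lborel_pair.Fubini[of "\<lambda>q. ?f (fst q) (snd q)"] meas by simp
  also have "\<dots> = (\<integral>\<^sup>+h. ennreal ((L2_norm (A (packet h)))\<^sup>2 / (bracket h)\<^sup>2) \<partial>lborel)"
  proof (rule nn_integral_cong)
    fix h
    have "(\<integral>\<^sup>+\<xi>. ?f \<xi> h \<partial>lborel) = (\<integral>\<^sup>+\<xi>. ennreal (1 / (bracket h)\<^sup>2) * ennreal ((cmod (What (\<xi> - h)) / bracket \<xi>)\<^sup>2) \<partial>lborel)"
      by (intro nn_integral_cong) (simp add: ennreal_mult[symmetric])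
    also have "\<dots> = ennreal (1 / (bracket h)\<^sup>2) * ennreal ((L2_norm (A (packet h)))\<^sup>2)"
      unfolding sandwiched_packet_norm by (rule nn_integral_cmult) measurable
    also have "\<dots> = ennreal ((L2_norm (A (packet h)))\<^sup>2 / (bracket h)\<^sup>2)" by (simp add: ennreal_mult[symmetric])
    finally show "(\<integral>\<^sup>+\<xi>. ?f \<xi> h \<partial>lborel) = ennreal ((L2_norm (A (packet h)))\<^sup>2 / (bracket h)\<^sup>2)" .
  qed
  finally show ?thesis .
qed

lemma damped_bound:
  assumes B: "L2_orthonormal_basis B" and S: "((\<lambda>e. (L2_norm (A e))\<^sup>2) has_sum S) B" and a: "a \<in> schwartz"
  shows "cmod (V (\<lambda>x. gauss \<epsilon> x * a x)) \<le> gauss_mass * sqrt S * h1_norm a"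
proof -
  have S0: "S \<ge> 0" using S by (rule has_sum_nonneg) simp
  have "ennreal (pi / 2 * (L2_norm density)\<^sup>2) \<le> ennreal (gauss_mass\<^sup>2 * S)"
    using density_le_packet_sum packet_sum_bound[OF B S] by (rule order.trans)
  then have "pi / 2 * (L2_norm density)\<^sup>2 \<le> gauss_mass\<^sup>2 * S"
    using S0 by (simp add: ennreal_le_iff)
  moreover have "1 * (L2_norm density)\<^sup>2 \<le> pi / 2 * (L2_norm density)\<^sup>2"
    using pi_gt3 by (intro mult_right_mono) auto
  ultimately have "(L2_norm density)\<^sup>2 \<le> (gauss_mass * sqrt S)\<^sup>2"
    using S0 by (simp add: power_mult_distrib)
  then have le: "L2_norm density \<le> gauss_mass * sqrt S"
    by (rule power2_le_imp_le) (use gauss_mass_nonneg S0 in simp)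
  have "cmod (V (\<lambda>x. gauss \<epsilon> x * a x)) \<le> h1_norm a * L2_norm density"
    unfolding density(2)[OF a] h1_norm_def by (rule L2_Cauchy_Schwarz[OF schwartz_bracket_L2[OF a] density(1)])
  also have "\<dots> \<le> h1_norm a * (gauss_mass * sqrt S)" by (intro mult_left_mono le h1_norm_nonneg)
  finally show ?thesis by (simp add: mult_ac)
qed

end

text \<open>
  The bounds for the damped distributions are uniform in \<open>\<epsilon>\<close> and pass to \<open>V\<close> by temperedness. Dividing the
  Fourier transform of the test function by the weight turns the resulting \<open>H\<^sup>1\<close> bound into an \<open>L\<^sup>2\<close> bound, and
  the representation theorem applies.
\<close>

theorem hilbert_schmidt_multiplier_in_sobolev:
  assumes mV: "sobolev_multiplier V" and hs: "hilbert_schmidt (sandwiched 1 V)"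
  shows "V \<in> sobolev (-1)"
proof -
  obtain C where mult: "multiplier V 1 C" using sobolev_multiplier_imp_multiplier[OF mV zero_less_one] by blast
  interpret multiplier V 1 C by (rule mult)
  obtain B S where B: "L2_orthonormal_basis B" "((\<lambda>e. (L2_norm (sandwiched 1 V e))\<^sup>2) has_sum S) B"
    using hs by (auto simp: hilbert_schmidt_def summable_on_def)
  have S0: "S \<ge> 0" using B(2) by (rule has_sum_nonneg) simp
  define D where "D = gauss_mass * sqrt S"
  have D0: "D \<ge> 0" using gauss_mass_nonneg S0 by (simp add: D_def)
  have bound: "cmod (V \<theta>) \<le> D * h1_norm \<theta>" if \<theta>: "\<theta> \<in> schwartz" for \<theta>
  proof (rule LIMSEQ_le_const2)
    show "(\<lambda>n. cmod (V (\<lambda>x. gauss (1 / real (Suc n)) x * \<theta> x))) \<longlonglongrightarrow> cmod (V \<theta>)"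
      by (intro tendsto_norm tempered_gauss_damping V \<theta>)
    have "cmod (V (\<lambda>x. gauss (1 / real (Suc n)) x * \<theta> x)) \<le> D * h1_norm \<theta>" for n
    proof -
      interpret damped_multiplier V C "1 / real (Suc n)" by unfold_locales simp_all
      show ?thesis unfolding D_def by (rule damped_bound[OF B \<theta>])
    qed
    then show "\<exists>N. \<forall>n\<ge>N. cmod (V (\<lambda>x. gauss (1 / real (Suc n)) x * \<theta> x)) \<le> D * h1_norm \<theta>" by blast
  qed
  define u where "u \<psi> = inv_fourier (\<lambda>\<xi>. of_real (1 / bracket \<xi>) * \<psi> \<xi>)" for \<psi>
  have m\<psi>: "(\<lambda>\<xi>. of_real (1 / bracket \<xi>) * \<psi> \<xi>) \<in> schwartz" if "\<psi> \<in> schwartz" for \<psi>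
    by (rule schwartz_mult_slow[OF slow_inverse_bracket that])
  have u: "u \<psi> \<in> schwartz" if "\<psi> \<in> schwartz" for \<psi>
    unfolding u_def by (intro schwartz_inv_fourier m\<psi> that)
  have weighted: "sobolev_weighted (-1) V \<psi> = V (u \<psi>)" for \<psi>
    unfolding sobolev_weighted_def dist_mult_def dist_fourier_def u_def bracket_powr by simp
  obtain g where g: "g \<in> L2" "\<And>\<psi>. \<psi> \<in> schwartz \<Longrightarrow> sobolev_weighted (-1) V \<psi> = L2_inner \<psi> g"
  proof (rule L2_Riesz[OF L2_subspace_schwartz, of "sobolev_weighted (-1) V" D])
    show "sobolev_weighted (-1) V (\<lambda>x. \<phi> x + \<psi> x) = sobolev_weighted (-1) V \<phi> + sobolev_weighted (-1) V \<psi>"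
      if "\<phi> \<in> schwartz" "\<psi> \<in> schwartz" for \<phi> \<psi>
    proof -
      have "u (\<lambda>x. \<phi> x + \<psi> x) = (\<lambda>x. u \<phi> x + u \<psi> x)"
        unfolding u_def using inv_fourier_add[OF m\<psi>[OF that(1)] m\<psi>[OF that(2)]] by (simp add: distrib_left add_divide_distrib)
      then show ?thesis by (simp add: weighted V_add u that)
    qed
    show "sobolev_weighted (-1) V (\<lambda>x. c * \<psi> x) = cnj c * sobolev_weighted (-1) V \<psi>" if "\<psi> \<in> schwartz" for c \<psi>
    proof -
      have "u (\<lambda>x. c * \<psi> x) = (\<lambda>x. c * u \<psi> x)"
        unfolding u_def inv_fourier_scale[symmetric] by (simp add: mult.left_commute)
      then show ?thesis by (simp add: weighted V_scale u that)
    qed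
    show "cmod (sobolev_weighted (-1) V \<psi>) \<le> D * L2_norm \<psi>" if \<psi>: "\<psi> \<in> schwartz" for \<psi>
    proof -
      have "h1_norm (u \<psi>) = L2_norm \<psi>"
        unfolding h1_norm_def u_def fourier_inv_fourier[OF m\<psi>[OF \<psi>]] by simp
      then show ?thesis using bound[OF u[OF \<psi>]] by (simp add: weighted)
    qed
  qed (use that in blast)
  have "is_function (sobolev_weighted (-1) V) g"
    unfolding is_function_def
    using g by (auto simp: dist_of_fun_def L2_inner_def intro: L2_inner_integrable schwartz_L2)
  then show ?thesis using g(1) V by (auto simp: sobolev_def)
qed

theorem proposition3p1:
  shows
    "(\<forall>V \<in> sobolev (-1).
        (\<forall>\<kappa>>0. hilbert_schmidt (sandwiched \<kappa> V)) \<and>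
        (\<forall>\<kappa>>0.
           integrable lborel
             (\<lambda>\<xi>. (cmod (fun_of_dist (dist_fourier V) \<xi>))\<^sup>2 / (\<xi>\<^sup>2 + 4 * \<kappa>\<^sup>2)) \<and>
           (hs_norm (sandwiched \<kappa> V))\<^sup>2 =
             1 / \<kappa> * (LINT \<xi>|lborel.
               (cmod (fun_of_dist (dist_fourier V) \<xi>))\<^sup>2 / (\<xi>\<^sup>2 + 4 * \<kappa>\<^sup>2))) \<and>
        ((\<lambda>\<kappa>. hs_norm (sandwiched \<kappa> V)) \<longlongrightarrow> 0) at_top) \<and>
     (\<forall>V. sobolev_multiplier V \<longrightarrow>
        ((\<forall>\<kappa>>0. hilbert_schmidt (sandwiched \<kappa> V)) \<longleftrightarrow> V \<in> sobolev (-1)))"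
proof -
  have ns: "\<exists>g. negative_sobolev V g" if "V \<in> sobolev (-1)" for V
    using that by (auto simp: sobolev_def negative_sobolev_def)
  have forward: "hilbert_schmidt (sandwiched \<kappa> V)" if "V \<in> sobolev (-1)" "\<kappa> > 0" for V \<kappa>
    using ns[OF that(1)] negative_sobolev.sandwiched_hilbert_schmidt(1)[OF _ that(2)] by blast
  show ?thesis
  proof (intro conjI ballI allI impI)
    fix V assume Vs: "V \<in> sobolev (-1)"
    obtain g where "negative_sobolev V g" using ns[OF Vs] by blast
    then interpret negative_sobolev V g .
    show "hilbert_schmidt (sandwiched \<kappa> V)" if "\<kappa> > 0" for \<kappa> by (rule forward[OF Vs that])
    show "integrable lborel (\<lambda>\<xi>. (cmod (fun_of_dist (dist_fourier V) \<xi>))\<^sup>2 / (\<xi>\<^sup>2 + 4 * \<kappa>\<^sup>2))" if "\<kappa> > 0" for \<kappa>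
      by (rule hs_square_fun_of_dist(1)[OF that])
    show "(hs_norm (sandwiched \<kappa> V))\<^sup>2 = 1 / \<kappa> * (LINT \<xi>|lborel.
        (cmod (fun_of_dist (dist_fourier V) \<xi>))\<^sup>2 / (\<xi>\<^sup>2 + 4 * \<kappa>\<^sup>2))" if "\<kappa> > 0" for \<kappa>
      using sandwiched_hilbert_schmidt(2)[OF that] hs_square_fun_of_dist(2)[OF that] by simp
    show "((\<lambda>\<kappa>. hs_norm (sandwiched \<kappa> V)) \<longlongrightarrow> 0) at_top" by (rule hs_norm_tendsto_zero)
  next
    fix V assume "sobolev_multiplier V"
    then show "(\<forall>\<kappa>>0. hilbert_schmidt (sandwiched \<kappa> V)) \<longleftrightarrow> V \<in> sobolev (-1)"
      using forward hilbert_schmidt_multiplier_in_sobolev zero_less_one by blast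
  qed
qed

end
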